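(* Let $n>1$ and $1<p\le q<\infty$ be such that $\Theta(1):=1+n\left(\frac1q-\frac1p\right)>0$ and $q<n/\Theta(1)$. Let $v\in RH_\infty(\mathbb{R}^n)$ be such that $v^{-p'/p}\in A_\infty(\mathbb{R}^n)$, where $\frac1p+\frac1{p'}=1$. Then there exists $C>0$, depending only on $n,p,q,[v^{-p'/p}]_{A_\infty}$ and $[v]_{RH_\infty}$, such that $$\left(\int_{\mathbb{R}^n}|f(x)|^q\,\mathcal{M}(g)(x)^{\Theta(1)q/n}\,v(x)^{q/p}\,dx\right)^{1/q}\le C\,\|g\|_{L^1(\mathbb{R}^n)}^{\Theta(1)/n}\left(\int_{\mathbb{R}^n}|\nabla f(x)|^p v(x)\,dx\right)^{1/p}$$ for every $f\in C_0^1(\mathbb{R}^n)$ and $g\in L^1(\mathbb{R}^n)$.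
   Context: $Q$ denotes a cube in $\mathbb{R}^n$ with sides parallel to the coordinate axes, and suprema over $Q$ are over all such cubes. $\mathcal{M}(g)(x)=\sup_{Q\ni x}\frac1{|Q|}\int_Q|g|$ is the Hardy--Littlewood maximal function. $C_0^1(\mathbb{R}^n)$ is the set of continuously differentiable functions on $\mathbb{R}^n$ vanishing at infinity. A weight is a function $w\in L^1_{\rm loc}(\mathbb{R}^n)$ with $w\ge0$ a.e.; $w\in A_\infty(\mathbb{R}^n)$ means $[w]_{A_\infty}:=\sup_Q\left(\frac1{|Q|}\int_Q w\right)\exp\left(-\frac1{|Q|}\int_Q\ln w\right)<\infty$; $w\in RH_\infty(\mathbb{R}^n)$ means $[w]_{RH_\infty}:=\sup_Q\left(\operatorname{ess\,sup}_Q w\right)\left(\frac1{|Q|}\int_Q w\right)^{-1}<\infty$. *)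

theory Defs
  imports "HOL-Analysis.Analysis" "HOL-Probability.Essential_Supremum"
begin

text \<open>
  Weights are taken with values in \<open>[0, \<infinity>]\<close>, so that a negative power of a weight is again
  a function of the same kind: it is \<open>\<infinity>\<close> where the weight is \<open>0\<close>. (The library powers and
  logarithms of reals have \<open>0 powr a = 0\<close> and \<open>ln 0 = 0\<close>, and the Bochner integral of a
  non-integrable function is \<open>0\<close>; none of this may enter the weight conditions.)
\<close>

definition epowr :: "ennreal \<Rightarrow> real \<Rightarrow> ennreal"  (infixr \<open>epowr\<close> 80) where
  "x epowr a =
     (if a = 0 then 1
      else if x = 0 then (if a > 0 then 0 else \<infinity>)
      else if x = \<infinity> then (if a > 0 then \<infinity> else 0)
      else ennreal (enn2real x powr a))"

definition eln :: "ennreal \<Rightarrow> ereal" where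
  "eln x = (if x = 0 then -\<infinity> else if x = \<infinity> then \<infinity> else ereal (ln (enn2real x)))"

definition eexp :: "ereal \<Rightarrow> ennreal" where
  "eexp x = (if x = -\<infinity> then 0 else if x = \<infinity> then \<infinity> else ennreal (exp (real_of_ereal x)))"

definition cubes :: "(real ^ 'n) set set" where
  "cubes = {cbox a b | a b. \<exists>l>0. \<forall>i. b $ i - a $ i = l}"

definition average :: "(real ^ 'n) set \<Rightarrow> (real ^ 'n \<Rightarrow> ennreal) \<Rightarrow> ennreal" where
  "average Q w = (\<integral>\<^sup>+x\<in>Q. w x \<partial>lebesgue) / emeasure lebesgue Q"

text \<open>
  Average of a signed extended-real function, as positive part minus negative part. For
  \<open>h = ln w\<close> with \<open>w\<close> locally integrable the positive part has finite average
  (\<open>ln w \<le> w\<close>), so the difference is meaningful and lies in \<open>[-\<infinity>, \<infinity>)\<close>.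
\<close>

definition signed_average :: "(real ^ 'n) set \<Rightarrow> (real ^ 'n \<Rightarrow> ereal) \<Rightarrow> ereal" where
  "signed_average Q h =
     enn2ereal (average Q (\<lambda>x. e2ennreal (h x))) - enn2ereal (average Q (\<lambda>x. e2ennreal (- h x)))"

definition maximal_function :: "(real ^ 'n \<Rightarrow> real) \<Rightarrow> real ^ 'n \<Rightarrow> ennreal" where
  "maximal_function g x = (SUP Q\<in>{Q \<in> cubes. x \<in> Q}. average Q (\<lambda>y. ennreal \<bar>g y\<bar>))"

definition weight :: "(real ^ 'n \<Rightarrow> ennreal) \<Rightarrow> bool" where
  "weight w \<longleftrightarrow> w \<in> borel_measurable lebesgue \<and>
     (\<forall>K. compact K \<longrightarrow> (\<integral>\<^sup>+x\<in>K. w x \<partial>lebesgue) < \<infinity>)"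

text \<open>
  In the next two constants the product \<open>0 * \<infinity> = 0\<close> arises only on a cube where \<open>w = 0\<close> almost
  everywhere.
\<close>

definition A_inf_const :: "(real ^ 'n \<Rightarrow> ennreal) \<Rightarrow> ennreal" where
  "A_inf_const w =
     (SUP Q\<in>cubes. average Q w * eexp (- signed_average Q (\<lambda>x. eln (w x))))"

definition A_inf :: "(real ^ 'n \<Rightarrow> ennreal) set" where
  "A_inf = {w. weight w \<and> A_inf_const w < \<infinity>}"

definition RH_inf_const :: "(real ^ 'n \<Rightarrow> ennreal) \<Rightarrow> ennreal" where
  "RH_inf_const w =
     (SUP Q\<in>cubes. esssup (restrict_space lebesgue Q) w * inverse (average Q w))"

definition RH_inf :: "(real ^ 'n \<Rightarrow> ennreal) set" where
  "RH_inf = {w. weight w \<and> RH_inf_const w < \<infinity>}"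

definition gradient :: "(real ^ 'n \<Rightarrow> real) \<Rightarrow> real ^ 'n \<Rightarrow> real ^ 'n" where
  "gradient f x = (THE D. GDERIV f x :> D)"

text \<open>Only \<open>f\<close> itself, not its gradient, is required to vanish at infinity.\<close>

definition C1_0 :: "(real ^ 'n \<Rightarrow> real) set" where
  "C1_0 = {f. (\<forall>x. \<exists>D. GDERIV f x :> D) \<and> continuous_on UNIV (gradient f) \<and>
              (f \<longlongrightarrow> 0) at_infinity}"

end

theory Submission
  imports Defs
begin

text \<open>
  Write \<open>F\<close> for the norm of the gradient and \<open>\<sigma> = v powr (- 1 / (p - 1))\<close>. Telescoping the averages of
  \<open>f\<close> over the dyadic cubes \<open>Q\<close> containing \<open>x\<close>, the Poincare inequality bounds \<open>f x\<close> by the sum of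
  side length times average of \<open>F\<close> over these cubes. The maximal function defines a scale at \<open>x\<close>:
  the integer \<open>k\<close> with \<open>M g(x)\<close> comparable to \<open>2 powr (- k n)\<close> times the norm of \<open>g\<close>. For each fixed
  difference \<open>j\<close> between the scale of \<open>Q\<close> and this \<open>k\<close>, the sets of points of \<open>Q\<close> with that difference
  satisfy a Carleson packing condition with constant \<open>min 1 (C 2 powr (- j n))\<close>, by the weak type
  inequality. The Carleson embedding theorem is used twice, once with Lebesgue measure, where the
  \<open>A_inf\<close> condition of \<open>\<sigma>\<close> turns the packing condition into one for the measure \<open>\<sigma> dx\<close>, and once with
  \<open>\<sigma> dx\<close>, where the \<open>A_p\<close> condition of \<open>v\<close> enters. The resulting bounds are summable over \<open>j\<close> because
  \<open>0 < \<Theta> q < n\<close>.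

  The \<open>A_p\<close> condition holds because \<open>\<sigma>\<close> belongs to \<open>A_inf\<close> by hypothesis and \<open>v\<close> does because of
  \<open>RH_inf\<close>; the latter is proved by a Bellman function argument along the dyadic tree.
\<close>

section \<open>Sums over trees\<close>

text \<open>The value of \<open>\<Theta>\<close> is an identity of exponents. Put \<alpha> =
  \<Theta> q. A cube Q of side l whose scale exceeds the index k of the level set by j contributes
  l^q 2^(- \<alpha> k) to the integrand. Since q - \<alpha> = n (q/p - 1), this is 2^(\<alpha> j)
  times |Q|^(q/p - 1), and the condition 0 < \<alpha> < n makes 2^(\<alpha> j) times the packing
  constant decay for j of either sign.

  If q > p, the surplus power q/p - 1 of |Q| v_Q F_Q^p is estimated on the single cube by the total
  energy, so that the Carleson theorem is needed with the exponent p only.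

  \<open>RH_inf\<close> acts twice. Pointwise, v \<le> K v_Q almost everywhere on Q replaces the
  weight by its averages. Along the tree, it bounds the accumulated variance of the averages of v,
  so that v_Q is comparable to the geometric mean of v on Q with an explicit constant and no
  self-improvement of the weight is invoked.

  Tree sums are cut off at a finite depth and estimated uniformly in it, so that they are finite
  sums of reals; infinitely many scales enter by monotone convergence afterwards.\<close>

fun tree_sum :: "('a \<Rightarrow> 'a set) \<Rightarrow> nat \<Rightarrow> ('a \<Rightarrow> real) \<Rightarrow> 'a \<Rightarrow> real" where
  "tree_sum ch 0 f Q = 0"
| "tree_sum ch (Suc m) f Q = f Q + (\<Sum>R\<in>ch Q. tree_sum ch m f R)"

fun leaf_sum :: "('a \<Rightarrow> 'a set) \<Rightarrow> nat \<Rightarrow> ('a \<Rightarrow> real) \<Rightarrow> 'a \<Rightarrow> real" where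
  "leaf_sum ch 0 f Q = f Q"
| "leaf_sum ch (Suc m) f Q = (\<Sum>R\<in>ch Q. leaf_sum ch m f R)"

lemma tree_sum_nonneg: "(\<And>R. 0 \<le> f R) \<Longrightarrow> 0 \<le> tree_sum ch m f Q"
  by (induction m arbitrary: Q) (auto intro!: add_nonneg_nonneg sum_nonneg)

lemma tree_sum_mono: "(\<And>R. f R \<le> g R) \<Longrightarrow> tree_sum ch m f Q \<le> tree_sum ch m g Q"
  by (induction m arbitrary: Q) (auto intro!: add_mono sum_mono)

lemma tree_sum_cmult: "tree_sum ch m (\<lambda>R. c * f R) Q = c * tree_sum ch m f Q"
  by (induction m arbitrary: Q) (auto simp: sum_distrib_left distrib_left)

section \<open>Hoelder's inequality on a tree and the Carleson embedding theorem\<close>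

lemma powr_tangent:
  fixes r x t :: real
  assumes "1 < r" "0 \<le> x" "0 \<le> t"
  shows "t powr r + r * t powr (r - 1) * (x - t) \<le> x powr r"
proof (cases "t = 0")
  case True
  then show ?thesis using assms by simp
next
  case False
  with assms have t: "t > 0" by simp
  show ?thesis
  proof (cases "x = 0")
    case True
    have "t powr r = t powr (r - 1) * t"
      using t by (simp add: powr_diff)
    then show ?thesis using True assms t by (simp add: algebra_simps)
  next
    case False
    with assms have x: "x > 0" by simp
    have cv: "convex_on {0<..} (\<lambda>x::real. x powr r)"
      using powr_convex[of r] assms by simp
    have "x powr r - t powr r \<ge> (r * t powr (r - 1)) * (x - t)"
    proof (rule convex_on_imp_above_tangent[OF cv])
      show "t \<in> interior {0<..}" using t by (simp add: interior_open)
      show "((\<lambda>x. x powr r) has_real_derivative r * t powr (r - 1)) (at t within {0<..})"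
        by (rule has_field_derivative_at_within, rule has_real_derivative_powr[OF t])
    qed (use x in auto)
    then show ?thesis by simp
  qed
qed

text \<open>Hoelder's inequality in Radon's form. Each summand equals
  \<open>N R * (I R / N R) powr r\<close>; \<open>powr_tangent\<close> is applied at the quotient
  \<open>T\<close> of the totals, where the linear terms add up to zero.
  \<open>holder_set_integral\<close> repeats the argument for integrals.\<close>

lemma radon_inequality:
  fixes r :: real
  assumes r: "1 < r" and I: "\<And>R. R \<in> S \<Longrightarrow> 0 \<le> I R" and N: "\<And>R. R \<in> S \<Longrightarrow> 0 < N R"
    and fin: "finite S" "S \<noteq> {}"
  shows "sum I S powr r / sum N S powr (r - 1) \<le> (\<Sum>R\<in>S. I R powr r / N R powr (r - 1))"
proof -
  define T where "T = sum I S / sum N S"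
  have Npos: "sum N S > 0" using N fin by (simp add: sum_pos)
  have T: "T \<ge> 0" unfolding T_def using I Npos by (simp add: sum_nonneg)
  have IT: "sum I S = T * sum N S" using Npos by (simp add: T_def)
  have eq: "a powr r / b powr (r - 1) = b * (a / b) powr r" if "b > 0" "a \<ge> 0" for a b :: real
    using that by (simp add: powr_divide powr_diff)
  have "sum I S powr r / sum N S powr (r - 1) = sum N S * T powr r"
    using eq[OF Npos, of "sum I S"] I by (simp add: T_def sum_nonneg)
  also have "\<dots> = sum N S * T powr r + r * T powr (r - 1) * (sum I S - T * sum N S)"
    by (simp add: IT)
  also have "\<dots> = (\<Sum>R\<in>S. N R * T powr r + r * T powr (r - 1) * (I R - T * N R))"
    by (simp add: sum.distrib sum_subtractf sum_distrib_left sum_distrib_right right_diff_distrib mult.assoc)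
  also have "\<dots> \<le> (\<Sum>R\<in>S. I R powr r / N R powr (r - 1))"
  proof (rule sum_mono)
    fix R assume R: "R \<in> S"
    have "N R * (T powr r + r * T powr (r - 1) * (I R / N R - T)) \<le> N R * (I R / N R) powr r"
      using powr_tangent[OF r, of "I R / N R" T] N[OF R] I[OF R] T
      by (intro mult_left_mono) auto
    moreover have "N R * (T powr r + r * T powr (r - 1) * (I R / N R - T))
        = N R * T powr r + r * T powr (r - 1) * (I R - T * N R)"
      using N[OF R] by (simp add: field_simps)
    ultimately show "N R * T powr r + r * T powr (r - 1) * (I R - T * N R) \<le> I R powr r / N R powr (r - 1)"
      using eq[OF N[OF R] I[OF R]] by simp
  qed
  finally show ?thesis .
qed

text \<open>As a function of \<open>N\<close>, the expression
  \<open>i powr r / N powr (r - 1)\<close> is convex with derivative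
  \<open>- (r - 1) * (i / N) powr r\<close>. The tangent at the right endpoint
  \<open>N + \<mu>\<close> bounds the decrease from below, and
  \<open>N + \<mu> \<le> 2 * \<nu>\<close> turns its slope into a multiple of
  \<open>(i / \<nu>) powr r\<close>.\<close>

lemma carleson_step:
  fixes r :: real
  assumes r: "1 < r" and "0 < \<nu>" "\<nu> \<le> N" "N + \<mu> \<le> 2 * \<nu>" "0 \<le> \<mu>" "0 \<le> i"
  shows "(r - 1) * 2 powr (- r) * (\<mu> * (i / \<nu>) powr r) + i powr r / (N + \<mu>) powr (r - 1)
       \<le> i powr r / N powr (r - 1)"
proof -
  define M where "M = N + \<mu>"
  have M: "M > 0" "M \<le> 2 * \<nu>" "N > 0" using assms by (auto simp: M_def)
  have tang: "M powr (1 - r) + (r - 1) * \<mu> * M powr (- r) \<le> N powr (1 - r)"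
  proof -
    have "1 + (r - 1) * (\<mu> / M) \<le> (N / M) powr (1 - r)"
    proof -
      have "(r - 1) * (\<mu> / M) \<le> (1 - r) * ln (N / M)"
      proof -
        have "ln (N / M) \<le> N / M - 1" using M by (intro ln_le_minus_one) auto
        also have "\<dots> = - \<mu> / M" using M by (simp add: M_def field_simps)
        finally have "(r - 1) * ln (N / M) \<le> (r - 1) * (- \<mu> / M)"
          using r by (intro mult_left_mono) auto
        then show ?thesis by (simp add: algebra_simps)
      qed
      then have "exp ((r - 1) * (\<mu> / M)) \<le> exp ((1 - r) * ln (N / M))" by simp
      moreover have "1 + (r - 1) * (\<mu> / M) \<le> exp ((r - 1) * (\<mu> / M))"
        by (rule exp_ge_add_one_self)
      moreover have "exp ((1 - r) * ln (N / M)) = (N / M) powr (1 - r)"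
        using M by (auto simp: powr_def)
      ultimately show ?thesis by linarith
    qed
    then have "M powr (1 - r) * (1 + (r - 1) * (\<mu> / M)) \<le> M powr (1 - r) * (N / M) powr (1 - r)"
      by (intro mult_left_mono) auto
    moreover have "M powr (1 - r) * (N / M) powr (1 - r) = N powr (1 - r)"
      using M by (simp add: powr_divide)
    moreover have "M powr (1 - r) * (1 + (r - 1) * (\<mu> / M)) = M powr (1 - r) + (r - 1) * \<mu> * M powr (- r)"
    proof -
      have "M powr (- r) = M powr (1 - r) / M" using M by (simp add: powr_diff powr_minus field_simps)
      then show ?thesis by (simp add: algebra_simps)
    qed
    ultimately show ?thesis by simp
  qed
  have "2 powr (- r) * \<nu> powr (- r) = (2 * \<nu>) powr (- r)"
    using assms by (simp add: powr_mult)
  also have "\<dots> \<le> M powr (- r)"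
    using M r by (intro powr_mono2') auto
  finally have "(r - 1) * \<mu> * (2 powr (- r) * \<nu> powr (- r)) \<le> (r - 1) * \<mu> * M powr (- r)"
    using r assms by (intro mult_left_mono) auto
  with tang have "M powr (1 - r) + (r - 1) * \<mu> * (2 powr (- r) * \<nu> powr (- r)) \<le> N powr (1 - r)"
    by linarith
  then have "i powr r * (M powr (1 - r) + (r - 1) * \<mu> * (2 powr (- r) * \<nu> powr (- r))) \<le> i powr r * N powr (1 - r)"
    by (intro mult_left_mono) auto
  moreover have "(i / \<nu>) powr r = i powr r * \<nu> powr (- r)"
    using assms by (simp add: powr_divide powr_minus field_simps)
  moreover have "i powr r / x powr (r - 1) = i powr r * x powr (1 - r)" if "x > 0" for x :: real
    using that powr_minus_divide[of x "r - 1"] by simp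
  ultimately show ?thesis
    using M unfolding M_def[symmetric] by (simp add: algebra_simps)
qed

text \<open>
  The Bellman function \<open>I powr r / N powr (r - 1)\<close> of the Carleson embedding theorem is
  subadditive over the children of a node, and adding the weight \<open>\<mu>\<close> of the node to \<open>N\<close>
  decreases it by at least a multiple of the new summand.
\<close>

lemma carleson_embedding:
  fixes r A :: real
  assumes r: "1 < r" and A: "0 < A"
    and fin: "\<And>Q. finite (ch Q)" and ne: "\<And>Q. ch Q \<noteq> {}"
    and \<nu>: "\<And>Q. 0 < \<nu> Q" and \<nu>_add: "\<And>Q. (\<Sum>R\<in>ch Q. \<nu> R) = \<nu> Q"
    and I: "\<And>Q. 0 \<le> I Q" and I_add: "\<And>Q. (\<Sum>R\<in>ch Q. I R) = I Q"
    and V_add: "\<And>Q. (\<Sum>R\<in>ch Q. V R) = V Q"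
    and IV: "\<And>Q. I Q powr r / \<nu> Q powr (r - 1) \<le> V Q"
    and \<mu>: "\<And>Q. 0 \<le> \<mu> Q" and car: "\<And>m Q. tree_sum ch m \<mu> Q \<le> A * \<nu> Q"
  shows "tree_sum ch m (\<lambda>R. \<mu> R * (I R / \<nu> R) powr r) Q \<le> 2 powr r / (r - 1) * A * V Q"
proof -
  define \<mu>' where "\<mu>' = (\<lambda>R. inverse A * \<mu> R)"
  have \<mu>': "\<And>Q. 0 \<le> \<mu>' Q" using \<mu> A by (simp add: \<mu>'_def)
  have car': "tree_sum ch m \<mu>' Q \<le> \<nu> Q" for m Q
  proof -
    have "inverse A * tree_sum ch m \<mu> Q \<le> inverse A * (A * \<nu> Q)"
      using car[of m Q] A by (intro mult_left_mono) auto
    also have "inverse A * (A * \<nu> Q) = \<nu> Q" using A by simp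
    finally show ?thesis unfolding \<mu>'_def tree_sum_cmult[of ch m "inverse A" \<mu> Q] .
  qed
  define c where "c = (r - 1) * 2 powr (- r)"
  have c: "c > 0" using r by (simp add: c_def)
  \<comment> \<open>After division by \<open>A\<close> the weight packed below \<open>Q\<close> is
    at most \<open>\<nu> Q\<close>. So \<open>N m Q\<close> stays between \<open>\<nu> Q\<close> and
    \<open>2 * \<nu> Q\<close>, the range in which \<open>carleson_step\<close> is
    available.\<close>
  define N where "N m Q = \<nu> Q + tree_sum ch m \<mu>' Q" for m Q
  have N_ge: "N m Q \<ge> \<nu> Q" for m Q by (simp add: N_def tree_sum_nonneg \<mu>')
  have main: "c * tree_sum ch m (\<lambda>R. \<mu>' R * (I R / \<nu> R) powr r) Q + I Q powr r / N m Q powr (r - 1) \<le> V Q"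
    for m Q
  proof (induction m arbitrary: Q)
    case 0
    then show ?case using IV by (simp add: N_def)
  next
    case (Suc m)
    let ?g = "\<lambda>R. \<mu>' R * (I R / \<nu> R) powr r"
    define N' where "N' = (\<Sum>R\<in>ch Q. N m R)"
    have N'_ge: "\<nu> Q \<le> N'"
      using sum_mono[of "ch Q" \<nu> "N m"] N_ge by (simp add: N'_def \<nu>_add)
    have NS: "N (Suc m) Q = N' + \<mu>' Q"
      by (simp add: N_def N'_def sum.distrib \<nu>_add)
    have N2: "N' + \<mu>' Q \<le> 2 * \<nu> Q"
      unfolding NS[symmetric] using car'[of "Suc m" Q] by (simp add: N_def)
    have step: "c * ?g Q + I Q powr r / N (Suc m) Q powr (r - 1) \<le> I Q powr r / N' powr (r - 1)"
      unfolding NS c_def by (rule carleson_step[OF r \<nu> N'_ge N2 \<mu>' I])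
    have rad: "I Q powr r / N' powr (r - 1) \<le> (\<Sum>R\<in>ch Q. I R powr r / N m R powr (r - 1))"
      using radon_inequality[OF r, of "ch Q" I "N m"] I fin ne less_le_trans[OF \<nu> N_ge]
      by (simp add: N'_def I_add)
    have "(\<Sum>R\<in>ch Q. c * tree_sum ch m ?g R + I R powr r / N m R powr (r - 1)) \<le> (\<Sum>R\<in>ch Q. V R)"
      by (intro sum_mono Suc.IH)
    then have "c * (\<Sum>R\<in>ch Q. tree_sum ch m ?g R) + (\<Sum>R\<in>ch Q. I R powr r / N m R powr (r - 1)) \<le> V Q"
      unfolding V_add sum.distrib sum_distrib_left .
    moreover have "c * tree_sum ch (Suc m) ?g Q = c * ?g Q + c * (\<Sum>R\<in>ch Q. tree_sum ch m ?g R)"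
      by (simp only: tree_sum.simps distrib_left)
    ultimately show ?case using step rad by linarith
  qed
  have "c * tree_sum ch m (\<lambda>R. \<mu>' R * (I R / \<nu> R) powr r) Q \<le> V Q"
  proof -
    have "0 \<le> I Q powr r / N m Q powr (r - 1)" by simp
    with main[of m Q] show ?thesis by linarith
  qed
  moreover have "tree_sum ch m (\<lambda>R. \<mu>' R * (I R / \<nu> R) powr r) Q
      = inverse A * tree_sum ch m (\<lambda>R. \<mu> R * (I R / \<nu> R) powr r) Q"
    using tree_sum_cmult[of ch m "inverse A" "\<lambda>R. \<mu> R * (I R / \<nu> R) powr r" Q]
    by (simp only: \<mu>'_def mult.assoc)
  ultimately have "c * (inverse A * tree_sum ch m (\<lambda>R. \<mu> R * (I R / \<nu> R) powr r) Q) \<le> V Q" by simp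
  then have "tree_sum ch m (\<lambda>R. \<mu> R * (I R / \<nu> R) powr r) Q \<le> (1 / c) * A * V Q"
    using A c by (simp add: field_simps)
  moreover have "1 / c = 2 powr r / (r - 1)" by (simp add: c_def powr_minus field_simps)
  ultimately show ?thesis by simp
qed

section \<open>A lower bound for logarithms of averages along a tree\<close>

lemma ln_ge_quadratic:
  fixes t c :: real
  assumes "0 < c" "c \<le> t"
  shows "t - 1 - (t - 1)\<^sup>2 / c \<le> ln t"
proof -
  have t: "t > 0" using assms by simp
  have "ln (1 / t) \<le> 1 / t - 1" using t by (intro ln_le_minus_one) auto
  then have "1 - 1 / t \<le> ln t" using t by (simp add: ln_div)
  moreover have "1 - 1 / t = t - 1 - (t - 1)\<^sup>2 / t"
    using t by (simp add: field_simps power2_eq_square)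
  moreover have "(t - 1)\<^sup>2 / t \<le> (t - 1)\<^sup>2 / c"
    using assms by (intro divide_left_mono) auto
  ultimately show ?thesis by linarith
qed

text \<open>
  Passing to the children, the concavity loss of \<open>ln\<close> is at most a multiple of the variance of the
  averages \<open>X / W\<close>, and the gain of the square \<open>(X / W / M)\<^sup>2\<close> is at least a multiple of
  the same variance.
\<close>

lemma leaf_sum_ln_lower:
  fixes c K :: real
  assumes fin: "\<And>Q. finite (ch Q)"
    and W: "\<And>Q. 0 < W Q" and W_add: "\<And>Q. (\<Sum>R\<in>ch Q. W R) = W Q"
    and X: "\<And>Q. 0 < X Q" and X_add: "\<And>Q. (\<Sum>R\<in>ch Q. X R) = X Q"
    and c: "0 < c" and doubling: "\<And>Q R. R \<in> ch Q \<Longrightarrow> c * (X Q / W Q) \<le> X R / W R"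
    and M_lower: "\<And>Q. X Q / W Q \<le> M Q" and M_upper: "\<And>Q. M Q \<le> K * (X Q / W Q)"
    and M_mono: "\<And>Q R. R \<in> ch Q \<Longrightarrow> M R \<le> M Q"
  shows "W Q * (ln (X Q / W Q) - K\<^sup>2 / c) \<le> leaf_sum ch m (\<lambda>R. W R * ln (X R / W R)) Q"
proof -
  define x where "x Q = X Q / W Q" for Q
  define C where "C = K\<^sup>2 / c"
  have x: "x Q > 0" for Q using X W by (simp add: x_def)
  have M: "M Q > 0" for Q using M_lower[of Q] x[of Q] by (simp add: x_def)
  have C: "C \<ge> 0" using c by (simp add: C_def)
  define P where "P Q = W Q * (ln (x Q) + C * (x Q / M Q)\<^sup>2)" for Q
  \<comment> \<open>Any single node forces this; \<open>undefined\<close> stands for an arbitrary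
    one.\<close>
  have K: "K > 0"
    using M_upper[of undefined] M[of undefined] x[of undefined] unfolding x_def[symmetric]
    by (smt (verit) mult_nonpos_nonneg)
  have step: "P Q \<le> (\<Sum>R\<in>ch Q. P R)" for Q
  proof -
    define t where "t R = x R / x Q" for R
    have Wt: "W R * t R = X R / x Q" for R using W[of R] by (simp add: t_def x_def)
    have sWt: "(\<Sum>R\<in>ch Q. W R * t R) = W Q"
      unfolding Wt sum_divide_distrib[symmetric] X_add using X[of Q] W[of Q] by (simp add: x_def)
    define var where "var = (\<Sum>R\<in>ch Q. W R * (t R - 1)\<^sup>2)"
    have var: "var \<ge> 0" unfolding var_def using W by (intro sum_nonneg mult_nonneg_nonneg) (auto intro: less_imp_le)
    have "var = (\<Sum>R\<in>ch Q. W R * (t R)\<^sup>2 - 2 * (W R * t R) + W R)"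
      unfolding var_def by (intro sum.cong refl) (simp add: power2_eq_square algebra_simps)
    also have "\<dots> = (\<Sum>R\<in>ch Q. W R * (t R)\<^sup>2) - W Q"
      by (simp add: sum.distrib sum_subtractf sum_distrib_left[symmetric] sWt W_add)
    finally have sq: "(\<Sum>R\<in>ch Q. W R * (t R)\<^sup>2) = W Q + var" by simp
    \<comment> \<open>\<open>k\<close> is the coefficient of the variance gained from the squares,
      while the logarithms lose \<open>1 / c\<close> per unit of variance. As
      \<open>x Q / M Q\<close> is at least \<open>1 / K\<close>, the choice
      \<open>C = K\<^sup>2 / c\<close> makes the gain prevail.\<close>
    define k where "k = C * (x Q / M Q)\<^sup>2"
    have k: "k \<ge> 1 / c"
    proof -
      have "1 / K \<le> x Q / M Q"
        using M_upper[of Q] K M[of Q] unfolding x_def[symmetric] by (simp add: field_simps)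
      then have "(1 / K)\<^sup>2 \<le> (x Q / M Q)\<^sup>2" using K by (intro power_mono) auto
      then have "C * (1 / K)\<^sup>2 \<le> k" unfolding k_def using C by (intro mult_left_mono) auto
      then show ?thesis using K by (simp add: C_def power_divide)
    qed
    have each: "W R * (ln (x Q) + (t R - 1) - (t R - 1)\<^sup>2 / c + k * (t R)\<^sup>2) \<le> P R" if R: "R \<in> ch Q" for R
    proof -
      have "c \<le> t R" using doubling[OF R] x[of Q] unfolding x_def[symmetric] by (simp add: t_def field_simps)
      from ln_ge_quadratic[OF c this] have "ln (x Q) + (t R - 1) - (t R - 1)\<^sup>2 / c \<le> ln (x Q) + ln (t R)" by simp
      also have "\<dots> = ln (x R)" using x[of R] x[of Q] by (simp add: t_def ln_div)
      finally have 1: "ln (x Q) + (t R - 1) - (t R - 1)\<^sup>2 / c \<le> ln (x R)" .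
      \<comment> \<open>Since \<open>M\<close> decreases along the tree, the squares of all children
        may be measured against the common denominator \<open>M Q\<close>.\<close>
      have "x R / M Q \<le> x R / M R"
        using M_mono[OF R] M[of R] M[of Q] x[of R] by (intro divide_left_mono) auto
      then have "(x R / M Q)\<^sup>2 \<le> (x R / M R)\<^sup>2" using x[of R] M[of Q] by (intro power_mono) auto
      then have "C * (x R / M Q)\<^sup>2 \<le> C * (x R / M R)\<^sup>2" using C by (intro mult_left_mono) auto
      moreover have "k * (t R)\<^sup>2 = C * (x R / M Q)\<^sup>2"
        using x[of Q] by (simp add: k_def t_def power_divide)
      ultimately have "ln (x Q) + (t R - 1) - (t R - 1)\<^sup>2 / c + k * (t R)\<^sup>2 \<le> ln (x R) + C * (x R / M R)\<^sup>2"
        using 1 by linarith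
      then show ?thesis unfolding P_def using W[of R] by (intro mult_left_mono) auto
    qed
    have "P Q = W Q * ln (x Q) + k * W Q" by (simp add: P_def k_def algebra_simps)
    also have "\<dots> \<le> W Q * ln (x Q) - var / c + k * (W Q + var)"
      using mult_right_mono[OF k var] by (simp add: algebra_simps)
    also have "\<dots> = (\<Sum>R\<in>ch Q. W R * (ln (x Q) + (t R - 1) - (t R - 1)\<^sup>2 / c + k * (t R)\<^sup>2))"
    proof -
      have "(\<Sum>R\<in>ch Q. W R * (ln (x Q) + (t R - 1) - (t R - 1)\<^sup>2 / c + k * (t R)\<^sup>2))
          = (\<Sum>R\<in>ch Q. W R * ln (x Q) + (W R * t R - W R) - W R * (t R - 1)\<^sup>2 / c + k * (W R * (t R)\<^sup>2))"
        by (intro sum.cong refl) (simp add: algebra_simps)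
      also have "\<dots> = W Q * ln (x Q) + (W Q - W Q) - var / c + k * (W Q + var)"
        by (simp only: sum.distrib sum_subtractf sum_distrib_left[symmetric] sum_distrib_right[symmetric]
            sum_divide_distrib[symmetric] sWt W_add sq var_def[symmetric])
      finally show ?thesis by simp
    qed
    also have "\<dots> \<le> (\<Sum>R\<in>ch Q. P R)" by (intro sum_mono each)
    finally show ?thesis .
  qed
  have "P Q \<le> leaf_sum ch m (\<lambda>R. W R * ln (x R)) Q + C * W Q" for Q
  proof (induction m arbitrary: Q)
    case 0
    have "(x Q / M Q)\<^sup>2 \<le> 1"
      using M_lower[of Q] x[of Q] M[of Q] unfolding x_def[symmetric] by (simp add: power_le_one)
    then have "W Q * (C * (x Q / M Q)\<^sup>2) \<le> W Q * (C * 1)"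
      using C W[of Q] by (intro mult_left_mono) auto
    then show ?case by (simp add: P_def algebra_simps)
  next
    case (Suc m)
    have "P Q \<le> (\<Sum>R\<in>ch Q. P R)" by (rule step)
    also have "\<dots> \<le> (\<Sum>R\<in>ch Q. leaf_sum ch m (\<lambda>R. W R * ln (x R)) R + C * W R)"
      by (intro sum_mono Suc.IH)
    also have "\<dots> = leaf_sum ch (Suc m) (\<lambda>R. W R * ln (x R)) Q + C * W Q"
      by (simp add: sum.distrib sum_distrib_left[symmetric] W_add)
    finally show ?case .
  qed
  moreover have "W Q * ln (x Q) \<le> P Q" unfolding P_def using W[of Q] C by (intro mult_left_mono) auto
  ultimately have "W Q * ln (x Q) \<le> leaf_sum ch m (\<lambda>R. W R * ln (x R)) Q + C * W Q"
    using order_trans by blast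
  then show ?thesis by (simp add: x_def C_def algebra_simps)
qed

section \<open>Dyadic cubes\<close>

definition dindex :: "int \<Rightarrow> real ^ 'n \<Rightarrow> 'n \<Rightarrow> int" where
  "dindex i x = (\<lambda>a. \<lfloor>x $ a / 2 powr real_of_int i\<rfloor>)"

text \<open>A label consists of the scale, with side length \<open>2 powr fst Q\<close>, and an
  integer index. The cubes are half-open, so that each scale partitions the space and the cube of
  scale \<open>i\<close> around \<open>x\<close> has the label \<open>(i, dindex i x)\<close>; a
  coefficient attached to cubes thereby becomes a function of \<open>x\<close>. The closed versions
  \<open>dclosure\<close>, which belong to \<open>cubes\<close>, differ by null sets.\<close>

definition dcube :: "int \<times> ('n \<Rightarrow> int) \<Rightarrow> (real ^ 'n) set" where
  "dcube Q = {x. dindex (fst Q) x = snd Q}"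

definition dchild :: "int \<times> ('n \<Rightarrow> int) \<Rightarrow> (int \<times> ('n \<Rightarrow> int)) set" where
  "dchild Q = {(fst Q - 1, k) | k. \<forall>a. k a div 2 = snd Q a}"

definition dclosure :: "int \<times> ('n \<Rightarrow> int) \<Rightarrow> (real ^ 'n) set" where
  "dclosure Q = cbox (\<chi> a. 2 powr real_of_int (fst Q) * real_of_int (snd Q a))
     (\<chi> a. 2 powr real_of_int (fst Q) * real_of_int (snd Q a) + 2 powr real_of_int (fst Q))"

definition dvol :: "'n itself \<Rightarrow> int \<Rightarrow> real" where
  "dvol _ i = 2 powr (real CARD('n) * real_of_int i)"

lemma mem_dcube: "x \<in> dcube (i, k) \<longleftrightarrow> dindex i x = k"
  by (simp add: dcube_def)

lemma mem_dcube_dindex: "x \<in> dcube (i, dindex i x)"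
  by (simp add: dcube_def)

lemma dcube_mem_iff:
  "x \<in> dcube Q \<longleftrightarrow> (\<forall>a. 2 powr real_of_int (fst Q) * real_of_int (snd Q a) \<le> x $ a \<and>
     x $ a < 2 powr real_of_int (fst Q) * real_of_int (snd Q a) + 2 powr real_of_int (fst Q))"
  unfolding dcube_def dindex_def fun_eq_iff floor_eq_iff mem_Collect_eq
  by (simp add: field_simps)

lemma dindex_div: "dindex (i - 1) x a div 2 = dindex i x a"
proof -
  have "x $ a / 2 powr real_of_int i = (x $ a / 2 powr real_of_int (i - 1)) / real_of_int 2"
    by (simp add: powr_diff)
  then show ?thesis
    unfolding dindex_def by (simp only: floor_divide_real_eq_div)
qed

lemma dchild_fst: "R \<in> dchild Q \<Longrightarrow> fst R = fst Q - 1"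
  by (auto simp: dchild_def)

lemma dchild_subset: "R \<in> dchild Q \<Longrightarrow> dcube R \<subseteq> dcube Q"
  by (clarsimp simp: dchild_def dcube_def fun_eq_iff) (metis dindex_div)

lemma dcube_eq_UN_dchild: "dcube Q = (\<Union>R\<in>dchild Q. dcube R)"
proof (intro antisym subsetI)
  fix x assume "x \<in> dcube Q"
  then have "(fst Q - 1, dindex (fst Q - 1) x) \<in> dchild Q"
    by (auto simp: dchild_def dcube_def dindex_div)
  then show "x \<in> (\<Union>R\<in>dchild Q. dcube R)" using mem_dcube_dindex by blast
qed (use dchild_subset in blast)

lemma disjoint_dchild: "disjoint_family_on dcube (dchild Q)"
  by (auto simp: disjoint_family_on_def dchild_def dcube_def)

lemma finite_dchild: "finite (dchild (Q :: int \<times> ('n::finite \<Rightarrow> int)))"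
proof -
  have "dchild Q \<subseteq> Pair (fst Q - 1) ` (PiE UNIV (\<lambda>a. {2 * snd Q a, 2 * snd Q a + 1}))"
  proof
    fix R assume "R \<in> dchild Q"
    then obtain k where k: "R = (fst Q - 1, k)" "\<And>a. k a div 2 = snd Q a"
      by (auto simp: dchild_def)
    have "k a = 2 * snd Q a \<or> k a = 2 * snd Q a + 1" for a
      using k(2)[of a] by presburger
    then have "k \<in> PiE UNIV (\<lambda>a. {2 * snd Q a, 2 * snd Q a + 1})" by (auto simp: PiE_def)
    then show "R \<in> Pair (fst Q - 1) ` (PiE UNIV (\<lambda>a. {2 * snd Q a, 2 * snd Q a + 1}))"
      using k(1) by blast
  qed
  moreover have "finite (PiE UNIV (\<lambda>a::'n. {2 * snd Q a, 2 * snd Q a + 1}))"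
    by (intro finite_PiE) auto
  ultimately show ?thesis by (meson finite_imageI finite_subset)
qed

lemma dchild_nonempty: "dchild Q \<noteq> {}"
proof -
  have "(fst Q - 1, \<lambda>a. 2 * snd Q a) \<in> dchild Q" by (auto simp: dchild_def)
  then show ?thesis by blast
qed

lemma cart_interval_measure:
  fixes a :: "real ^ 'n" and l :: real
  assumes "0 < l"
  shows "measure lebesgue (cbox a (\<chi> i. a $ i + l)) = l ^ CARD('n)"
proof -
  have "cbox a (\<chi> i. a $ i + l) \<noteq> {}"
    using assms by (auto simp: mem_box_cart set_eq_iff intro!: exI[of _ a])
  then show ?thesis by (simp add: content_cbox_cart)
qed

lemma box_subset_dcube:
  "box (\<chi> a. 2 powr real_of_int (fst Q) * real_of_int (snd Q a))
     (\<chi> a. 2 powr real_of_int (fst Q) * real_of_int (snd Q a) + 2 powr real_of_int (fst Q)) \<subseteq> dcube Q"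
  by (auto simp: dcube_mem_iff mem_box_cart less_imp_le)

lemma dcube_subset_dclosure: "dcube Q \<subseteq> dclosure Q"
  by (auto simp: dcube_mem_iff dclosure_def mem_box_cart less_imp_le)

lemma dclosure_diff_dcube: "dclosure Q - dcube Q \<in> null_sets lebesgue"
proof -
  have "negligible (dclosure Q - dcube Q)"
    unfolding dclosure_def
    by (rule negligible_subset[OF negligible_frontier_interval]) (use box_subset_dcube in blast)
  then show ?thesis by (simp add: negligible_iff_null_sets)
qed

lemma sets_dcube [measurable, simp]: "dcube Q \<in> sets lebesgue"
proof -
  have "dcube Q = dclosure Q - (dclosure Q - dcube Q)" using dcube_subset_dclosure by blast
  moreover have "dclosure Q \<in> sets lebesgue" by (simp add: dclosure_def)
  ultimately show ?thesis using dclosure_diff_dcube[of Q] by (metis null_setsD2 sets.Diff)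
qed

lemma AE_dclosure_iff: "AE x in lebesgue. x \<in> dclosure Q \<longleftrightarrow> x \<in> dcube Q"
  using AE_not_in[OF dclosure_diff_dcube[of Q]] dcube_subset_dclosure[of Q] by (auto elim!: eventually_mono)

lemma measure_dclosure: "measure lebesgue (dclosure (Q :: int \<times> ('n::finite \<Rightarrow> int))) = dvol TYPE('n) (fst Q)"
proof -
  have "measure lebesgue (dclosure Q) = (2 powr real_of_int (fst Q)) ^ CARD('n)"
    using cart_interval_measure[of "2 powr real_of_int (fst Q)" "\<chi> a. 2 powr real_of_int (fst Q) * real_of_int (snd Q a)"]
    by (simp add: dclosure_def)
  also have "\<dots> = dvol TYPE('n) (fst Q)"
    by (simp add: dvol_def powr_realpow[symmetric] powr_powr mult.commute)
  finally show ?thesis .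
qed

lemma emeasure_dclosure: "emeasure lebesgue (dclosure (Q :: int \<times> ('n::finite \<Rightarrow> int))) = ennreal (dvol TYPE('n) (fst Q))"
proof -
  have "emeasure lebesgue (dclosure Q) = ennreal (measure lebesgue (dclosure Q))"
    by (rule emeasure_eq_ennreal_measure) (simp add: dclosure_def emeasure_lborel_cbox_eq)
  then show ?thesis by (simp add: measure_dclosure)
qed

lemma emeasure_dcube: "emeasure lebesgue (dcube (Q :: int \<times> ('n::finite \<Rightarrow> int))) = ennreal (dvol TYPE('n) (fst Q))"
proof -
  have "emeasure lebesgue (dcube Q) = emeasure lebesgue (dclosure Q)"
    by (rule emeasure_eq_AE) (use AE_dclosure_iff[of Q] in \<open>auto simp: dclosure_def elim!: eventually_mono\<close>)
  then show ?thesis by (simp only: emeasure_dclosure)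
qed

lemma dvol_pos [simp]: "0 < dvol TYPE('n) i"
  by (simp add: dvol_def)

lemma measure_dcube: "measure lebesgue (dcube (Q :: int \<times> ('n::finite \<Rightarrow> int))) = dvol TYPE('n) (fst Q)"
  using emeasure_dcube[of Q] by (simp add: measure_def less_imp_le[OF dvol_pos])

lemma measurable_dindex [measurable]:
  "(dindex i :: real ^ 'n \<Rightarrow> 'n \<Rightarrow> int) \<in> measurable lebesgue (count_space UNIV)"
proof (subst measurable_count_space_eq2_countable)
  show "(dindex i :: real ^ 'n \<Rightarrow> _) \<in> space lebesgue \<rightarrow> UNIV \<and> (\<forall>k\<in>UNIV. (dindex i :: real ^ 'n \<Rightarrow> _) -` {k} \<inter> space lebesgue \<in> sets lebesgue)"
  proof (intro conjI ballI)
    fix k :: "'n \<Rightarrow> int"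
    have "dindex i -` {k} \<inter> space lebesgue = dcube (i, k)" by (auto simp: dcube_def)
    then show "dindex i -` {k} \<inter> space lebesgue \<in> sets lebesgue" by simp
  qed simp
qed

lemma measurable_fun_dindex:
  "(\<lambda>x. c (dindex i x)) \<in> measurable lebesgue (borel :: 'b::topological_space measure)"
  by (rule measurable_compose[OF measurable_dindex]) simp

lemma indicator_dcube_eq_sum:
  "indicator (dcube (Q :: int \<times> ('n::finite \<Rightarrow> int))) x = (\<Sum>R\<in>dchild Q. indicator (dcube R) x)"
  by (subst dcube_eq_UN_dchild) (rule indicator_UN_disjoint[OF finite_dchild disjoint_dchild])

lemma nn_integral_dcube_eq_sum:
  fixes Q :: "int \<times> ('n::finite \<Rightarrow> int)"
  assumes [measurable]: "f \<in> borel_measurable lebesgue"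
  shows "(\<integral>\<^sup>+x\<in>dcube Q. f x \<partial>lebesgue) = (\<Sum>R\<in>dchild Q. \<integral>\<^sup>+x\<in>dcube R. f x \<partial>lebesgue)"
  by (subst indicator_dcube_eq_sum) (simp add: sum_distrib_left nn_integral_sum)

lemma set_integral_dcube_eq_sum:
  fixes Q :: "int \<times> ('n::finite \<Rightarrow> int)" and f :: "real ^ 'n \<Rightarrow> real"
  assumes "set_integrable lebesgue (dcube Q) f"
  shows "(LINT x:dcube Q|lebesgue. f x) = (\<Sum>R\<in>dchild Q. LINT x:dcube R|lebesgue. f x)"
  by (subst dcube_eq_UN_dchild, rule set_integral_finite_Union[OF finite_dchild disjoint_dchild])
     (auto intro: set_integrable_subset[OF assms _ dchild_subset])

lemma dvol_eq_sum: "dvol TYPE('n) (fst Q) = (\<Sum>R\<in>dchild Q. dvol TYPE('n) (fst R))"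
  for Q :: "int \<times> ('n::finite \<Rightarrow> int)"
proof -
  have "set_integrable lebesgue (dcube Q) (\<lambda>_. 1::real)"
    unfolding set_integrable_def by (simp add: integrable_indicator_iff emeasure_dcube)
  from set_integral_dcube_eq_sum[OF this] show ?thesis
    by (simp add: set_integral_const emeasure_dcube measure_dcube)
qed

text \<open>Sums over infinitely many cubes or scales are written as integrals over
  \<open>count_space\<close>, so that exchanging them with integrals is an instance of Tonelli's
  theorem and needs no summability.\<close>

lemma nn_integral_eq_sum_dcube:
  fixes f :: "real ^ 'n \<Rightarrow> ennreal"
  assumes [measurable]: "f \<in> borel_measurable lebesgue"
  shows "(\<integral>\<^sup>+x. f x \<partial>lebesgue) = (\<integral>\<^sup>+k. (\<integral>\<^sup>+x\<in>dcube (i, k). f x \<partial>lebesgue) \<partial>count_space UNIV)"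
proof -
  have "(\<integral>\<^sup>+k. f x * indicator (dcube (i, k)) x \<partial>count_space UNIV) = f x" for x
  proof -
    have "(\<integral>\<^sup>+k. f x * indicator (dcube (i, k)) x \<partial>count_space UNIV)
        = (\<integral>\<^sup>+k. f x * indicator {dindex i x} k \<partial>count_space UNIV)"
      by (intro nn_integral_cong) (auto simp: mem_dcube split: split_indicator)
    then show ?thesis by simp
  qed
  then have "(\<integral>\<^sup>+x. f x \<partial>lebesgue) = (\<integral>\<^sup>+x. (\<integral>\<^sup>+k. f x * indicator (dcube (i, k)) x \<partial>count_space UNIV) \<partial>lebesgue)"
    by simp
  also have "\<dots> = (\<integral>\<^sup>+k. (\<integral>\<^sup>+x\<in>dcube (i, k). f x \<partial>lebesgue) \<partial>count_space UNIV)"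
    by (rule nn_integral_count_space_nn_integral) auto
  finally show ?thesis .
qed

text \<open>The windows are half-open because \<open>sum_levels_le\<close> uses trees of
  \<open>2 * N\<close> generations rooted at scale \<open>N\<close>; these reach exactly the scales
  in \<open>{- int N<..int N}\<close>.\<close>

lemma nn_integral_count_space_int_le:
  fixes g :: "int \<Rightarrow> ennreal"
  assumes "\<And>N. (\<Sum>i\<in>{- int N<..int N}. g i) \<le> C"
  shows "(\<integral>\<^sup>+i. g i \<partial>count_space UNIV) \<le> C"
proof -
  have SUP: "(SUP N. g i * indicator {- int N<..int N} i) = g i" for i
  proof (rule antisym)
    have "i \<in> {- int (nat \<bar>i\<bar> + 1)<..int (nat \<bar>i\<bar> + 1)}" by auto
    then show "g i \<le> (SUP N. g i * indicator {- int N<..int N} i)"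
      by (intro SUP_upper2[of "nat \<bar>i\<bar> + 1"]) auto
  qed (auto intro!: SUP_least split: split_indicator)
  have "(\<integral>\<^sup>+i. g i \<partial>count_space UNIV) = (\<integral>\<^sup>+i. (SUP N. g i * indicator {- int N<..int N} i) \<partial>count_space UNIV)"
    by (simp add: SUP)
  also have "\<dots> = (SUP N. \<integral>\<^sup>+i. g i * indicator {- int N<..int N} i \<partial>count_space UNIV)"
    by (rule nn_integral_monotone_convergence_SUP)
       (auto simp: incseq_def le_fun_def split: split_indicator)
  also have "\<dots> \<le> C"
  proof (rule SUP_least)
    fix N
    have "(\<integral>\<^sup>+i. g i * indicator {- int N<..int N} i \<partial>count_space UNIV) = (\<Sum>i\<in>{- int N<..int N}. g i * indicator {- int N<..int N} i)"
      by (rule nn_integral_count_space') (auto split: split_indicator)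
    also have "\<dots> = (\<Sum>i\<in>{- int N<..int N}. g i)" by (intro sum.cong) auto
    finally show "(\<integral>\<^sup>+i. g i * indicator {- int N<..int N} i \<partial>count_space UNIV) \<le> C" using assms by simp
  qed
  finally show ?thesis .
qed

text \<open>Generation \<open>l\<close> partitions \<open>dcube Q\<close> into cubes of scale
  \<open>fst Q - int l\<close>, so it contributes a single integral over \<open>dcube Q\<close>. The
  set \<open>B\<close> may change with the scale, as the level sets of the maximal function
  will.\<close>

lemma tree_sum_eq_nn_integral:
  fixes c :: "int \<times> ('n::finite \<Rightarrow> int) \<Rightarrow> real" and B :: "int \<Rightarrow> (real ^ 'n) set"
  assumes [measurable]: "\<And>i. B i \<in> sets lebesgue" and c: "\<And>Q. 0 \<le> c Q"
  shows "ennreal (tree_sum dchild m (\<lambda>Q. measure lebesgue (dcube Q \<inter> B (fst Q)) * c Q) Q) =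
    (\<Sum>l<m. \<integral>\<^sup>+x\<in>dcube Q. ennreal (c (fst Q - int l, dindex (fst Q - int l) x)) * indicator (B (fst Q - int l)) x \<partial>lebesgue)"
proof (induction m arbitrary: Q)
  case 0
  then show ?case by simp
next
  case (Suc m)
  let ?t = "\<lambda>m. tree_sum dchild m (\<lambda>Q. measure lebesgue (dcube Q \<inter> B (fst Q)) * c Q)"
  have [measurable]: "(\<lambda>x. ennreal (c (i, dindex i x))) \<in> borel_measurable lebesgue" for i
    by (rule measurable_fun_dindex)
  let ?h = "\<lambda>i x. ennreal (c (i, dindex i x)) * indicator (B i) x"
  have nn: "0 \<le> ?t m R" for R by (intro tree_sum_nonneg mult_nonneg_nonneg c measure_nonneg)
  have fin: "emeasure lebesgue (dcube Q \<inter> B (fst Q)) \<noteq> \<infinity>"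
  proof -
    have "emeasure lebesgue (dcube Q \<inter> B (fst Q)) \<le> emeasure lebesgue (dcube Q)"
      by (intro emeasure_mono) auto
    then show ?thesis by (auto simp: emeasure_dcube top_unique)
  qed
  have "(\<integral>\<^sup>+x\<in>dcube Q. ?h (fst Q) x \<partial>lebesgue) = (\<integral>\<^sup>+x. ennreal (c Q) * indicator (dcube Q \<inter> B (fst Q)) x \<partial>lebesgue)"
    by (intro nn_integral_cong) (auto simp: dcube_def split: split_indicator)
  also have "\<dots> = ennreal (c Q) * emeasure lebesgue (dcube Q \<inter> B (fst Q))"
    by (subst nn_integral_cmult_indicator) auto
  also have "\<dots> = ennreal (measure lebesgue (dcube Q \<inter> B (fst Q)) * c Q)"
    using fin c by (simp add: emeasure_eq_ennreal_measure ennreal_mult' mult.commute)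
  finally have top: "(\<integral>\<^sup>+x\<in>dcube Q. ?h (fst Q) x \<partial>lebesgue) = ennreal (measure lebesgue (dcube Q \<inter> B (fst Q)) * c Q)" .
  have "(\<Sum>R\<in>dchild Q. ennreal (?t m R)) =
      (\<Sum>R\<in>dchild Q. \<Sum>l<m. \<integral>\<^sup>+x\<in>dcube R. ?h (fst R - int l) x \<partial>lebesgue)"
    by (simp only: Suc.IH)
  also have "\<dots> = (\<Sum>R\<in>dchild Q. \<Sum>l<m. \<integral>\<^sup>+x\<in>dcube R. ?h (fst Q - int (Suc l)) x \<partial>lebesgue)"
    by (intro sum.cong refl) (simp add: dchild_fst algebra_simps)
  also have "\<dots> = (\<Sum>l<m. \<Sum>R\<in>dchild Q. \<integral>\<^sup>+x\<in>dcube R. ?h (fst Q - int (Suc l)) x \<partial>lebesgue)"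
    by (rule sum.swap)
  also have "\<dots> = (\<Sum>l<m. \<integral>\<^sup>+x\<in>dcube Q. ?h (fst Q - int (Suc l)) x \<partial>lebesgue)"
    by (intro sum.cong refl nn_integral_dcube_eq_sum[symmetric]) measurable
  finally have rest: "(\<Sum>R\<in>dchild Q. ennreal (?t m R)) = (\<Sum>l<m. \<integral>\<^sup>+x\<in>dcube Q. ?h (fst Q - int (Suc l)) x \<partial>lebesgue)" .
  have "ennreal (?t (Suc m) Q) = ennreal (measure lebesgue (dcube Q \<inter> B (fst Q)) * c Q) + (\<Sum>R\<in>dchild Q. ennreal (?t m R))"
    using nn c by (simp add: sum_nonneg ennreal_plus[symmetric] del: ennreal_plus)
  also have "\<dots> = (\<Sum>l<Suc m. \<integral>\<^sup>+x\<in>dcube Q. ?h (fst Q - int l) x \<partial>lebesgue)"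
    unfolding rest sum.lessThan_Suc_shift using top by simp
  finally show ?case .
qed

text \<open>The cubes of the top scale of a window partition the space, and the sum over the window
  splits into their trees. A bound for the sum of \<open>V\<close> over one scale, uniform in the
  scale, thus bounds every window.\<close>

lemma sum_levels_le:
  fixes c :: "int \<times> ('n::finite \<Rightarrow> int) \<Rightarrow> real" and B :: "int \<Rightarrow> (real ^ 'n) set"
  assumes B [measurable]: "\<And>i. B i \<in> sets lebesgue" and c: "\<And>Q. 0 \<le> c Q"
    and tree: "\<And>m Q. tree_sum dchild m (\<lambda>Q. measure lebesgue (dcube Q \<inter> B (fst Q)) * c Q) Q \<le> V Q"
    and total: "\<And>i. (\<integral>\<^sup>+k. ennreal (V (i, k)) \<partial>count_space UNIV) \<le> T"
  shows "(\<integral>\<^sup>+i. (\<integral>\<^sup>+x\<in>B i. ennreal (c (i, dindex i x)) \<partial>lebesgue) \<partial>count_space UNIV) \<le> T"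
proof (rule nn_integral_count_space_int_le)
  fix N
  have [measurable]: "(\<lambda>x. ennreal (c (i, dindex i x))) \<in> borel_measurable lebesgue" for i
    by (rule measurable_fun_dindex)
  let ?h = "\<lambda>i x. ennreal (c (i, dindex i x)) * indicator (B i) x"
  have bij: "bij_betw (\<lambda>l. int N - int l) {..<2 * N} {- int N<..int N}"
    by (rule bij_betw_byWitness[where f' = "\<lambda>i. nat (int N - i)"]) auto
  have "(\<Sum>i\<in>{- int N<..int N}. \<integral>\<^sup>+x. ?h i x \<partial>lebesgue) = (\<Sum>l<2 * N. \<integral>\<^sup>+x. ?h (int N - int l) x \<partial>lebesgue)"
    by (rule sum.reindex_bij_betw[OF bij, symmetric])
  also have "\<dots> = (\<integral>\<^sup>+x. (\<Sum>l<2 * N. ?h (int N - int l) x) \<partial>lebesgue)"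
    by (rule nn_integral_sum[symmetric]) measurable
  also have "\<dots> = (\<integral>\<^sup>+k. (\<integral>\<^sup>+x\<in>dcube (int N, k). (\<Sum>l<2 * N. ?h (int N - int l) x) \<partial>lebesgue) \<partial>count_space UNIV)"
    by (rule nn_integral_eq_sum_dcube) measurable
  also have "\<dots> \<le> (\<integral>\<^sup>+k. ennreal (V (int N, k)) \<partial>count_space UNIV)"
  proof (rule nn_integral_mono)
    fix k :: "'n \<Rightarrow> int"
    have "(\<integral>\<^sup>+x\<in>dcube (int N, k). (\<Sum>l<2 * N. ?h (int N - int l) x) \<partial>lebesgue)
        = (\<Sum>l<2 * N. \<integral>\<^sup>+x\<in>dcube (int N, k). ?h (int N - int l) x \<partial>lebesgue)"
      unfolding sum_distrib_right by (rule nn_integral_sum) measurable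
    also have "\<dots> = ennreal (tree_sum dchild (2 * N) (\<lambda>Q. measure lebesgue (dcube Q \<inter> B (fst Q)) * c Q) (int N, k))"
      by (subst tree_sum_eq_nn_integral[OF B c]) simp
    also have "\<dots> \<le> ennreal (V (int N, k))" by (intro ennreal_leI tree)
    finally show "(\<integral>\<^sup>+x\<in>dcube (int N, k). (\<Sum>l<2 * N. ?h (int N - int l) x) \<partial>lebesgue) \<le> ennreal (V (int N, k))" .
  qed
  also have "\<dots> \<le> T" by (rule total)
  finally show "(\<Sum>i\<in>{- int N<..int N}. \<integral>\<^sup>+x. ?h i x \<partial>lebesgue) \<le> T" .
qed

section \<open>Pointwise control of a function by its gradient\<close>

lemma set_integrable_dcube_continuous:
  fixes f :: "real ^ 'n \<Rightarrow> real"
  assumes "continuous_on UNIV f"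
  shows "set_integrable lebesgue (dcube Q) f"
proof -
  have "set_integrable lebesgue (dclosure Q) f"
    unfolding dclosure_def
    by (rule absolutely_integrable_continuous) (use assms continuous_on_subset in blast)
  then show ?thesis
    by (rule set_integrable_subset) (auto simp: dcube_subset_dclosure)
qed

lemma nn_set_integral_eq_set_integral':
  fixes f :: "'a \<Rightarrow> real"
  assumes "set_integrable M A f" and "AE x\<in>A in M. 0 \<le> f x"
  shows "(\<integral>\<^sup>+x\<in>A. ennreal (f x) \<partial>M) = ennreal (LINT x:A|M. f x)"
proof -
  have "(\<integral>\<^sup>+x\<in>A. ennreal (f x) \<partial>M) = (\<integral>\<^sup>+x. ennreal (indicator A x *\<^sub>R f x) \<partial>M)"
    by (intro nn_integral_cong) (auto split: split_indicator)
  also have "\<dots> = ennreal (LINT x:A|M. f x)"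
    unfolding set_lebesgue_integral_def
    by (rule nn_integral_eq_integral)
       (use assms in \<open>auto simp: set_integrable_def split: split_indicator elim!: eventually_mono\<close>)
  finally show ?thesis .
qed

lemma set_lebesgue_integral_nonneg:
  fixes f :: "'a \<Rightarrow> real"
  shows "(\<And>x. 0 \<le> f x) \<Longrightarrow> 0 \<le> (LINT x:A|M. f x)"
  unfolding set_lebesgue_integral_def
  by (rule Bochner_Integration.integral_nonneg) (auto split: split_indicator)

lemma average_deviation_le:
  fixes f :: "'a \<Rightarrow> real"
  assumes f: "set_integrable M A f" and A: "A \<in> sets M" "0 < measure M A"
  shows "ennreal \<bar>(LINT x:A|M. f x) / measure M A - c\<bar> \<le> (\<integral>\<^sup>+x\<in>A. ennreal \<bar>f x - c\<bar> \<partial>M) / ennreal (measure M A)"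
proof -
  have fin: "emeasure M A < \<infinity>"
    using A(2) by (cases "emeasure M A = \<infinity>") (auto simp: measure_def top.not_eq_extremum)
  have c: "set_integrable M A (\<lambda>_. c)"
    unfolding set_integrable_def using A(1) fin by (auto simp: integrable_indicator_iff)
  have "(LINT x:A|M. f x - c) = (LINT x:A|M. f x) - measure M A * c"
    using set_integral_diff(2)[OF f c] fin A(1) by (simp add: set_integral_const)
  then have eq: "(LINT x:A|M. f x) / measure M A - c = (LINT x:A|M. f x - c) / measure M A"
    using A by (simp add: field_simps)
  have "ennreal \<bar>LINT x:A|M. f x - c\<bar> \<le> (\<integral>\<^sup>+x. ennreal (norm (indicator A x *\<^sub>R (f x - c))) \<partial>M)"
    unfolding set_lebesgue_integral_def real_norm_def[symmetric]
    by (rule integral_norm_bound_ennreal) (use set_integral_diff(1)[OF f c] in \<open>simp add: set_integrable_def\<close>)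
  also have "\<dots> = (\<integral>\<^sup>+x\<in>A. ennreal \<bar>f x - c\<bar> \<partial>M)"
    by (intro nn_integral_cong) (auto split: split_indicator)
  finally have "ennreal \<bar>LINT x:A|M. f x - c\<bar> / ennreal (measure M A) \<le> (\<integral>\<^sup>+x\<in>A. ennreal \<bar>f x - c\<bar> \<partial>M) / ennreal (measure M A)"
    by (rule divide_right_mono_ennreal)
  then show ?thesis unfolding eq using A by (simp add: abs_divide divide_ennreal)
qed

section \<open>A Poincare inequality on convex sets\<close>

lemma GDERIV_difference_le_nn_integral:
  fixes f :: "'a::euclidean_space \<Rightarrow> real"
  assumes G: "\<And>x. GDERIV f x :> G x" and cont: "continuous_on UNIV G"
  shows "ennreal \<bar>f y - f x\<bar> \<le> ennreal (norm (y - x)) * (\<integral>\<^sup>+t. ennreal (norm (G ((1 - t) *\<^sub>R x + t *\<^sub>R y))) * indicator {0..1} t \<partial>lborel)"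
proof -
  define p where "p t = (1 - t) *\<^sub>R x + t *\<^sub>R y" for t :: real
  define h where "h t = inner (y - x) (G (p t))" for t
  have p_cont: "continuous_on UNIV p" unfolding p_def by (intro continuous_intros)
  have Gp: "continuous_on UNIV (\<lambda>t. G (p t))"
    by (rule continuous_on_compose2[OF cont p_cont]) auto
  have h_cont: "continuous_on {0..1} h"
    unfolding h_def by (intro continuous_intros continuous_on_subset[OF Gp]) auto
  have der: "((\<lambda>t. f (p t)) has_vector_derivative h t) (at t within {0..1})" for t
  proof -
    have "(f has_derivative (\<lambda>h. inner h (G (p t)))) (at (p t))"
      using G[of "p t"] by (simp add: gderiv_def)
    moreover have "(p has_vector_derivative (y - x)) (at t within {0..1})"
      unfolding p_def by (auto intro!: derivative_eq_intros)
    ultimately have "((f \<circ> p) has_derivative ((\<lambda>h. inner h (G (p t))) \<circ> (\<lambda>s. s *\<^sub>R (y - x)))) (at t within {0..1})"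
      unfolding has_vector_derivative_def
      by (intro diff_chain_within) (auto intro: has_derivative_at_withinI)
    then show ?thesis by (simp add: has_vector_derivative_def h_def o_def)
  qed
  have "integral\<^sup>L lborel (\<lambda>t. indicator {0..1} t *\<^sub>R h t) = f (p 1) - f (p 0)"
    by (rule integral_FTC_atLeastAtMost) (use der h_cont in auto)
  then have eq: "f y - f x = integral\<^sup>L lborel (\<lambda>t. indicator {0..1} t *\<^sub>R h t)" by (simp add: p_def)
  have "integrable lborel (\<lambda>t. indicator {0..1} t *\<^sub>R h t)"
    using borel_integrable_atLeastAtMost'[OF h_cont] by (simp add: set_integrable_def)
  then have "ennreal (norm (f y - f x)) \<le> (\<integral>\<^sup>+t. ennreal (norm (indicator {0..1} t *\<^sub>R h t)) \<partial>lborel)"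
    unfolding eq by (rule integral_norm_bound_ennreal)
  also have "\<dots> \<le> (\<integral>\<^sup>+t. ennreal (norm (y - x)) * (ennreal (norm (G (p t))) * indicator {0..1} t) \<partial>lborel)"
  proof (rule nn_integral_mono)
    fix t
    have "ennreal \<bar>h t\<bar> \<le> ennreal (norm (y - x)) * ennreal (norm (G (p t)))"
      using Cauchy_Schwarz_ineq2[of "y - x" "G (p t)"]
      by (simp add: h_def ennreal_mult'[symmetric] ennreal_leI)
    then show "ennreal (norm (indicator {0..1} t *\<^sub>R h t)) \<le> ennreal (norm (y - x)) * (ennreal (norm (G (p t))) * indicator {0..1} t)"
      by (auto split: split_indicator)
  qed
  also have "\<dots> = ennreal (norm (y - x)) * (\<integral>\<^sup>+t. ennreal (norm (G (p t))) * indicator {0..1} t \<partial>lborel)"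
  proof (rule nn_integral_cmult)
    have [measurable]: "(\<lambda>t. G (p t)) \<in> borel_measurable borel"
      by (rule borel_measurable_continuous_onI[OF Gp])
    show "(\<lambda>t. ennreal (norm (G (p t))) * indicator {0..1} t) \<in> borel_measurable lborel" by measurable
  qed
  finally show ?thesis by (simp add: p_def)
qed

text \<open>
  Averaging over \<open>x\<close> the value of \<open>N\<close> at a point of the segment from \<open>y\<close> to \<open>x\<close> that is
  closer to \<open>x\<close> costs only a dimensional constant; in the double integral below one integrates first over
  the nearer endpoint.
\<close>

lemma nn_integral_contraction_le:
  fixes N :: "'a::euclidean_space \<Rightarrow> ennreal"
  assumes [measurable]: "N \<in> borel_measurable borel" "D \<in> sets borel"
    and "convex D" "y \<in> D" and s: "1 / 2 \<le> s" "s \<le> 1"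
  shows "(\<integral>\<^sup>+x. N (s *\<^sub>R x + (1 - s) *\<^sub>R y) * indicator D x \<partial>lborel) \<le> 2 ^ DIM('a) * (\<integral>\<^sup>+x\<in>D. N x \<partial>lborel)"
proof -
  let ?g = "\<lambda>z. N z * indicator D z"
  let ?J = "\<integral>\<^sup>+x. ?g ((1 - s) *\<^sub>R y + s *\<^sub>R x) \<partial>lborel"
  have "(\<integral>\<^sup>+x. N (s *\<^sub>R x + (1 - s) *\<^sub>R y) * indicator D x \<partial>lborel) \<le> ?J"
  proof (rule nn_integral_mono)
    fix x
    have "(1 - s) *\<^sub>R y + s *\<^sub>R x \<in> D" if "x \<in> D"
      using \<open>convex D\<close> that \<open>y \<in> D\<close> s by (auto intro: convexD)
    then show "N (s *\<^sub>R x + (1 - s) *\<^sub>R y) * indicator D x \<le> ?g ((1 - s) *\<^sub>R y + s *\<^sub>R x)"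
      by (auto simp: add.commute split: split_indicator)
  qed
  \<comment> \<open>A factor one is inserted: the power of \<open>1 / 2\<close> is a lower bound for
    the Jacobian \<open>\<bar>s\<bar> ^ DIM('a)\<close> of the contraction towards \<open>y\<close>,
    and the power of 2 remains in the result.\<close>
  also have "\<dots> = (ennreal 2 * ennreal (1 / 2)) ^ DIM('a) * ?J"
    by (subst ennreal_mult[symmetric]) auto
  also have "\<dots> = ennreal 2 ^ DIM('a) * (ennreal (1 / 2) ^ DIM('a) * ?J)"
    by (simp add: power_mult_distrib mult.assoc)
  also have "\<dots> \<le> ennreal 2 ^ DIM('a) * (ennreal (\<bar>s\<bar> ^ DIM('a)) * ?J)"
  proof (intro mult_left_mono mult_right_mono)
    have "ennreal (1 / 2) ^ DIM('a) = ennreal ((1 / 2) ^ DIM('a))" by (rule ennreal_power) simp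
    also have "\<dots> \<le> ennreal (\<bar>s\<bar> ^ DIM('a))" using s by (intro ennreal_leI power_mono) auto
    finally show "ennreal (1 / 2) ^ DIM('a) \<le> ennreal (\<bar>s\<bar> ^ DIM('a))" .
  qed auto
  also have "ennreal (\<bar>s\<bar> ^ DIM('a)) * ?J = (\<integral>\<^sup>+x. ?g x \<partial>lborel)"
  proof -
    have "s \<noteq> 0" using s by auto
    from lborel_affine[OF this, of "(1 - s) *\<^sub>R y"]
    have "(\<integral>\<^sup>+x. ?g x \<partial>lborel) = (\<integral>\<^sup>+x. ?g x \<partial>density (distr lborel borel (\<lambda>x. (1 - s) *\<^sub>R y + s *\<^sub>R x)) (\<lambda>_. \<bar>s\<bar> ^ DIM('a)))"
      by simp
    also have "\<dots> = ennreal (\<bar>s\<bar> ^ DIM('a)) * ?J"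
      by (simp add: nn_integral_density nn_integral_distr nn_integral_cmult)
    finally show ?thesis by simp
  qed
  finally show ?thesis by simp
qed

lemma poincare_double_integral:
  fixes f :: "'a::euclidean_space \<Rightarrow> real"
  assumes G: "\<And>x. GDERIV f x :> G x" and cont: "continuous_on UNIV G"
    and D [measurable]: "D \<in> sets borel" and "convex D"
    and d: "\<And>x y. x \<in> D \<Longrightarrow> y \<in> D \<Longrightarrow> norm (y - x) \<le> d"
  shows "(\<integral>\<^sup>+x\<in>D. (\<integral>\<^sup>+y\<in>D. ennreal \<bar>f y - f x\<bar> \<partial>lborel) \<partial>lborel)
    \<le> ennreal d * (2 ^ DIM('a) * emeasure lborel D * (\<integral>\<^sup>+x\<in>D. ennreal (norm (G x)) \<partial>lborel))"
proof -
  define N where "N z = ennreal (norm (G z))" for z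
  have N [measurable]: "N \<in> borel_measurable borel"
    unfolding N_def using borel_measurable_continuous_onI[OF cont] by measurable
  define H where "H x y t = N ((1 - t) *\<^sub>R x + t *\<^sub>R y) * indicator {0..1} t * indicator D y * indicator D x" for x y and t :: real
  have "(\<integral>\<^sup>+x\<in>D. (\<integral>\<^sup>+y\<in>D. ennreal \<bar>f y - f x\<bar> \<partial>lborel) \<partial>lborel) \<le>
      (\<integral>\<^sup>+x. (\<integral>\<^sup>+y. (\<integral>\<^sup>+t. ennreal d * H x y t \<partial>lborel) \<partial>lborel) \<partial>lborel)"
  proof -
    have pt: "ennreal \<bar>f y - f x\<bar> * indicator D y * indicator D x \<le> (\<integral>\<^sup>+t. ennreal d * H x y t \<partial>lborel)" for x y
    proof (cases "x \<in> D \<and> y \<in> D")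
      case True
      have "ennreal \<bar>f y - f x\<bar> \<le> ennreal (norm (y - x)) * (\<integral>\<^sup>+t. N ((1 - t) *\<^sub>R x + t *\<^sub>R y) * indicator {0..1} t \<partial>lborel)"
        unfolding N_def by (rule GDERIV_difference_le_nn_integral[OF G cont])
      also have "\<dots> \<le> ennreal d * (\<integral>\<^sup>+t. N ((1 - t) *\<^sub>R x + t *\<^sub>R y) * indicator {0..1} t \<partial>lborel)"
        using d True by (intro mult_right_mono ennreal_leI) auto
      also have "\<dots> = (\<integral>\<^sup>+t. ennreal d * H x y t \<partial>lborel)"
        using True by (subst nn_integral_cmult[symmetric]) (auto simp: H_def)
      finally show ?thesis using True by simp
    qed (auto simp: H_def)
    have "(\<integral>\<^sup>+x\<in>D. (\<integral>\<^sup>+y\<in>D. ennreal \<bar>f y - f x\<bar> \<partial>lborel) \<partial>lborel)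
        \<le> (\<integral>\<^sup>+x. (\<integral>\<^sup>+y. ennreal \<bar>f y - f x\<bar> * indicator D y * indicator D x \<partial>lborel) \<partial>lborel)"
      by (intro nn_integral_mono) (auto split: split_indicator)
    also have "\<dots> \<le> (\<integral>\<^sup>+x. (\<integral>\<^sup>+y. (\<integral>\<^sup>+t. ennreal d * H x y t \<partial>lborel) \<partial>lborel) \<partial>lborel)"
      by (intro nn_integral_mono pt)
    finally show ?thesis .
  qed
  also have "\<dots> = ennreal d * (\<integral>\<^sup>+x. (\<integral>\<^sup>+y. (\<integral>\<^sup>+t. H x y t \<partial>lborel) \<partial>lborel) \<partial>lborel)"
    unfolding H_def by (simp add: nn_integral_cmult)
  also have "(\<integral>\<^sup>+x. (\<integral>\<^sup>+y. (\<integral>\<^sup>+t. H x y t \<partial>lborel) \<partial>lborel) \<partial>lborel) = (\<integral>\<^sup>+x. (\<integral>\<^sup>+t. (\<integral>\<^sup>+y. H x y t \<partial>lborel) \<partial>lborel) \<partial>lborel)"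
    unfolding H_def by (intro nn_integral_cong lborel_pair.Fubini') measurable
  also have "\<dots> = (\<integral>\<^sup>+t. (\<integral>\<^sup>+x. (\<integral>\<^sup>+y. H x y t \<partial>lborel) \<partial>lborel) \<partial>lborel)"
    unfolding H_def by (intro lborel_pair.Fubini') measurable
  also have "\<dots> \<le> (\<integral>\<^sup>+t. 2 ^ DIM('a) * emeasure lborel D * (\<integral>\<^sup>+x\<in>D. N x \<partial>lborel) * indicator {0..1::real} t \<partial>lborel)"
  proof (rule nn_integral_mono)
    fix t :: real
    show "(\<integral>\<^sup>+x. (\<integral>\<^sup>+y. H x y t \<partial>lborel) \<partial>lborel) \<le> 2 ^ DIM('a) * emeasure lborel D * (\<integral>\<^sup>+x\<in>D. N x \<partial>lborel) * indicator {0..1} t"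
    proof (cases "t \<in> {0..1}")
      case True
      have const: "(\<integral>\<^sup>+x. (2 ^ DIM('a) * (\<integral>\<^sup>+x\<in>D. N x \<partial>lborel)) * indicator D x \<partial>lborel) = 2 ^ DIM('a) * emeasure lborel D * (\<integral>\<^sup>+x\<in>D. N x \<partial>lborel)"
        by (subst nn_integral_cmult_indicator) (auto simp: mult_ac)
      consider "t \<le> 1 / 2" | "1 / 2 \<le> t" by linarith
      then show ?thesis
      proof cases
        case 1
        have "(\<integral>\<^sup>+x. (\<integral>\<^sup>+y. H x y t \<partial>lborel) \<partial>lborel) = (\<integral>\<^sup>+y. (\<integral>\<^sup>+x. H x y t \<partial>lborel) \<partial>lborel)"
          unfolding H_def by (intro lborel_pair.Fubini') measurable
        also have "\<dots> \<le> (\<integral>\<^sup>+y. (2 ^ DIM('a) * (\<integral>\<^sup>+x\<in>D. N x \<partial>lborel)) * indicator D y \<partial>lborel)"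
        proof (rule nn_integral_mono)
          fix y
          show "(\<integral>\<^sup>+x. H x y t \<partial>lborel) \<le> (2 ^ DIM('a) * (\<integral>\<^sup>+x\<in>D. N x \<partial>lborel)) * indicator D y"
            using nn_integral_contraction_le[OF N D \<open>convex D\<close>, of y "1 - t"] 1 True
            by (cases "y \<in> D") (auto simp: H_def)
        qed
        finally show ?thesis using True const by simp
      next
        case 2
        have "(\<integral>\<^sup>+x. (\<integral>\<^sup>+y. H x y t \<partial>lborel) \<partial>lborel) \<le> (\<integral>\<^sup>+x. (2 ^ DIM('a) * (\<integral>\<^sup>+x\<in>D. N x \<partial>lborel)) * indicator D x \<partial>lborel)"
        proof (rule nn_integral_mono)
          fix x
          show "(\<integral>\<^sup>+y. H x y t \<partial>lborel) \<le> (2 ^ DIM('a) * (\<integral>\<^sup>+x\<in>D. N x \<partial>lborel)) * indicator D x"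
            using nn_integral_contraction_le[OF N D \<open>convex D\<close>, of x t] 2 True
            by (cases "x \<in> D") (auto simp: H_def add.commute)
        qed
        then show ?thesis using True const by simp
      qed
    qed (auto simp: H_def)
  qed
  also have "\<dots> = 2 ^ DIM('a) * emeasure lborel D * (\<integral>\<^sup>+x\<in>D. N x \<partial>lborel)"
    by (subst nn_integral_cmult_indicator) auto
  finally show ?thesis by (simp add: N_def mult_left_mono)
qed

lemma gradient_GDERIV:
  assumes "f \<in> C1_0"
  shows "GDERIV f x :> gradient f x"
proof -
  obtain D where D: "GDERIV f x :> D" using assms by (auto simp: C1_0_def)
  have "D' = D" if "GDERIV f x :> D'" for D'
  proof -
    have "(\<lambda>h. inner h D') = (\<lambda>h. inner h D)"
      using that D unfolding gderiv_def by (rule has_derivative_unique)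
    then have "inner (D' - D) D' = inner (D' - D) D" by metis
    then show ?thesis by (metis inner_diff_right inner_eq_zero_iff right_minus_eq)
  qed
  with D show ?thesis unfolding gradient_def by (rule theI)
qed

lemma dclosure_diameter:
  fixes x y :: "real ^ 'n"
  assumes "x \<in> dclosure Q" "y \<in> dclosure Q"
  shows "norm (y - x) \<le> real CARD('n) * 2 powr real_of_int (fst Q)"
proof -
  have "norm (y - x) \<le> (\<Sum>a\<in>UNIV. \<bar>(y - x) $ a\<bar>)" by (rule norm_le_l1_cart)
  also have "\<dots> \<le> (\<Sum>a\<in>(UNIV::'n set). 2 powr real_of_int (fst Q))"
  proof (rule sum_mono)
    fix a
    have *: "2 powr real_of_int (fst Q) * real_of_int (snd Q a) \<le> z $ a \<and>
        z $ a \<le> 2 powr real_of_int (fst Q) * real_of_int (snd Q a) + 2 powr real_of_int (fst Q)"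
      if "z \<in> dclosure Q" for z
      using that unfolding dclosure_def mem_box_cart by auto
    show "\<bar>(y - x) $ a\<bar> \<le> 2 powr real_of_int (fst Q)"
      using *[OF assms(1)] *[OF assms(2)] by auto
  qed
  finally show ?thesis by simp
qed

lemma nn_integral_dcube_le_dclosure:
  "(\<integral>\<^sup>+x\<in>dcube Q. h x \<partial>lebesgue) \<le> (\<integral>\<^sup>+x\<in>dclosure Q. h x \<partial>lborel)"
  by (subst nn_integral_completion) (rule nn_set_integral_set_mono[OF dcube_subset_dclosure])

lemma nn_integral_dclosure_eq:
  "(\<integral>\<^sup>+x\<in>dclosure Q. h x \<partial>lebesgue) = (\<integral>\<^sup>+x\<in>dcube Q. h x \<partial>lebesgue)"
  by (rule nn_integral_cong_AE) (use AE_dclosure_iff[of Q] in \<open>auto elim!: eventually_mono split: split_indicator\<close>)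

section \<open>Telescoping of dyadic averages\<close>

definition davg :: "(real ^ 'n \<Rightarrow> real) \<Rightarrow> int \<times> ('n \<Rightarrow> int) \<Rightarrow> real" where
  "davg h Q = (LINT x:dcube Q|lebesgue. h x) / dvol TYPE('n) (fst Q)"

lemma dvol_Suc: "dvol TYPE('n) i = 2 ^ CARD('n) * dvol TYPE('n::finite) (i - 1)"
  by (simp add: dvol_def powr_diff powr_realpow right_diff_distrib)

text \<open>The averages are compared through the mean of \<open>\<bar>f y - f x\<bar>\<close> with
  \<open>x\<close> in the child and \<open>y\<close> in \<open>Q\<close>. Enlarging the child to
  \<open>Q\<close> costs the ratio \<open>2 ^ CARD('n)\<close> of the volumes, the double integral
  another \<open>2 ^ CARD('n)\<close>, and the diameter the factor \<open>CARD('n)\<close>.\<close>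

lemma davg_dchild_diff:
  fixes f :: "real ^ 'n \<Rightarrow> real"
  assumes G: "\<And>x. GDERIV f x :> G x" and cont: "continuous_on UNIV G"
    and R: "R \<in> dchild Q"
  shows "\<bar>davg f R - davg f Q\<bar> \<le> real CARD('n) * 4 ^ CARD('n) * (2 powr real_of_int (fst Q) * davg (\<lambda>x. norm (G x)) Q)"
proof -
  let ?v = "dvol TYPE('n)"
  have fc: "continuous_on UNIV f"
    using G has_derivative_continuous unfolding gderiv_def continuous_on_eq_continuous_within by blast
  have Gc: "continuous_on UNIV (\<lambda>x. norm (G x))" by (intro continuous_on_norm cont)
  note si = set_integrable_dcube_continuous[OF fc]
  have vR: "?v (fst R) = ?v (fst Q) / 2 ^ CARD('n)"
    using dvol_Suc[where 'n = 'n, of "fst Q"] dchild_fst[OF R] by simp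
  have 1: "ennreal \<bar>f x - davg f Q\<bar> \<le> (\<integral>\<^sup>+y\<in>dclosure Q. ennreal \<bar>f y - f x\<bar> \<partial>lborel) / ennreal (?v (fst Q))" for x
  proof -
    have "ennreal \<bar>davg f Q - f x\<bar> \<le> (\<integral>\<^sup>+y\<in>dcube Q. ennreal \<bar>f y - f x\<bar> \<partial>lebesgue) / ennreal (?v (fst Q))"
      using average_deviation_le[OF si sets_dcube, of Q "f x"] by (simp add: measure_dcube davg_def)
    also have "\<dots> \<le> (\<integral>\<^sup>+y\<in>dclosure Q. ennreal \<bar>f y - f x\<bar> \<partial>lborel) / ennreal (?v (fst Q))"
      by (intro divide_right_mono_ennreal nn_integral_dcube_le_dclosure)
    finally show ?thesis by (simp add: abs_minus_commute)
  qed
  have "ennreal \<bar>davg f R - davg f Q\<bar> \<le> (\<integral>\<^sup>+x\<in>dcube R. ennreal \<bar>f x - davg f Q\<bar> \<partial>lebesgue) / ennreal (?v (fst R))"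
    using average_deviation_le[OF si sets_dcube, of R "davg f Q"] by (simp add: measure_dcube davg_def)
  also have "\<dots> \<le> (\<integral>\<^sup>+x\<in>dclosure Q. (\<integral>\<^sup>+y\<in>dclosure Q. ennreal \<bar>f y - f x\<bar> \<partial>lborel) / ennreal (?v (fst Q)) \<partial>lborel) / ennreal (?v (fst R))"
  proof (rule divide_right_mono_ennreal)
    have "(\<integral>\<^sup>+x\<in>dcube R. ennreal \<bar>f x - davg f Q\<bar> \<partial>lebesgue) \<le> (\<integral>\<^sup>+x\<in>dcube R. (\<integral>\<^sup>+y\<in>dclosure Q. ennreal \<bar>f y - f x\<bar> \<partial>lborel) / ennreal (?v (fst Q)) \<partial>lebesgue)"
      by (intro nn_integral_mono mult_right_mono 1) auto
    also have "\<dots> \<le> (\<integral>\<^sup>+x\<in>dcube Q. (\<integral>\<^sup>+y\<in>dclosure Q. ennreal \<bar>f y - f x\<bar> \<partial>lborel) / ennreal (?v (fst Q)) \<partial>lebesgue)"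
      by (rule nn_set_integral_set_mono[OF dchild_subset[OF R]])
    also have "\<dots> \<le> (\<integral>\<^sup>+x\<in>dclosure Q. (\<integral>\<^sup>+y\<in>dclosure Q. ennreal \<bar>f y - f x\<bar> \<partial>lborel) / ennreal (?v (fst Q)) \<partial>lborel)"
      by (rule nn_integral_dcube_le_dclosure)
    finally show "(\<integral>\<^sup>+x\<in>dcube R. ennreal \<bar>f x - davg f Q\<bar> \<partial>lebesgue) \<le> \<dots>" .
  qed
  also have "(\<integral>\<^sup>+x\<in>dclosure Q. (\<integral>\<^sup>+y\<in>dclosure Q. ennreal \<bar>f y - f x\<bar> \<partial>lborel) / ennreal (?v (fst Q)) \<partial>lborel)
      = (\<integral>\<^sup>+x\<in>dclosure Q. (\<integral>\<^sup>+y\<in>dclosure Q. ennreal \<bar>f y - f x\<bar> \<partial>lborel) \<partial>lborel) / ennreal (?v (fst Q))"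
  proof -
    have [measurable]: "f \<in> borel_measurable borel" by (rule borel_measurable_continuous_onI[OF fc])
    have [measurable]: "dclosure Q \<in> sets borel" by (simp add: dclosure_def)
    have "(\<lambda>x. (\<integral>\<^sup>+y\<in>dclosure Q. ennreal \<bar>f y - f x\<bar> \<partial>lborel) * indicator (dclosure Q) x) \<in> borel_measurable lborel"
      by measurable
    from nn_integral_divide[OF this, of "ennreal (?v (fst Q))"] show ?thesis
      by (simp add: divide_ennreal_def mult_ac)
  qed
  also have "\<dots> / ennreal (?v (fst R)) \<le> (ennreal (real CARD('n) * 2 powr real_of_int (fst Q)) * (2 ^ DIM(real ^ 'n) * emeasure lborel (dclosure Q) * (\<integral>\<^sup>+x\<in>dclosure Q. ennreal (norm (G x)) \<partial>lborel)))
       / ennreal (?v (fst Q)) / ennreal (?v (fst R))"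
    by (intro divide_right_mono_ennreal poincare_double_integral[OF G cont] dclosure_diameter)
       (auto simp: dclosure_def)
  also have "emeasure lborel (dclosure Q) = ennreal (?v (fst Q))"
  proof -
    have "emeasure lborel (dclosure Q) = emeasure lebesgue (dclosure Q)"
      by (simp add: dclosure_def)
    then show ?thesis by (simp only: emeasure_dclosure)
  qed
  also have "(\<integral>\<^sup>+x\<in>dclosure Q. ennreal (norm (G x)) \<partial>lborel) = (\<integral>\<^sup>+x\<in>dclosure Q. ennreal (norm (G x)) \<partial>lebesgue)"
    by (rule nn_integral_completion[symmetric])
  also have "\<dots> = ennreal (LINT x:dcube Q|lebesgue. norm (G x))"
    unfolding nn_integral_dclosure_eq
    by (rule nn_set_integral_eq_set_integral'[OF set_integrable_dcube_continuous[OF Gc]]) simp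
  finally have "ennreal \<bar>davg f R - davg f Q\<bar> \<le> ennreal (real CARD('n) * 2 powr real_of_int (fst Q)) * (2 ^ CARD('n) * ennreal (?v (fst Q)) * ennreal (LINT x:dcube Q|lebesgue. norm (G x)))
       / ennreal (?v (fst Q)) / ennreal (?v (fst R))" by simp
  also have "\<dots> = ennreal (real CARD('n) * 4 ^ CARD('n) * (2 powr real_of_int (fst Q) * davg (\<lambda>x. norm (G x)) Q))"
  proof -
    have nn: "0 \<le> (LINT x:dcube Q|lebesgue. norm (G x))"
      by (intro set_lebesgue_integral_nonneg) auto
    have two: "(2::ennreal) ^ CARD('n) = ennreal (2 ^ CARD('n))" by (metis ennreal_numeral ennreal_power zero_le_numeral)
    have four: "(4::real) ^ CARD('n) = 2 ^ CARD('n) * 2 ^ CARD('n)" by (simp add: power_mult_distrib[symmetric])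
    show ?thesis
      unfolding two vR using nn
      by (simp add: ennreal_mult[symmetric] divide_ennreal davg_def four field_simps
          dvol_pos[THEN less_imp_le] dvol_pos[THEN less_imp_neq, symmetric])
  qed
  finally show ?thesis
  proof (subst (asm) ennreal_le_iff)
    have "0 \<le> (LINT x:dcube Q|lebesgue. norm (G x))"
      by (intro set_lebesgue_integral_nonneg) auto
    then show "0 \<le> real CARD('n) * 4 ^ CARD('n) * (2 powr real_of_int (fst Q) * davg (\<lambda>x. norm (G x)) Q)"
      by (simp add: davg_def less_imp_le[OF dvol_pos])
  qed
qed

text \<open>On the exceptional set \<open>S\<close> only the crude bound \<open>M\<close> holds. In
  \<open>dyadic_representation\<close> it is a ball outside of which \<open>f\<close> is small, for
  large cubes, and empty for small cubes.\<close>

lemma davg_bound: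
  fixes f :: "real ^ 'n \<Rightarrow> real"
  assumes f: "set_integrable lebesgue (dcube Q) f" and S: "S \<in> lmeasurable"
    and M: "\<And>x. x \<in> S \<Longrightarrow> \<bar>f x - c\<bar> \<le> M" and e: "\<And>x. x \<in> dcube Q \<Longrightarrow> x \<notin> S \<Longrightarrow> \<bar>f x - c\<bar> \<le> e"
    and "0 \<le> M" "0 \<le> e"
  shows "\<bar>davg f Q - c\<bar> \<le> e + M * measure lebesgue S / dvol TYPE('n) (fst Q)"
proof -
  let ?v = "dvol TYPE('n) (fst Q)"
  have [measurable]: "S \<in> sets lebesgue" using S by auto
  have "ennreal \<bar>davg f Q - c\<bar> \<le> (\<integral>\<^sup>+x\<in>dcube Q. ennreal \<bar>f x - c\<bar> \<partial>lebesgue) / ennreal ?v"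
    using average_deviation_le[OF f sets_dcube, of c] by (simp add: measure_dcube davg_def)
  also have "\<dots> \<le> (\<integral>\<^sup>+x. ennreal e * indicator (dcube Q) x + ennreal M * indicator S x \<partial>lebesgue) / ennreal ?v"
  proof (intro divide_right_mono_ennreal nn_integral_mono)
    fix x
    show "ennreal \<bar>f x - c\<bar> * indicator (dcube Q) x \<le> ennreal e * indicator (dcube Q) x + ennreal M * indicator S x"
    proof (cases "x \<in> S")
      case True
      then have "ennreal \<bar>f x - c\<bar> \<le> ennreal M" using M by (intro ennreal_leI) auto
      then show ?thesis using True by (auto split: split_indicator intro: add_increasing)
    next
      case False
      then show ?thesis using e by (auto split: split_indicator intro!: ennreal_leI)
    qed
  qed
  also have "\<dots> = (ennreal e * ennreal ?v + ennreal M * emeasure lebesgue S) / ennreal ?v"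
    by (subst nn_integral_add) (auto simp: nn_integral_cmult_indicator emeasure_dcube)
  also have "emeasure lebesgue S = ennreal (measure lebesgue S)"
    using S by (simp add: emeasure_eq_measure2)
  also have "(ennreal e * ennreal ?v + ennreal M * ennreal (measure lebesgue S)) / ennreal ?v = ennreal ((e * ?v + M * measure lebesgue S) / ?v)"
    using assms by (simp add: ennreal_mult[symmetric] ennreal_plus[symmetric] divide_ennreal less_imp_le[OF dvol_pos] del: ennreal_plus)
  finally have "\<bar>davg f Q - c\<bar> \<le> (e * ?v + M * measure lebesgue S) / ?v"
    by (subst (asm) ennreal_le_iff) (use assms in \<open>auto simp: less_imp_le[OF dvol_pos]\<close>)
  then show ?thesis by (simp add: add_divide_distrib dvol_pos[THEN less_imp_neq, symmetric])
qed

lemma nn_integral_count_space_sum_le: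
  fixes g :: "'a \<Rightarrow> ennreal"
  assumes "finite I"
  shows "(\<Sum>i\<in>I. g i) \<le> (\<integral>\<^sup>+i. g i \<partial>count_space UNIV)"
proof -
  have "(\<Sum>i\<in>I. g i) = (\<integral>\<^sup>+i. g i * indicator I i \<partial>count_space UNIV)"
    using assms by (subst nn_integral_count_space'[of I]) (auto intro!: sum.cong)
  also have "\<dots> \<le> (\<integral>\<^sup>+i. g i \<partial>count_space UNIV)"
    by (intro nn_integral_mono) (auto split: split_indicator)
  finally show ?thesis .
qed

text \<open>The telescoping runs from a fine scale, where the averages are close to
  \<open>f x\<close> by continuity, to a coarse one, where they are close to zero because
  \<open>f\<close> vanishes at infinity. At finite scales both are only approximate, which is what
  \<open>ennreal_le_epsilon\<close> absorbs.\<close>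

lemma dyadic_representation:
  fixes f :: "real ^ 'n \<Rightarrow> real"
  assumes f: "f \<in> C1_0"
  shows "ennreal \<bar>f x\<bar> \<le> ennreal (real CARD('n) * 4 ^ CARD('n)) *
    (\<integral>\<^sup>+i. ennreal (2 powr real_of_int i * davg (\<lambda>y. norm (gradient f y)) (i, dindex i x)) \<partial>count_space UNIV)"
    (is "_ \<le> ennreal ?C * (\<integral>\<^sup>+i. ennreal (?e i) \<partial>_)")
proof (rule ennreal_le_epsilon)
  fix e :: real assume e: "0 < e"
  let ?v = "dvol TYPE('n)"
  let ?a = "\<lambda>i. davg f (i, dindex i x)"
  note G = gradient_GDERIV[OF f]
  have Gc: "continuous_on UNIV (gradient f)" using f by (simp add: C1_0_def)
  have fc: "continuous_on UNIV f"
    using G has_derivative_continuous unfolding gderiv_def continuous_on_eq_continuous_within by blast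
  note si = set_integrable_dcube_continuous[OF fc]
  have lim: "(f \<longlongrightarrow> 0) at_infinity" using f by (simp add: C1_0_def)
  have "\<forall>\<^sub>F y in at_infinity. \<bar>f y\<bar> < e / 4"
    using tendstoD[OF lim, of "e / 4"] e by (simp add: dist_real_def)
  then obtain r where r: "\<And>y. r \<le> norm y \<Longrightarrow> \<bar>f y\<bar> < e / 4" unfolding eventually_at_infinity by blast
  have "bounded (f ` cball 0 r)"
    by (intro compact_imp_bounded compact_continuous_image) (auto intro: continuous_on_subset[OF fc])
  then obtain M where M: "M > 0" "\<And>y. y \<in> cball 0 r \<Longrightarrow> \<bar>f y\<bar> \<le> M" unfolding bounded_pos by auto
  have large: "\<exists>N. \<forall>i\<ge>int N. \<bar>?a i\<bar> \<le> e / 2"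
  proof -
    obtain N :: nat where N: "M * measure lebesgue (cball (0::real^'n) r) * 4 / e < real N" using reals_Archimedean2 by blast
    have "\<bar>?a i\<bar> \<le> e / 2" if i: "int N \<le> i" for i
    proof -
      have "real N \<le> 2 powr real N" by (simp add: powr_realpow of_nat_less_two_power less_imp_le)
      also have "\<dots> \<le> 2 powr (real CARD('n) * real_of_int i)"
      proof (rule powr_mono)
        have "1 * real N \<le> real CARD('n) * real_of_int i" using i by (intro mult_mono) auto
        then show "real N \<le> real CARD('n) * real_of_int i" by simp
      qed simp
      also have "\<dots> = ?v i" by (simp add: dvol_def)
      finally have "M * measure lebesgue (cball (0::real^'n) r) * 4 / e \<le> ?v i" using N by linarith
      then have small: "M * measure lebesgue (cball (0::real^'n) r) / ?v i \<le> e / 4"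
        using e dvol_pos[where 'n = 'n, of i] by (simp add: field_simps)
      have "\<bar>?a i - 0\<bar> \<le> e / 4 + M * measure lebesgue (cball (0::real^'n) r) / ?v (fst (i, dindex i x))"
      proof (rule davg_bound[OF si])
        show "\<bar>f x - 0\<bar> \<le> e / 4" if "x \<notin> cball 0 r" for x
          using r[of x] that by (simp add: less_imp_le)
      qed (use M e in auto)
      with small show ?thesis unfolding fst_conv diff_0_right by linarith
    qed
    then show ?thesis by blast
  qed
  have small: "\<exists>N. \<forall>i\<le>- int N. \<bar>f x - ?a i\<bar> \<le> e / 2"
  proof -
    have "isCont f x" using fc by (simp add: continuous_on_eq_continuous_at)
    then obtain d where d: "d > 0" "\<And>y. dist y x < d \<Longrightarrow> \<bar>f y - f x\<bar> < e / 2"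
      using e unfolding continuous_at_eps_delta dist_real_def by (meson half_gt_zero)
    obtain N :: nat where N: "real CARD('n) / d < real N" using reals_Archimedean2 by blast
    have "\<bar>f x - ?a i\<bar> \<le> e / 2" if i: "i \<le> - int N" for i
    proof -
      have "real N < 2 powr real N" by (simp add: powr_realpow of_nat_less_two_power)
      then have "real CARD('n) / d < 2 powr real N" using N by linarith
      then have "real CARD('n) * 2 powr - real N < d" using d(1) by (simp add: powr_minus field_simps)
      moreover have "real CARD('n) * 2 powr real_of_int i \<le> real CARD('n) * 2 powr - real N"
        using i by (intro mult_left_mono powr_mono) auto
      ultimately have lt: "real CARD('n) * 2 powr real_of_int i < d" by linarith
      have "\<bar>?a i - f x\<bar> \<le> e / 2 + 0 * measure lebesgue ({}::(real^'n) set) / ?v (fst (i, dindex i x))"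
      proof (rule davg_bound[OF si])
        show "\<bar>f y - f x\<bar> \<le> e / 2" if "y \<in> dcube (i, dindex i x)" for y
        proof -
          have "norm (y - x) \<le> real CARD('n) * 2 powr real_of_int (fst (i, dindex i x))"
            by (rule dclosure_diameter) (use that mem_dcube_dindex dcube_subset_dclosure in blast)+
          then have "dist y x < d" using lt by (simp add: dist_norm)
          then show ?thesis using d(2) less_imp_le by blast
        qed
      qed (use e in auto)
      then show ?thesis by (simp add: abs_minus_commute)
    qed
    then show ?thesis by blast
  qed
  from large small obtain N1 N2 where N1: "\<And>i. int N1 \<le> i \<Longrightarrow> \<bar>?a i\<bar> \<le> e / 2"
    and N2: "\<And>i. i \<le> - int N2 \<Longrightarrow> \<bar>f x - ?a i\<bar> \<le> e / 2" by blast
  define m where "m = N1 + N2"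
  have enn: "0 \<le> ?e i" for i
    unfolding davg_def
    by (intro mult_nonneg_nonneg divide_nonneg_nonneg set_lebesgue_integral_nonneg) (auto simp: less_imp_le[OF dvol_pos])
  have step: "\<bar>?a (i - 1) - ?a i\<bar> \<le> ?C * ?e i" for i
  proof -
    have "(i - 1, dindex (i - 1) x) \<in> dchild (i, dindex i x)" by (auto simp: dchild_def dindex_div)
    from davg_dchild_diff[OF G Gc this] show ?thesis by simp
  qed
  have tele: "\<bar>?a (- int N2) - ?a (- int N2 + int k)\<bar> \<le> ?C * (\<Sum>i\<in>{- int N2<..- int N2 + int k}. ?e i)" for k
  proof (induction k)
    case 0
    then show ?case by simp
  next
    case (Suc k)
    let ?i = "- int N2 + int (Suc k)"
    have set: "{- int N2<..?i} = insert ?i {- int N2<..- int N2 + int k}" by auto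
    have "\<bar>?a (- int N2) - ?a ?i\<bar> \<le> \<bar>?a (- int N2) - ?a (- int N2 + int k)\<bar> + \<bar>?a (?i - 1) - ?a ?i\<bar>"
      by simp
    also have "\<dots> \<le> ?C * (\<Sum>i\<in>{- int N2<..- int N2 + int k}. ?e i) + ?C * ?e ?i"
      using Suc.IH step[of ?i] by (intro add_mono)
    also have "\<dots> = ?C * (\<Sum>i\<in>{- int N2<..?i}. ?e i)"
      unfolding set by (subst sum.insert) (auto simp: algebra_simps)
    finally show ?case .
  qed
  let ?I = "{- int N2<..- int N2 + int m}"
  have "\<bar>f x\<bar> \<le> \<bar>f x - ?a (- int N2)\<bar> + \<bar>?a (- int N2) - ?a (- int N2 + int m)\<bar> + \<bar>?a (- int N2 + int m)\<bar>"
    by linarith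
  also have "\<dots> \<le> e / 2 + ?C * (\<Sum>i\<in>?I. ?e i) + e / 2"
    by (intro add_mono tele N1 N2) (auto simp: m_def)
  finally have "ennreal \<bar>f x\<bar> \<le> ennreal (?C * (\<Sum>i\<in>?I. ?e i) + e)" by (intro ennreal_leI) linarith
  also have "\<dots> = ennreal ?C * (\<Sum>i\<in>?I. ennreal (?e i)) + ennreal e"
    using e enn by (simp add: ennreal_mult[symmetric] sum_nonneg)
  also have "\<dots> \<le> ennreal ?C * (\<integral>\<^sup>+i. ennreal (?e i) \<partial>count_space UNIV) + ennreal e"
    by (intro add_right_mono mult_left_mono nn_integral_count_space_sum_le) auto
  finally show "ennreal \<bar>f x\<bar> \<le> ennreal ?C * (\<integral>\<^sup>+i. ennreal (?e i) \<partial>count_space UNIV) + ennreal e" .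
qed

section \<open>A dyadic maximal function and its level sets\<close>

definition dtriple :: "int \<times> ('n \<Rightarrow> int) \<Rightarrow> (real ^ 'n) set" where
  "dtriple Q = {x. \<forall>a. \<bar>dindex (fst Q) x a - snd Q a\<bar> \<le> 1}"

text \<open>A dyadic substitute for the maximal function. The point need only lie in the triple of
  the averaging cube, because a cube around \<open>x\<close> can meet the neighbours of the dyadic
  cube of \<open>x\<close>. Being a supremum over countably many labels, it is measurable.\<close>

definition dmaximal :: "(real ^ 'n \<Rightarrow> real) \<Rightarrow> real ^ 'n \<Rightarrow> ennreal" where
  "dmaximal g x = (SUP Q. (\<integral>\<^sup>+y\<in>dcube Q. ennreal \<bar>g y\<bar> \<partial>lebesgue) / ennreal (dvol TYPE('n) (fst Q)) * indicator (dtriple Q) x)"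

definition near :: "('n \<Rightarrow> int) \<Rightarrow> ('n \<Rightarrow> int) set" where
  "near k = PiE UNIV (\<lambda>a. {k a - 1..k a + 1})"

lemma mem_near: "k' \<in> near k \<longleftrightarrow> (\<forall>a. \<bar>k' a - k a\<bar> \<le> 1)"
  unfolding near_def PiE_def by (auto simp: abs_le_iff Pi_iff; metis diff_le_eq add.commute le_diff_eq)

lemma finite_near [simp]: "finite (near (k :: 'n::finite \<Rightarrow> int))"
  unfolding near_def by (intro finite_PiE) auto

lemma card_near: "card (near (k :: 'n::finite \<Rightarrow> int)) = 3 ^ CARD('n)"
  unfolding near_def by (subst card_PiE) auto

lemma sets_dtriple [measurable, simp]: "dtriple Q \<in> sets lebesgue"
proof -
  have "dtriple Q = dindex (fst Q) -` {k. \<forall>a. \<bar>k a - snd Q a\<bar> \<le> 1} \<inter> space lebesgue"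
    by (auto simp: dtriple_def)
  moreover have "dindex (fst Q) -` {k. \<forall>a. \<bar>k a - snd Q a\<bar> \<le> 1} \<inter> space lebesgue \<in> sets lebesgue"
    by (rule measurable_sets[OF measurable_dindex]) simp
  ultimately show ?thesis by (simp only:)
qed

lemma dtriple_eq_UN: "dtriple Q = (\<Union>k\<in>near (snd Q). dcube (fst Q, k))"
  by (auto simp: dtriple_def mem_near mem_dcube)

lemma emeasure_dtriple_le:
  "emeasure lebesgue (dtriple Q) \<le> ennreal (3 ^ CARD('n) * dvol TYPE('n) (fst Q))"
  for Q :: "int \<times> ('n::finite \<Rightarrow> int)"
proof -
  have "emeasure lebesgue (dtriple Q) \<le> (\<Sum>k\<in>near (snd Q). emeasure lebesgue (dcube (fst Q, k)))"
    unfolding dtriple_eq_UN by (rule emeasure_subadditive_finite) auto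
  also have "\<dots> = ennreal (3 ^ CARD('n) * dvol TYPE('n) (fst Q))"
    by (simp add: emeasure_dcube card_near ennreal_mult less_imp_le[OF dvol_pos] flip: ennreal_power)
  finally show ?thesis .
qed

lemma measurable_dmaximal [measurable]: "dmaximal g \<in> borel_measurable lebesgue"
  unfolding dmaximal_def by measurable

lemma dindex_close:
  assumes "\<bar>x $ a - y $ a\<bar> \<le> 2 powr real_of_int i"
  shows "\<bar>dindex i x a - dindex i y a\<bar> \<le> 1"
proof -
  define u v where "u = x $ a / 2 powr real_of_int i" and "v = y $ a / 2 powr real_of_int i"
  have "\<bar>u - v\<bar> = \<bar>x $ a - y $ a\<bar> / 2 powr real_of_int i"
    by (simp add: u_def v_def flip: diff_divide_distrib)
  also have "\<dots> \<le> 1" using assms by simp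
  finally show ?thesis unfolding dindex_def u_def[symmetric] v_def[symmetric]
    by (auto simp: abs_le_iff) linarith+
qed

text \<open>A cube of side \<open>l\<close> around \<open>x\<close> is covered by the
  \<open>3 ^ CARD('n)\<close> cubes near \<open>x\<close> of a scale \<open>i\<close> with
  \<open>2 powr i\<close> between \<open>l\<close> and \<open>2 * l\<close>. Each has at most
  \<open>2 ^ CARD('n)\<close> times its volume, and every one of their triples contains
  \<open>x\<close>.\<close>

lemma maximal_function_le_dmaximal:
  fixes g :: "real ^ 'n \<Rightarrow> real"
  assumes [measurable]: "g \<in> borel_measurable lebesgue"
  shows "maximal_function g x \<le> ennreal (6 ^ CARD('n)) * dmaximal g x"
  unfolding maximal_function_def
proof (rule SUP_least)
  fix D :: "(real ^ 'n) set" assume "D \<in> {Q \<in> cubes. x \<in> Q}"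
  then obtain a b l where D: "D = cbox a b" and l: "l > 0" "\<And>i. b $ i - a $ i = l" and x: "x \<in> D"
    unfolding cubes_def by auto
  define i where "i = \<lceil>log 2 l\<rceil>"
  let ?v = "dvol TYPE('n) i"
  let ?G = "\<lambda>k. \<integral>\<^sup>+y\<in>dcube (i, k). ennreal \<bar>g y\<bar> \<partial>lebesgue"
  have "log 2 l \<le> real_of_int i" by (simp add: i_def)
  then have "2 powr log 2 l \<le> 2 powr real_of_int i" by (intro powr_mono) auto
  then have l_le: "l \<le> 2 powr real_of_int i" using l by simp
  have "real_of_int i \<le> log 2 l + 1" unfolding i_def by linarith
  then have "2 powr real_of_int i \<le> 2 powr (log 2 l + 1)" by (intro powr_mono) auto
  then have l_ge: "2 powr real_of_int i \<le> 2 * l" using l by (simp add: powr_add)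
  have "b = (\<chi> j. a $ j + l)" using l(2) by (simp add: vec_eq_iff) (metis diff_add_cancel add.commute)
  then have mD: "measure lebesgue D = l ^ CARD('n)" using cart_interval_measure[OF l(1), of a] D by simp
  have eD: "emeasure lebesgue D = ennreal (l ^ CARD('n))"
    unfolding mD[symmetric] D by (rule emeasure_eq_ennreal_measure) (simp add: emeasure_lborel_cbox_eq)
  have v_le: "?v \<le> 2 ^ CARD('n) * l ^ CARD('n)"
  proof -
    have "?v = (2 powr real_of_int i) ^ CARD('n)"
      by (simp add: dvol_def powr_powr mult.commute flip: powr_realpow)
    also have "\<dots> \<le> (2 * l) ^ CARD('n)" using l_ge by (intro power_mono) auto
    finally show ?thesis by (simp add: power_mult_distrib)
  qed
  have G_le: "?G k \<le> ennreal ?v * dmaximal g x" if "k \<in> near (dindex i x)" for k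
  proof -
    have "x \<in> dtriple (i, k)" using that by (auto simp: dtriple_def mem_near abs_minus_commute)
    then have "?G k / ennreal ?v = ?G (snd (i, k)) / ennreal (dvol TYPE('n) (fst (i, k))) * indicator (dtriple (i, k)) x"
      by simp
    also have "\<dots> \<le> dmaximal g x" unfolding dmaximal_def
      by (rule SUP_upper2[of "(i, k)"]) auto
    finally have "ennreal ?v * (?G k / ennreal ?v) \<le> ennreal ?v * dmaximal g x"
      by (intro mult_left_mono) auto
    then show ?thesis
      by (simp add: ennreal_times_divide ennreal_mult_divide_eq mult.commute[of "ennreal _"]
          dvol_pos[THEN less_imp_neq, symmetric] less_imp_le[OF dvol_pos])
  qed
  have "(\<integral>\<^sup>+y\<in>D. ennreal \<bar>g y\<bar> \<partial>lebesgue) \<le> (\<integral>\<^sup>+y. (\<Sum>k\<in>near (dindex i x). ennreal \<bar>g y\<bar> * indicator (dcube (i, k)) y) \<partial>lebesgue)"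
  proof (rule nn_integral_mono)
    fix y
    show "ennreal \<bar>g y\<bar> * indicator D y \<le> (\<Sum>k\<in>near (dindex i x). ennreal \<bar>g y\<bar> * indicator (dcube (i, k)) y)"
    proof (cases "y \<in> D")
      case True
      have "\<bar>y $ j - x $ j\<bar> \<le> 2 powr real_of_int i" for j
        using True x l(2)[of j] l_le unfolding D mem_box_cart by (smt (verit))
      then have near: "dindex i y \<in> near (dindex i x)" by (auto simp: mem_near dindex_close)
      have "ennreal \<bar>g y\<bar> * indicator D y = ennreal \<bar>g y\<bar> * indicator (dcube (i, dindex i y)) y"
        using True by (simp add: mem_dcube_dindex)
      also have "\<dots> \<le> (\<Sum>k\<in>near (dindex i x). ennreal \<bar>g y\<bar> * indicator (dcube (i, k)) y)"
        using near by (intro member_le_sum) auto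
      finally show ?thesis .
    qed simp
  qed
  also have "\<dots> = (\<Sum>k\<in>near (dindex i x). ?G k)" by (rule nn_integral_sum) measurable
  also have "\<dots> \<le> (\<Sum>k\<in>near (dindex i x). ennreal ?v * dmaximal g x)" by (intro sum_mono G_le)
  also have "\<dots> = ennreal (3 ^ CARD('n)) * (ennreal ?v * dmaximal g x)"
    by (simp add: card_near flip: ennreal_power)
  also have "\<dots> \<le> ennreal (3 ^ CARD('n)) * (ennreal (2 ^ CARD('n) * l ^ CARD('n)) * dmaximal g x)"
    by (intro mult_left_mono mult_right_mono ennreal_leI v_le) auto
  also have "\<dots> = ennreal (6 ^ CARD('n)) * dmaximal g x * ennreal (l ^ CARD('n))"
  proof -
    have "(6::real) ^ CARD('n) = 3 ^ CARD('n) * 2 ^ CARD('n)" by (simp add: power_mult_distrib[symmetric])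
    then show ?thesis using l by (simp add: ennreal_mult mult_ac)
  qed
  finally have "(\<integral>\<^sup>+y\<in>D. ennreal \<bar>g y\<bar> \<partial>lebesgue) / ennreal (l ^ CARD('n)) \<le> ennreal (6 ^ CARD('n)) * dmaximal g x * ennreal (l ^ CARD('n)) / ennreal (l ^ CARD('n))"
    by (rule divide_right_mono_ennreal)
  also have "\<dots> = ennreal (6 ^ CARD('n)) * dmaximal g x"
    using l by (intro ennreal_mult_divide_eq) auto
  finally show "average D (\<lambda>y. ennreal \<bar>g y\<bar>) \<le> ennreal (6 ^ CARD('n)) * dmaximal g x"
    by (simp add: average_def eD)
qed

section \<open>The weak type inequality by selection of maximal cubes\<close>

definition dparent :: "int \<times> ('n \<Rightarrow> int) \<Rightarrow> int \<times> ('n \<Rightarrow> int)" where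
  "dparent Q = (fst Q + 1, \<lambda>a. snd Q a div 2)"

lemma dchild_dparent: "Q \<in> dchild (dparent Q)"
  unfolding dchild_def dparent_def by (cases Q) auto

text \<open>Integers at distance at most one stay so after division by two. Hence the triple of a
  selected cube contains the triples of all cubes below it, and it is enough to count maximal
  selected cubes.\<close>

lemma dtriple_dparent: "dtriple Q \<subseteq> dtriple (dparent Q)"
proof
  fix x assume x: "x \<in> dtriple Q"
  have "\<bar>dindex (fst Q + 1) x a - snd Q a div 2\<bar> \<le> 1" for a
  proof -
    have 1: "\<bar>dindex (fst Q) x a - snd Q a\<bar> \<le> 1" using x by (auto simp: dtriple_def)
    have 2: "dindex (fst Q + 1) x a = dindex (fst Q) x a div 2" using dindex_div[of "fst Q + 1" x a] by simp
    show ?thesis unfolding 2 using 1 by presburger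
  qed
  then show "x \<in> dtriple (dparent Q)" by (simp add: dtriple_def dparent_def)
qed

lemma fst_dparent_funpow: "fst ((dparent ^^ l) Q) = fst Q + int l"
  by (induction l) (auto simp: dparent_def)

text \<open>
  The union of the triples of the maximal cubes with property \<open>P\<close> among the first \<open>m\<close> generations
  of \<open>Q\<close>; since those cubes are disjoint, its measure is controlled.
\<close>

fun stopping_set :: "(int \<times> ('n \<Rightarrow> int) \<Rightarrow> bool) \<Rightarrow> nat \<Rightarrow> int \<times> ('n \<Rightarrow> int) \<Rightarrow> (real ^ 'n) set" where
  "stopping_set P 0 Q = {}"
| "stopping_set P (Suc m) Q = (if P Q then dtriple Q else (\<Union>R\<in>dchild Q. stopping_set P m R))"

lemma sets_stopping_set [measurable, simp]: "stopping_set P m (Q :: int \<times> ('n::finite \<Rightarrow> int)) \<in> sets lebesgue"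
  by (induction m arbitrary: Q) (auto intro!: sets.finite_UN finite_dchild)

lemma dtriple_funpow_dparent: "dtriple Q \<subseteq> dtriple ((dparent ^^ l) Q)"
proof (induction l)
  case (Suc l)
  from Suc.IH dtriple_dparent[of "(dparent ^^ l) Q"] have "dtriple Q \<subseteq> dtriple (dparent ((dparent ^^ l) Q))"
    by (rule subset_trans)
  then show ?case by (simp only: funpow.simps(2) o_apply)
qed simp

text \<open>Either an ancestor met on the way down is selected, and its triple contains that of
  \<open>Q\<close>, or the recursion reaches \<open>Q\<close> itself. It visits the generations 0 to
  \<open>m - 1\<close>, whence the strict inequality.\<close>

lemma dtriple_subset_stopping_set:
  "l < m \<Longrightarrow> P Q \<Longrightarrow> dtriple Q \<subseteq> stopping_set P m ((dparent ^^ l) Q)"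
proof (induction m arbitrary: l)
  case (Suc m)
  show ?case
  proof (cases "P ((dparent ^^ l) Q)")
    case True
    then show ?thesis using dtriple_funpow_dparent[of Q l] by simp
  next
    case False
    then obtain l' where l': "l = Suc l'" using Suc.prems by (cases l) auto
    then have "dtriple Q \<subseteq> stopping_set P m ((dparent ^^ l') Q)" using Suc by auto
    moreover have "(dparent ^^ l') Q \<in> dchild ((dparent ^^ l) Q)" by (simp add: l' dchild_dparent)
    ultimately show ?thesis using False by auto
  qed
qed simp

lemma emeasure_stopping_set_le:
  fixes Q :: "int \<times> ('n::finite \<Rightarrow> int)"
  assumes [measurable]: "g \<in> borel_measurable lebesgue" and "0 < s"
    and P: "\<And>Q. P Q \<Longrightarrow> ennreal (s * dvol TYPE('n) (fst Q)) \<le> (\<integral>\<^sup>+y\<in>dcube Q. g y \<partial>lebesgue)"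
  shows "emeasure lebesgue (stopping_set P m Q) \<le> ennreal (3 ^ CARD('n) / s) * (\<integral>\<^sup>+y\<in>dcube Q. g y \<partial>lebesgue)"
proof (induction m arbitrary: Q)
  case (Suc m)
  show ?case
  proof (cases "P Q")
    case True
    have "emeasure lebesgue (dtriple Q) \<le> ennreal (3 ^ CARD('n) * dvol TYPE('n) (fst Q))"
      by (rule emeasure_dtriple_le)
    also have "\<dots> = ennreal (3 ^ CARD('n) / s) * ennreal (s * dvol TYPE('n) (fst Q))"
      using \<open>0 < s\<close> by (subst ennreal_mult[symmetric]) (auto simp: less_imp_le[OF dvol_pos])
    also have "\<dots> \<le> ennreal (3 ^ CARD('n) / s) * (\<integral>\<^sup>+y\<in>dcube Q. g y \<partial>lebesgue)"
      by (intro mult_left_mono P True) auto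
    finally show ?thesis using True by simp
  next
    case False
    have "emeasure lebesgue (stopping_set P (Suc m) Q) \<le> (\<Sum>R\<in>dchild Q. emeasure lebesgue (stopping_set P m R))"
      unfolding stopping_set.simps if_not_P[OF False]
      by (rule emeasure_subadditive_finite[OF finite_dchild]) auto
    also have "\<dots> \<le> (\<Sum>R\<in>dchild Q. ennreal (3 ^ CARD('n) / s) * (\<integral>\<^sup>+y\<in>dcube R. g y \<partial>lebesgue))"
      by (intro sum_mono Suc.IH)
    also have "\<dots> = ennreal (3 ^ CARD('n) / s) * (\<integral>\<^sup>+y\<in>dcube Q. g y \<partial>lebesgue)"
      by (subst nn_integral_dcube_eq_sum) (auto simp: sum_distrib_left)
    finally show ?thesis .
  qed
qed simp

text \<open>Restricting the scales to those between \<open>- N\<close> and \<open>N\<close> gives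
  sets \<open>A N\<close> that exhaust the level set. The cubes used for \<open>A N\<close> all
  descend from cubes of scale \<open>N\<close>, so each family of maximal cubes is found from a
  root, and the roots partition the space.\<close>

lemma dmaximal_weak_type:
  fixes g :: "real ^ 'n \<Rightarrow> real"
  assumes g [measurable]: "g \<in> borel_measurable lebesgue" and s: "0 < s"
  shows "emeasure lebesgue {x. ennreal s < dmaximal g x} \<le> ennreal (3 ^ CARD('n) / s) * (\<integral>\<^sup>+y. ennreal \<bar>g y\<bar> \<partial>lebesgue)"
proof -
  let ?G = "\<lambda>Q. \<integral>\<^sup>+y\<in>dcube Q. ennreal \<bar>g y\<bar> \<partial>lebesgue"
  let ?v = "\<lambda>Q. dvol TYPE('n) (fst Q)"
  define P where "P Q \<longleftrightarrow> ennreal s < ?G Q / ennreal (?v Q)" for Q :: "int \<times> ('n \<Rightarrow> int)"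
  have P: "ennreal (s * ?v Q) \<le> ?G Q" if "P Q" for Q :: "int \<times> ('n \<Rightarrow> int)"
  proof -
    have "ennreal (s * ?v Q) = ennreal s * ennreal (?v Q)" using s by (intro ennreal_mult) (auto simp: less_imp_le[OF dvol_pos])
    also have "\<dots> \<le> (?G Q / ennreal (?v Q)) * ennreal (?v Q)"
      using that unfolding P_def by (intro mult_right_mono less_imp_le) auto
    also have "\<dots> = ?G Q"
      by (simp add: ennreal_divide_times ennreal_mult_divide_eq dvol_pos[THEN less_imp_neq, symmetric] less_imp_le[OF dvol_pos])
    finally show ?thesis .
  qed
  define A where "A N = (\<Union>Q\<in>{Q. \<bar>fst Q\<bar> \<le> int N \<and> P Q}. dtriple Q)" for N :: nat
  have A_sets [measurable]: "A N \<in> sets lebesgue" for N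
    unfolding A_def by (intro sets.countable_UN') auto
  have eq: "{x. ennreal s < dmaximal g x} = (\<Union>N. A N)"
  proof (intro set_eqI iffI)
    fix x assume "x \<in> {x. ennreal s < dmaximal g x}"
    then obtain Q where "ennreal s < ?G Q / ennreal (?v Q) * indicator (dtriple Q) x"
      unfolding dmaximal_def less_SUP_iff by blast
    then have "x \<in> dtriple Q" "P Q" unfolding P_def by (auto split: split_indicator_asm)
    then have "x \<in> A (nat \<bar>fst Q\<bar>)" unfolding A_def by (intro UN_I[of Q]) auto
    then show "x \<in> (\<Union>N. A N)" by blast
  next
    fix x assume "x \<in> (\<Union>N. A N)"
    then obtain Q where Q: "x \<in> dtriple Q" "P Q" unfolding A_def by blast
    have "ennreal s < ?G Q / ennreal (?v Q) * indicator (dtriple Q) x" using Q by (simp add: P_def)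
    also have "\<dots> \<le> dmaximal g x" unfolding dmaximal_def by (rule SUP_upper) auto
    finally show "x \<in> {x. ennreal s < dmaximal g x}" by simp
  qed
  have A_le: "emeasure lebesgue (A N) \<le> ennreal (3 ^ CARD('n) / s) * (\<integral>\<^sup>+y. ennreal \<bar>g y\<bar> \<partial>lebesgue)" for N
  proof -
    \<comment> \<open>Both extreme scales \<open>- N\<close> and \<open>N\<close> occur, which makes
      \<open>2 * N + 1\<close> generations.\<close>
    let ?S = "\<lambda>k. stopping_set P (2 * N + 1) (int N, k)"
    have "emeasure lebesgue (A N) = (\<integral>\<^sup>+x. indicator (A N) x \<partial>lebesgue)" by simp
    also have "\<dots> \<le> (\<integral>\<^sup>+x. (\<integral>\<^sup>+k. indicator (?S k) x \<partial>count_space UNIV) \<partial>lebesgue)"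
    proof (rule nn_integral_mono)
      fix x
      show "indicator (A N) x \<le> (\<integral>\<^sup>+k. indicator (?S k) x \<partial>count_space UNIV)"
      proof (cases "x \<in> A N")
        case True
        then obtain Q where Q: "x \<in> dtriple Q" "P Q" "\<bar>fst Q\<bar> \<le> int N" unfolding A_def by blast
        define l where "l = nat (int N - fst Q)"
        define k where "k = snd ((dparent ^^ l) Q)"
        have "(dparent ^^ l) Q = (int N, k)"
          using fst_dparent_funpow[of l Q] Q(3) by (auto simp: k_def l_def prod_eq_iff)
        moreover have "l < 2 * N + 1" using Q(3) by (auto simp: l_def)
        ultimately have "dtriple Q \<subseteq> ?S k" using dtriple_subset_stopping_set[of l "2 * N + 1" P Q] Q(2) by simp
        then have "x \<in> ?S k" using Q(1) by blast
        then have "indicator (A N) x \<le> (\<Sum>k\<in>{k}. indicator (?S k) x :: ennreal)"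
          by (simp split: split_indicator)
        also have "\<dots> \<le> (\<integral>\<^sup>+k. indicator (?S k) x \<partial>count_space UNIV)"
          by (rule nn_integral_count_space_sum_le) simp
        finally show ?thesis .
      qed simp
    qed
    also have "\<dots> = (\<integral>\<^sup>+k. (\<integral>\<^sup>+x. indicator (?S k) x \<partial>lebesgue) \<partial>count_space UNIV)"
      by (rule nn_integral_count_space_nn_integral) (auto simp del: stopping_set.simps)
    also have "\<dots> \<le> (\<integral>\<^sup>+k. ennreal (3 ^ CARD('n) / s) * ?G (int N, k) \<partial>count_space UNIV)"
    proof (rule nn_integral_mono)
      fix k
      have "(\<integral>\<^sup>+x. indicator (?S k) x \<partial>lebesgue) = emeasure lebesgue (?S k)"
        by (rule nn_integral_indicator[OF sets_stopping_set])
      also have "\<dots> \<le> ennreal (3 ^ CARD('n) / s) * ?G (int N, k)"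
        by (rule emeasure_stopping_set_le[OF _ s P]) auto
      finally show "(\<integral>\<^sup>+x. indicator (?S k) x \<partial>lebesgue) \<le> \<dots>" .
    qed
    also have "\<dots> = ennreal (3 ^ CARD('n) / s) * (\<integral>\<^sup>+y. ennreal \<bar>g y\<bar> \<partial>lebesgue)"
      by (subst nn_integral_eq_sum_dcube[where i = "int N"]) (auto simp: nn_integral_cmult)
    finally show ?thesis .
  qed
  have "emeasure lebesgue (\<Union>N. A N) = (SUP N. emeasure lebesgue (A N))"
  proof (rule SUP_emeasure_incseq[symmetric])
    show "incseq A" unfolding incseq_def A_def by (intro allI impI UN_mono) auto
  qed auto
  also have "\<dots> \<le> ennreal (3 ^ CARD('n) / s) * (\<integral>\<^sup>+y. ennreal \<bar>g y\<bar> \<partial>lebesgue)"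
    by (intro SUP_least A_le)
  finally show ?thesis by (simp add: eq)
qed

section \<open>Level sets of the maximal function and their packing condition\<close>

lemma sets_dmaximal: "A \<in> sets borel \<Longrightarrow> {x. dmaximal g x \<in> A} \<in> sets lebesgue"
proof -
  assume "A \<in> sets borel"
  then have "dmaximal g -` A \<inter> space lebesgue \<in> sets lebesgue" by (rule measurable_sets[OF measurable_dmaximal])
  moreover have "dmaximal g -` A \<inter> space lebesgue = {x. dmaximal g x \<in> A}" by auto
  ultimately show ?thesis by (simp only:)
qed

text \<open>The number \<open>2 powr k\<close> is the side length of a cube over which the whole
  norm of \<open>g\<close> would average to the upper threshold. The lower threshold of a level is
  the upper one of the next, so that the levels are disjoint.\<close>

definition dmax_level :: "(real ^ 'n \<Rightarrow> real) \<Rightarrow> int \<Rightarrow> (real ^ 'n) set" where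
  "dmax_level g k = {x. ennreal (dvol TYPE('n) (- (k + 1)) * (LINT y|lebesgue. \<bar>g y\<bar>)) < dmaximal g x \<and>
     dmaximal g x \<le> ennreal (dvol TYPE('n) (- k) * (LINT y|lebesgue. \<bar>g y\<bar>))}"

text \<open>The packing constant for the offset \<open>j\<close>: the bound by the volume, and the
  weak type bound. The constant \<open>3 ^ CARD('n)\<close> of the latter becomes
  \<open>6 ^ CARD('n)\<close> because on level \<open>k\<close> the maximal function is only known
  to exceed the threshold of index \<open>k + 1\<close>.\<close>

definition level_decay :: "'n itself \<Rightarrow> int \<Rightarrow> real" where
  "level_decay _ j = min 1 (6 ^ CARD('n) * dvol TYPE('n) (- j))"

lemma sets_dmax_level [measurable, simp]: "dmax_level g k \<in> sets lebesgue"
  for g :: "real ^ 'n \<Rightarrow> real"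
proof -
  have "{x \<in> space lebesgue. ennreal (dvol TYPE('n) (- (k + 1)) * (LINT y|lebesgue. \<bar>g y\<bar>)) < dmaximal g x \<and>
     dmaximal g x \<le> ennreal (dvol TYPE('n) (- k) * (LINT y|lebesgue. \<bar>g y\<bar>))} \<in> sets lebesgue"
    by measurable
  moreover have "space lebesgue = (UNIV :: (real ^ 'n) set)" by simp
  ultimately show ?thesis unfolding dmax_level_def by (simp only: UNIV_I simp_thms)
qed

lemma dvol_add: "dvol TYPE('n) (i + j) = dvol TYPE('n) i * dvol TYPE('n::finite) j"
  by (simp add: dvol_def powr_add[symmetric] distrib_left)

lemma dvol_mono: "i \<le> j \<Longrightarrow> dvol TYPE('n) i \<le> dvol TYPE('n::finite) j"
  by (simp add: dvol_def)

lemma dvol_1: "dvol TYPE('n::finite) 1 = 2 ^ CARD('n)"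
  by (simp add: dvol_def powr_realpow)

lemma level_decay_pos: "0 < level_decay TYPE('n::finite) j"
  by (simp add: level_decay_def)

lemma disjoint_dmax_level:
  fixes g :: "real ^ 'n \<Rightarrow> real"
  assumes "i \<noteq> j"
  shows "dmax_level g i \<inter> dmax_level g j = {}"
proof -
  have *: "dmax_level g i \<inter> dmax_level g j = {}" if "i < j" for i j
  proof -
    have False if x: "x \<in> dmax_level g i" "x \<in> dmax_level g j" for x
    proof -
      have "dvol TYPE('n) (- j) * (LINT y|lebesgue. \<bar>g y\<bar>) \<le> dvol TYPE('n) (- (i + 1)) * (LINT y|lebesgue. \<bar>g y\<bar>)"
        using \<open>i < j\<close> by (intro mult_right_mono dvol_mono Bochner_Integration.integral_nonneg) auto
      then have "dmaximal g x \<le> ennreal (dvol TYPE('n) (- (i + 1)) * (LINT y|lebesgue. \<bar>g y\<bar>))"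
        using x(2) by (auto simp: dmax_level_def intro: order_trans ennreal_leI)
      then show False using x(1) by (auto simp: dmax_level_def)
    qed
    then show ?thesis by blast
  qed
  show ?thesis using *[of i j] *[of j i] assms by (cases "i < j") (auto simp: Int_commute)
qed

lemma dmax_level_cover:
  fixes g :: "real ^ 'n \<Rightarrow> real"
  assumes M: "0 < (LINT y|lebesgue. \<bar>g y\<bar>)" and x: "dmaximal g x \<noteq> 0" "dmaximal g x \<noteq> \<infinity>"
  shows "\<exists>k. x \<in> dmax_level g k"
proof -
  define m where "m = enn2real (dmaximal g x)"
  let ?M = "LINT y|lebesgue. \<bar>g y\<bar>"
  have m: "dmaximal g x = ennreal m" "m > 0"
    using x by (auto simp: m_def enn2real_positive_iff top.not_eq_extremum zero_less_iff_neq_zero)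
  define t where "t = - log 2 (m / ?M) / real CARD('n)"
  define k where "k = \<lfloor>t\<rfloor>"
  have mM: "m = 2 powr (real CARD('n) * (- t)) * ?M"
    using m(2) M by (simp add: t_def)
  have "2 powr (real CARD('n) * (- t)) \<le> dvol TYPE('n) (- k)"
    unfolding dvol_def k_def by (intro powr_mono mult_left_mono) auto
  then have upper: "m \<le> dvol TYPE('n) (- k) * ?M" using M by (subst mM) (auto intro: mult_right_mono)
  have "dvol TYPE('n) (- (k + 1)) < 2 powr (real CARD('n) * (- t))"
    unfolding dvol_def k_def by (intro powr_less_mono mult_strict_left_mono) (auto, linarith)
  then have lower: "dvol TYPE('n) (- (k + 1)) * ?M < m" using M by (subst mM) (auto intro: mult_strict_right_mono)
  have "dmaximal g x \<le> ennreal (dvol TYPE('n) (- k) * ?M)" unfolding m(1) by (rule ennreal_leI[OF upper])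
  moreover have "ennreal (dvol TYPE('n) (- (k + 1)) * ?M) < dmaximal g x"
    unfolding m(1) by (subst ennreal_less_iff[OF _]) (use lower M in \<open>auto simp: less_imp_le[OF dvol_pos]\<close>)
  ultimately have "x \<in> dmax_level g k" unfolding dmax_level_def by blast
  then show ?thesis by blast
qed

lemma dmaximal_finite_AE:
  fixes g :: "real ^ 'n \<Rightarrow> real"
  assumes g: "integrable lebesgue g"
  shows "AE x in lebesgue. dmaximal g x \<noteq> \<infinity>"
proof -
  define M where "M = (LINT y|lebesgue. \<bar>g y\<bar>)"
  have gm [measurable]: "g \<in> borel_measurable lebesgue" using g by auto
  have gM: "(\<integral>\<^sup>+y. ennreal \<bar>g y\<bar> \<partial>lebesgue) = ennreal M"
    unfolding M_def using g by (intro nn_integral_eq_integral) auto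
  have M0: "M \<ge> 0" unfolding M_def by (intro Bochner_Integration.integral_nonneg) auto
  have "emeasure lebesgue {x. dmaximal g x = \<infinity>} \<le> ennreal e" if e: "0 < e" for e
  proof -
    \<comment> \<open>With \<open>M + 1\<close> instead of \<open>M\<close> the threshold is
      positive even if \<open>g\<close> vanishes.\<close>
    define s where "s = 3 ^ CARD('n) * (M + 1) / e"
    have s: "s > 0" using e M0 by (simp add: s_def)
    have meas: "{x. ennreal s < dmaximal g x} \<in> sets lebesgue"
      using sets_dmaximal[of "{ennreal s<..}" g, OF borel_open[OF open_greaterThan]] by (simp only: greaterThan_iff)
    have "emeasure lebesgue {x. dmaximal g x = \<infinity>} \<le> emeasure lebesgue {x. ennreal s < dmaximal g x}"
      by (rule emeasure_mono[OF _ meas]) auto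
    also have "\<dots> \<le> ennreal (3 ^ CARD('n) / s) * ennreal M"
      using dmaximal_weak_type[OF gm s] by (simp add: gM)
    also have "\<dots> = ennreal (3 ^ CARD('n) / s * M)" using s M0 by (subst ennreal_mult) auto
    also have "\<dots> \<le> ennreal e"
    proof (rule ennreal_leI)
      have "3 ^ CARD('n) / s = e / (M + 1)" by (simp add: s_def)
      then have "3 ^ CARD('n) / s * M = e * (M / (M + 1))" by simp
      also have "\<dots> \<le> e * 1" using e M0 by (intro mult_left_mono) auto
      finally show "3 ^ CARD('n) / s * M \<le> e" by simp
    qed
    finally show ?thesis .
  qed
  then have "emeasure lebesgue {x. dmaximal g x = \<infinity>} \<le> 0"
    by - (rule ennreal_le_epsilon, simp)
  moreover have "{x. dmaximal g x = \<infinity>} \<in> sets lebesgue"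
    using sets_dmaximal[of "{\<infinity>}" g, OF borel_singleton[OF sets.empty_sets]] by (simp only: singleton_iff)
  ultimately have "{x. dmaximal g x = \<infinity>} \<in> null_sets lebesgue" by auto
  from AE_not_in[OF this] show ?thesis by simp
qed

text \<open>Down the tree the scale decreases, the index of the level set with it, and so the
  maximal function increases: all level sets met below \<open>Q\<close> lie in the superlevel set
  \<open>W\<close> determined by the scale of \<open>Q\<close>. Being disjoint, they have total
  measure in \<open>Q\<close> at most that of \<open>W \<inter> dcube Q\<close>.\<close>

lemma level_sets_carleson:
  fixes g :: "real ^ 'n \<Rightarrow> real" and Q :: "int \<times> ('n \<Rightarrow> int)"
  assumes g: "integrable lebesgue g" and M: "0 < (LINT y|lebesgue. \<bar>g y\<bar>)"
  shows "tree_sum dchild m (\<lambda>Q. measure lebesgue (dcube Q \<inter> dmax_level g (fst Q - j))) Q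
    \<le> level_decay TYPE('n) j * dvol TYPE('n) (fst Q)"
proof -
  let ?M = "LINT y|lebesgue. \<bar>g y\<bar>"
  let ?B = "\<lambda>i. dmax_level g (i - j)"
  have gm [measurable]: "g \<in> borel_measurable lebesgue" using g by auto
  define s where "s = dvol TYPE('n) (- (fst Q - j + 1)) * ?M"
  have s: "s > 0" using M by (simp add: s_def)
  define W where "W = {x. ennreal s < dmaximal g x}"
  have W [measurable]: "W \<in> sets lebesgue"
    unfolding W_def using sets_dmaximal[of "{ennreal s<..}" g, OF borel_open[OF open_greaterThan]] by (simp only: greaterThan_iff)
  have pt: "(\<Sum>l<m. indicator (?B (fst Q - int l)) x :: ennreal) \<le> indicator W x" for x
  proof -
    have "(\<Sum>l<m. indicator (?B (fst Q - int l)) x :: ennreal) = indicator (\<Union>l<m. ?B (fst Q - int l)) x"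
      by (rule indicator_UN_disjoint[symmetric]) (auto simp: disjoint_family_on_def intro!: disjoint_dmax_level)
    also have "\<dots> \<le> indicator W x"
    proof -
      have "?B (fst Q - int l) \<subseteq> W" for l
      proof
        fix y assume y: "y \<in> ?B (fst Q - int l)"
        have "s \<le> dvol TYPE('n) (- (fst Q - int l - j + 1)) * ?M"
          unfolding s_def using M by (intro mult_right_mono dvol_mono) auto
        then have "ennreal s \<le> ennreal (dvol TYPE('n) (- (fst Q - int l - j + 1)) * ?M)" by (rule ennreal_leI)
        also have "\<dots> < dmaximal g y" using y by (simp add: dmax_level_def)
        finally show "y \<in> W" by (simp add: W_def)
      qed
      then show ?thesis by (auto split: split_indicator)
    qed
    finally show ?thesis .
  qed
  have "ennreal (tree_sum dchild m (\<lambda>Q. measure lebesgue (dcube Q \<inter> ?B (fst Q)) * 1) Q)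
      = (\<Sum>l<m. \<integral>\<^sup>+x\<in>dcube Q. ennreal 1 * indicator (?B (fst Q - int l)) x \<partial>lebesgue)"
    by (rule tree_sum_eq_nn_integral) auto
  also have "\<dots> = (\<integral>\<^sup>+x\<in>dcube Q. (\<Sum>l<m. indicator (?B (fst Q - int l)) x) \<partial>lebesgue)"
    unfolding sum_distrib_right ennreal_1 mult_1 by (rule nn_integral_sum[symmetric]) measurable
  also have "\<dots> \<le> (\<integral>\<^sup>+x\<in>dcube Q. indicator W x \<partial>lebesgue)"
    by (intro nn_integral_mono mult_right_mono pt) auto
  also have "\<dots> = (\<integral>\<^sup>+x. indicator (W \<inter> dcube Q) x \<partial>lebesgue)"
    by (intro nn_integral_cong) (auto split: split_indicator)
  also have "\<dots> = emeasure lebesgue (W \<inter> dcube Q)"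
    by (rule nn_integral_indicator) auto
  finally have le: "ennreal (tree_sum dchild m (\<lambda>Q. measure lebesgue (dcube Q \<inter> ?B (fst Q))) Q) \<le> emeasure lebesgue (W \<inter> dcube Q)"
    by simp
  have 1: "emeasure lebesgue (W \<inter> dcube Q) \<le> ennreal (dvol TYPE('n) (fst Q))"
    unfolding emeasure_dcube[symmetric] by (rule emeasure_mono) auto
  have 2: "emeasure lebesgue (W \<inter> dcube Q) \<le> ennreal (6 ^ CARD('n) * dvol TYPE('n) (- j) * dvol TYPE('n) (fst Q))"
  proof -
    have "emeasure lebesgue (W \<inter> dcube Q) \<le> emeasure lebesgue W" by (rule emeasure_mono) auto
    also have "\<dots> \<le> ennreal (3 ^ CARD('n) / s) * (\<integral>\<^sup>+y. ennreal \<bar>g y\<bar> \<partial>lebesgue)"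
      unfolding W_def by (rule dmaximal_weak_type[OF gm s])
    also have "(\<integral>\<^sup>+y. ennreal \<bar>g y\<bar> \<partial>lebesgue) = ennreal ?M"
      using g by (intro nn_integral_eq_integral) auto
    also have "ennreal (3 ^ CARD('n) / s) * ennreal ?M = ennreal (3 ^ CARD('n) / s * ?M)"
      using s M by (subst ennreal_mult) auto
    also have "3 ^ CARD('n) / s * ?M = 3 ^ CARD('n) * inverse (dvol TYPE('n) (- (fst Q - j + 1)))"
      using M by (simp add: s_def field_simps)
    also have "inverse (dvol TYPE('n) (- (fst Q - j + 1))) = dvol TYPE('n) (fst Q + (- j) + 1)"
      unfolding dvol_def powr_minus[symmetric] by (simp add: algebra_simps)
    also have "\<dots> = dvol TYPE('n) (fst Q) * dvol TYPE('n) (- j) * 2 ^ CARD('n)"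
      by (simp only: dvol_add dvol_1)
    also have "3 ^ CARD('n) * (dvol TYPE('n) (fst Q) * dvol TYPE('n) (- j) * 2 ^ CARD('n)) = 6 ^ CARD('n) * dvol TYPE('n) (- j) * dvol TYPE('n) (fst Q)"
    proof -
      have "(6::real) ^ CARD('n) = 3 ^ CARD('n) * 2 ^ CARD('n)" by (simp add: power_mult_distrib[symmetric])
      then show ?thesis by simp
    qed
    finally show ?thesis .
  qed
  have "tree_sum dchild m (\<lambda>Q. measure lebesgue (dcube Q \<inter> ?B (fst Q))) Q \<le> dvol TYPE('n) (fst Q)"
    using order_trans[OF le 1] by (subst (asm) ennreal_le_iff) (auto simp: less_imp_le[OF dvol_pos])
  moreover have "tree_sum dchild m (\<lambda>Q. measure lebesgue (dcube Q \<inter> ?B (fst Q))) Q \<le> 6 ^ CARD('n) * dvol TYPE('n) (- j) * dvol TYPE('n) (fst Q)"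
    using order_trans[OF le 2] by (subst (asm) ennreal_le_iff) (auto simp: less_imp_le[OF dvol_pos])
  ultimately show ?thesis
    unfolding level_decay_def by (auto simp: min_def)
qed

section \<open>Weights satisfying a reverse Hoelder inequality with exponent infinity\<close>

lemma set_integral_pos_AE:
  fixes h :: "real ^ 'n \<Rightarrow> real"
  assumes h: "set_integrable lebesgue (dcube Q) h" and pos: "AE x in lebesgue. 0 < h x"
  shows "0 < (LINT x:dcube Q|lebesgue. h x)"
proof -
  have int: "integrable lebesgue (\<lambda>x. indicator (dcube Q) x *\<^sub>R h x)"
    using h by (simp add: set_integrable_def)
  have nn: "AE x in lebesgue. 0 \<le> indicator (dcube Q) x *\<^sub>R h x"
    using pos by eventually_elim (auto split: split_indicator)
  have "\<not> (AE x in lebesgue. indicator (dcube Q) x *\<^sub>R h x = 0)"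
  proof
    assume "AE x in lebesgue. indicator (dcube Q) x *\<^sub>R h x = 0"
    with pos have "AE x in lebesgue. x \<notin> dcube Q" by eventually_elim (auto split: split_indicator_asm)
    then have "emeasure lebesgue (dcube Q) = 0" by (subst (asm) AE_iff_measurable[where N = "dcube Q"]) auto
    then show False using dvol_pos[where 'n = 'n, of "fst Q"] by (simp add: emeasure_dcube ennreal_eq_0_iff not_le)
  qed
  moreover have "0 \<le> (LINT x|lebesgue. indicator (dcube Q) x *\<^sub>R h x)"
    by (rule integral_nonneg_AE[OF nn])
  ultimately show ?thesis
    using integral_nonneg_eq_0_iff_AE[OF int nn] unfolding set_lebesgue_integral_def by linarith
qed

text \<open>A real-valued representative of the weight. The bound is assumed on all cubes, not on
  dyadic ones alone, because the doubling property is derived from cubes interpolating between a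
  dyadic cube and its parent.\<close>

locale RH_weight =
  fixes u :: "real ^ 'n \<Rightarrow> real" and K :: real
  assumes u_meas [measurable]: "u \<in> borel_measurable lebesgue"
    and u_nonneg: "\<And>x. 0 \<le> u x"
    and u_pos: "AE x in lebesgue. 0 < u x"
    and u_int: "\<And>D. D \<in> cubes \<Longrightarrow> set_integrable lebesgue D u"
    and K_pos: "0 < K"
    and RH: "\<And>D. D \<in> cubes \<Longrightarrow>
      AE x\<in>D in lebesgue. u x \<le> K * ((LINT x:D|lebesgue. u x) / measure lebesgue D)"
begin

definition mass :: "(real ^ 'n) set \<Rightarrow> real" where
  "mass D = (LINT x:D|lebesgue. u x)"

text \<open>On \<open>D - E\<close> the weight is at most \<open>K\<close> times its average over
  \<open>D\<close>, and by \<open>near\<close> this set is so small that it carries at most half of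
  the mass of \<open>D\<close>.\<close>

lemma mass_doubling_near:
  assumes D: "D \<in> cubes" and E: "E \<in> cubes" "E \<subseteq> D"
    and near: "2 * K * (measure lebesgue D - measure lebesgue E) \<le> measure lebesgue D"
    and D_pos: "0 < measure lebesgue D"
  shows "mass D \<le> 2 * mass E"
proof -
  have lm: "D \<in> lmeasurable" "E \<in> lmeasurable" using D E by (auto simp: cubes_def)
  then have sD [measurable]: "D \<in> sets lebesgue" "E \<in> sets lebesgue" by auto
  have iD: "set_integrable lebesgue (D - E) u"
    by (rule set_integrable_subset[OF u_int[OF D]]) auto
  have "mass D = mass (E \<union> (D - E))" using E by (simp add: Un_absorb1)
  also have "\<dots> = mass E + mass (D - E)"
    unfolding mass_def by (rule set_integral_Un) (use u_int[OF E(1)] iD in auto)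
  finally have split: "mass D = mass E + mass (D - E)" .
  have DE: "D - E \<in> lmeasurable" using lm by blast
  have "mass (D - E) \<le> (LINT x:(D - E)|lebesgue. K * (mass D / measure lebesgue D))"
    unfolding mass_def
  proof (rule set_integral_mono_AE[OF iD])
    show "set_integrable lebesgue (D - E) (\<lambda>x. K * ((LINT x:D|lebesgue. u x) / measure lebesgue D))"
      unfolding set_integrable_def using DE by (auto simp: integrable_indicator_iff fmeasurable_def)
    show "AE x\<in>D - E in lebesgue. u x \<le> K * ((LINT x:D|lebesgue. u x) / measure lebesgue D)"
      using RH[OF D] by (auto elim!: eventually_mono)
  qed
  also have "\<dots> = measure lebesgue (D - E) * (K * (mass D / measure lebesgue D))"
    using DE by (subst set_integral_const) (auto simp: fmeasurable_def)
  also have "measure lebesgue (D - E) = measure lebesgue D - measure lebesgue E"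
    using lm E by (intro measurable_measure_Diff) auto
  also have "\<dots> * (K * (mass D / measure lebesgue D)) = (2 * K * (measure lebesgue D - measure lebesgue E)) * (mass D / (2 * measure lebesgue D))"
    by simp
  also have "\<dots> \<le> measure lebesgue D * (mass D / (2 * measure lebesgue D))"
    using near D_pos by (intro mult_right_mono) (auto simp: mass_def intro!: divide_nonneg_nonneg set_lebesgue_integral_nonneg u_nonneg)
  also have "\<dots> = mass D / 2" using D_pos by simp
  finally show ?thesis using split by simp
qed

text \<open>In a chain of \<open>N\<close> steps from side \<open>l\<close> to side
  \<open>2 * l\<close>, consecutive side lengths have ratio at least \<open>1 - 1 / N\<close>, hence
  by Bernoulli's inequality the volumes have ratio at least \<open>1 - n / N\<close>. For
  \<open>N \<ge> 2 * K * n\<close> this is the closeness that \<open>mass_doubling_near\<close> asks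
  for.\<close>

definition doubling_steps :: nat where
  "doubling_steps = nat \<lceil>2 * K * real CARD('n)\<rceil> + 1"

text \<open>
  The two cubes are joined by a chain of \<open>doubling_steps\<close> interpolating cubes, each so close to the
  next one that it carries at least half of its mass.
\<close>

lemma mass_doubling:
  fixes a b :: "real ^ 'n"
  assumes l: "0 < l" and sub: "\<And>i. b $ i \<le> a $ i" "\<And>i. a $ i + l \<le> b $ i + 2 * l"
  shows "mass (cbox b (\<chi> i. b $ i + 2 * l)) \<le> 2 ^ doubling_steps * mass (cbox a (\<chi> i. a $ i + l))"
proof -
  let ?N = "doubling_steps"
  define t where "t j = real j / real ?N" for j
  define E where "E j = cbox (\<chi> i. a $ i + t j * (b $ i - a $ i)) (\<chi> i. (\<chi> i. a $ i + t j * (b $ i - a $ i)) $ i + l * (1 + t j))" for j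
  have N: "real ?N > 0" "2 * K * real CARD('n) \<le> real ?N"
    unfolding doubling_steps_def by linarith+
  have t: "0 \<le> t j" "t j \<le> t (Suc j)" for j using N by (auto simp: t_def divide_right_mono)
  have lp: "0 < l * (1 + t j)" for j using l t(1)[of j] by simp
  have E_cube: "E j \<in> cubes" for j
    unfolding cubes_def E_def using lp[of j] by (intro CollectI exI conjI refl) auto
  have E_meas: "measure lebesgue (E j) = (l * (1 + t j)) ^ CARD('n)" for j
    unfolding E_def by (rule cart_interval_measure[OF lp])
  have E_sub: "E j \<subseteq> E (Suc j)" for j
  proof -
    have 1: "t (Suc j) * (b $ i - a $ i) \<le> t j * (b $ i - a $ i)" for i
      using t(2)[of j] sub(1)[of i] by (intro mult_right_mono_neg) auto
    have 2: "t j * (b $ i - a $ i + l) \<le> t (Suc j) * (b $ i - a $ i + l)" for i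
      using t(2)[of j] sub(2)[of i] by (intro mult_right_mono) auto
    show ?thesis
    proof
      fix x assume x: "x \<in> E j"
      have "a $ i + t (Suc j) * (b $ i - a $ i) \<le> x $ i \<and> x $ i \<le> a $ i + t (Suc j) * (b $ i - a $ i) + l * (1 + t (Suc j))" for i
      proof -
        have "a $ i + t j * (b $ i - a $ i) \<le> x $ i \<and> x $ i \<le> a $ i + t j * (b $ i - a $ i) + l * (1 + t j)"
          using x by (simp add: E_def mem_box_cart)
        then show ?thesis using 1[of i] 2[of i] by (simp add: algebra_simps)
      qed
      then show "x \<in> E (Suc j)" by (simp add: E_def mem_box_cart)
    qed
  qed
  have step: "mass (E (Suc j)) \<le> 2 * mass (E j)" for j
  proof (rule mass_doubling_near[OF E_cube E_cube E_sub])
    show "0 < measure lebesgue (E (Suc j))" unfolding E_meas using lp by (intro zero_less_power)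
    define r where "r = (1 + t j) / (1 + t (Suc j))"
    have pos: "1 + t (Suc j) > 0" using t(1)[of "Suc j"] by simp
    have r: "r \<ge> 1 - 1 / real ?N"
    proof -
      have eq: "t (Suc j) - t j = 1 / real ?N" by (simp add: t_def add_divide_distrib)
      have "r = 1 - (t (Suc j) - t j) / (1 + t (Suc j))" using pos by (simp add: r_def field_simps)
      then have "r = 1 - 1 / real ?N / (1 + t (Suc j))" unfolding eq .
      moreover have "1 / real ?N / (1 + t (Suc j)) \<le> 1 / real ?N / 1"
        using t(1)[of "Suc j"] by (intro divide_left_mono) auto
      ultimately show ?thesis by simp
    qed
    have "1 - real CARD('n) / real ?N \<le> r ^ CARD('n)"
    proof -
      have N1: "1 \<le> real ?N" by (simp add: doubling_steps_def)
      have "1 + real CARD('n) * (- 1 / real ?N) \<le> (1 + (- 1 / real ?N)) ^ CARD('n)"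
        using N1 by (intro Bernoulli_inequality) (simp add: field_simps)
      also have "\<dots> \<le> r ^ CARD('n)" using r N1 by (intro power_mono) (auto simp: field_simps)
      finally show ?thesis by simp
    qed
    then have "2 * K * (1 - r ^ CARD('n)) \<le> 2 * K * (real CARD('n) / real ?N)"
      using K_pos by (intro mult_left_mono) auto
    also have "\<dots> \<le> 1" using N by (simp add: field_simps)
    finally have "(l * (1 + t (Suc j))) ^ CARD('n) * (2 * K * (1 - r ^ CARD('n))) \<le> (l * (1 + t (Suc j))) ^ CARD('n) * 1"
      using lp[of "Suc j"] by (intro mult_left_mono) auto
    moreover have "(l * (1 + t j)) ^ CARD('n) = (l * (1 + t (Suc j))) ^ CARD('n) * r ^ CARD('n)"
      using pos by (simp add: r_def flip: power_mult_distrib)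
    ultimately show "2 * K * (measure lebesgue (E (Suc j)) - measure lebesgue (E j)) \<le> measure lebesgue (E (Suc j))"
      unfolding E_meas by (simp add: algebra_simps)
  qed
  have "mass (E j) \<le> 2 ^ j * mass (E 0)" for j
  proof (induction j)
    case (Suc j)
    then show ?case using step[of j] by simp
  qed simp
  from this[of ?N] have "mass (E ?N) \<le> 2 ^ ?N * mass (E 0)" .
  moreover have "E 0 = cbox a (\<chi> i. a $ i + l)" by (simp add: E_def t_def)
  moreover have "E ?N = cbox b (\<chi> i. b $ i + 2 * l)"
  proof -
    have "t ?N = 1" using N by (simp add: t_def)
    then show ?thesis by (simp add: E_def algebra_simps)
  qed
  ultimately show ?thesis by simp
qed

lemma dclosure_cubes: "dclosure Q \<in> cubes"
  unfolding cubes_def dclosure_def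
  by (intro CollectI exI conjI refl exI[of _ "2 powr real_of_int (fst Q)"]) auto

lemma u_int_dcube: "set_integrable lebesgue (dcube Q) u"
  by (rule set_integrable_subset[OF u_int[OF dclosure_cubes[of Q]]]) (auto simp: dcube_subset_dclosure)

lemma mass_dclosure: "mass (dclosure Q) = mass (dcube Q)"
  unfolding mass_def set_lebesgue_integral_def
proof (rule integral_cong_AE)
  show "(\<lambda>x. indicat_real (dclosure Q) x *\<^sub>R u x) \<in> borel_measurable lebesgue"
    using u_int[OF dclosure_cubes] by (auto simp: set_integrable_def)
  show "(\<lambda>x. indicat_real (dcube Q) x *\<^sub>R u x) \<in> borel_measurable lebesgue" by measurable
qed (use AE_dclosure_iff[of Q] in \<open>auto elim!: eventually_mono split: split_indicator\<close>)

lemma mass_dcube_pos: "0 < mass (dcube Q)"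
  unfolding mass_def by (rule set_integral_pos_AE[OF u_int_dcube u_pos])

lemma davg_pos: "0 < davg u Q"
  using mass_dcube_pos[of Q] by (simp add: davg_def mass_def)

lemma RH_dcube: "AE x\<in>dcube Q in lebesgue. u x \<le> K * davg u Q"
proof -
  have "K * (mass (dclosure Q) / measure lebesgue (dclosure Q)) = K * davg u Q"
    using mass_dclosure[of Q] by (simp add: measure_dclosure davg_def mass_def)
  with RH[OF dclosure_cubes, of Q] show ?thesis
    using dcube_subset_dclosure[of Q] by (auto simp: mass_def elim!: eventually_mono)
qed

lemma davg_sub: "dcube R \<subseteq> dcube Q \<Longrightarrow> davg u R \<le> K * davg u Q"
proof -
  assume sub: "dcube R \<subseteq> dcube Q"
  have "(LINT x:dcube R|lebesgue. u x) \<le> (LINT x:dcube R|lebesgue. K * davg u Q)"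
  proof (rule set_integral_mono_AE[OF u_int_dcube])
    show "set_integrable lebesgue (dcube R) (\<lambda>x. K * davg u Q)"
      unfolding set_integrable_def by (auto simp: integrable_indicator_iff emeasure_dcube)
    show "AE x\<in>dcube R in lebesgue. u x \<le> K * davg u Q"
      using RH_dcube[of Q] sub by (auto elim!: eventually_mono)
  qed
  also have "\<dots> = dvol TYPE('n) (fst R) * (K * davg u Q)"
    by (subst set_integral_const) (auto simp: emeasure_dcube measure_dcube)
  finally show ?thesis by (simp add: davg_def[of u R] field_simps)
qed

lemma davg_dchild: 
  assumes R: "R \<in> dchild Q"
  shows "1 / 2 ^ doubling_steps * davg u Q \<le> davg u R"
proof -
  let ?l = "2 powr real_of_int (fst R)"
  let ?a = "\<chi> a. ?l * real_of_int (snd R a)" and ?b = "\<chi> a. (2 * ?l) * real_of_int (snd Q a)"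
  have Q: "2 powr real_of_int (fst Q) = 2 * ?l"
    using dchild_fst[OF R] by (simp add: powr_diff)
  have k: "snd R a div 2 = snd Q a" for a using R by (auto simp: dchild_def)
  have bounds: "2 * snd Q a \<le> snd R a \<and> snd R a \<le> 2 * snd Q a + 1" for a using k[of a] by presburger
  have "mass (cbox ?b (\<chi> i. ?b $ i + 2 * ?l)) \<le> 2 ^ doubling_steps * mass (cbox ?a (\<chi> i. ?a $ i + ?l))"
  proof (rule mass_doubling)
    fix i
    have "real_of_int (2 * snd Q i) \<le> real_of_int (snd R i)" "real_of_int (snd R i) \<le> real_of_int (2 * snd Q i + 1)"
      using bounds[of i] by (simp_all only: of_int_le_iff)
    then have "?l * (2 * real_of_int (snd Q i)) \<le> ?l * real_of_int (snd R i)" "?l * real_of_int (snd R i) \<le> ?l * (2 * real_of_int (snd Q i) + 1)"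
      by (auto intro!: mult_left_mono)
    then show "?b $ i \<le> ?a $ i" "?a $ i + ?l \<le> ?b $ i + 2 * ?l" by (simp_all add: algebra_simps)
  qed simp
  also have "cbox ?b (\<chi> i. ?b $ i + 2 * ?l) = dclosure Q" by (simp add: dclosure_def Q)
  also have "cbox ?a (\<chi> i. ?a $ i + ?l) = dclosure R" by (simp add: dclosure_def)
  finally have m: "mass (dcube Q) \<le> 2 ^ doubling_steps * mass (dcube R)" by (simp add: mass_dclosure)
  have v: "dvol TYPE('n) (fst R) \<le> dvol TYPE('n) (fst Q)" using dchild_fst[OF R] by (intro dvol_mono) simp
  have "davg u Q \<le> 2 ^ doubling_steps * mass (dcube R) / dvol TYPE('n) (fst Q)"
    unfolding davg_def using m by (intro divide_right_mono) (auto simp: mass_def less_imp_le[OF dvol_pos])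
  also have "\<dots> \<le> 2 ^ doubling_steps * mass (dcube R) / dvol TYPE('n) (fst R)"
    using v mass_dcube_pos[of R] by (intro divide_left_mono) auto
  also have "\<dots> = 2 ^ doubling_steps * davg u R" by (simp add: davg_def mass_def)
  finally show ?thesis by (simp add: field_simps)
qed

text \<open>The loss \<open>K\<^sup>2 / c\<close> of \<open>leaf_sum_ln_lower\<close> for the
  doubling constant \<open>c = 1 / 2 ^ doubling_steps\<close>. In the end it bounds the logarithm of
  the average of \<open>u\<close> divided by its geometric mean.\<close>

definition log_defect :: real where
  "log_defect = K\<^sup>2 * 2 ^ doubling_steps"

lemma leaf_sum_ln_davg:
  "dvol TYPE('n) (fst Q) * (ln (davg u Q) - log_defect) \<le> leaf_sum dchild m (\<lambda>R. dvol TYPE('n) (fst R) * ln (davg u R)) Q"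
proof -
  \<comment> \<open>A supremum over subcubes rather than the average itself, since \<open>M\<close>
    has to decrease along the tree; the reverse Hoelder inequality keeps it within the factor
    \<open>K\<close> of the average.\<close>
  define M where "M Q = (SUP R\<in>{R. dcube R \<subseteq> dcube Q}. davg u R)" for Q
  have bdd: "bdd_above (davg u ` {R. dcube R \<subseteq> dcube Q})" for Q
    by (rule bdd_aboveI2[of _ _ "K * davg u Q"]) (auto intro: davg_sub)
  have X: "mass (dcube Q) / dvol TYPE('n) (fst Q) = davg u Q" for Q by (simp add: davg_def mass_def)
  have "dvol TYPE('n) (fst Q) * (ln (mass (dcube Q) / dvol TYPE('n) (fst Q)) - K\<^sup>2 / (1 / 2 ^ doubling_steps))
      \<le> leaf_sum dchild m (\<lambda>R. dvol TYPE('n) (fst R) * ln (mass (dcube R) / dvol TYPE('n) (fst R))) Q"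
  proof (rule leaf_sum_ln_lower[where M = M])
    show "(\<Sum>R\<in>dchild Q. dvol TYPE('n) (fst R)) = dvol TYPE('n) (fst Q)" for Q :: "int \<times> ('n \<Rightarrow> int)" by (rule dvol_eq_sum[symmetric])
    show "(\<Sum>R\<in>dchild Q. mass (dcube R)) = mass (dcube Q)" for Q
      unfolding mass_def by (rule set_integral_dcube_eq_sum[OF u_int_dcube, symmetric])
    show "1 / 2 ^ doubling_steps * (mass (dcube Q) / dvol TYPE('n) (fst Q)) \<le> mass (dcube R) / dvol TYPE('n) (fst R)" if "R \<in> dchild Q" for Q R
      unfolding X by (rule davg_dchild[OF that])
    show "mass (dcube Q) / dvol TYPE('n) (fst Q) \<le> M Q" for Q
      unfolding X M_def by (rule cSUP_upper[OF _ bdd]) simp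
    show "M Q \<le> K * (mass (dcube Q) / dvol TYPE('n) (fst Q))" for Q
      unfolding X M_def by (rule cSUP_least) (blast, auto intro: davg_sub)
    show "M R \<le> M Q" if "R \<in> dchild Q" for Q R
      unfolding M_def by (rule cSUP_subset_mono[OF _ bdd]) (blast, use dchild_subset[OF that] in auto)
  qed (auto simp: finite_dchild mass_dcube_pos)
  then show ?thesis unfolding X by (simp add: log_defect_def)
qed

end

section \<open>From averages of the weight to the weight itself\<close>

lemma leaf_sum_additive: "(\<And>Q. (\<Sum>R\<in>ch Q. f R) = f Q) \<Longrightarrow> leaf_sum ch m f Q = f Q"
  by (induction m arbitrary: Q) auto

lemma leaf_sum_add: "leaf_sum ch m (\<lambda>R. f R + g R) Q = leaf_sum ch m f Q + leaf_sum ch m g Q"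
  by (induction m arbitrary: Q) (auto simp: sum.distrib)

lemma leaf_sum_cmult: "leaf_sum ch m (\<lambda>R. c * f R) Q = c * leaf_sum ch m f Q"
  by (induction m arbitrary: Q) (auto simp: sum_distrib_left)

lemma leaf_sum_dchild_mono:
  "(\<And>R. fst R = fst Q - int m \<Longrightarrow> dcube R \<subseteq> dcube Q \<Longrightarrow> f R \<le> g R) \<Longrightarrow> leaf_sum dchild m f Q \<le> leaf_sum dchild m g Q"
proof (induction m arbitrary: Q)
  case (Suc m)
  show ?case unfolding leaf_sum.simps
  proof (intro sum_mono Suc.IH)
    fix S R assume S: "S \<in> dchild Q" and R: "fst R = fst S - int m" "dcube R \<subseteq> dcube S"
    show "f R \<le> g R"
      by (rule Suc.prems) (use S R dchild_subset[OF S] dchild_fst[OF S] in auto)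
  qed
qed simp

lemma set_integrable_dcube_const: "set_integrable lebesgue (dcube Q) (\<lambda>_. c :: real)"
  unfolding set_integrable_def by (auto simp: integrable_indicator_iff emeasure_dcube)

lemma set_integral_dcube_const: "(LINT x:dcube (Q :: int \<times> ('n::finite \<Rightarrow> int))|lebesgue. c) = dvol TYPE('n) (fst Q) * (c :: real)"
  by (subst set_integral_const) (auto simp: emeasure_dcube measure_dcube)

lemma mean_oscillation_le:
  fixes h :: "real ^ 'n \<Rightarrow> real"
  assumes h: "set_integrable lebesgue (dcube Q) h"
  shows "(LINT x:dcube Q|lebesgue. \<bar>h x - davg h Q\<bar>) \<le> 2 * (LINT x:dcube Q|lebesgue. \<bar>h x - c\<bar>)"
proof -
  have i1: "set_integrable lebesgue (dcube Q) (\<lambda>x. \<bar>h x - c\<bar>)" for c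
    by (intro set_integrable_abs set_integral_diff(1) h set_integrable_dcube_const)
  have "(LINT x:dcube Q|lebesgue. \<bar>h x - davg h Q\<bar>) \<le> (LINT x:dcube Q|lebesgue. \<bar>h x - c\<bar> + \<bar>davg h Q - c\<bar>)"
    by (intro set_integral_mono i1 set_integral_add(1) set_integrable_dcube_const) auto
  also have "\<dots> = (LINT x:dcube Q|lebesgue. \<bar>h x - c\<bar>) + dvol TYPE('n) (fst Q) * \<bar>davg h Q - c\<bar>"
    by (subst set_integral_add(2)[OF i1 set_integrable_dcube_const]) (simp add: set_integral_dcube_const)
  also have "dvol TYPE('n) (fst Q) * \<bar>davg h Q - c\<bar> = \<bar>LINT x:dcube Q|lebesgue. h x - c\<bar>"
  proof -
    have "(LINT x:dcube Q|lebesgue. h x - c) = dvol TYPE('n) (fst Q) * (davg h Q - c)"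
      by (subst set_integral_diff(2)[OF h set_integrable_dcube_const])
         (simp add: set_integral_dcube_const davg_def right_diff_distrib dvol_pos[THEN less_imp_neq, symmetric])
    then show ?thesis by (simp add: abs_mult less_imp_le[OF dvol_pos])
  qed
  also have "\<dots> \<le> (LINT x:dcube Q|lebesgue. \<bar>h x - c\<bar>)"
  proof -
    have "\<bar>LINT x|lebesgue. indicator (dcube Q) x *\<^sub>R (h x - c)\<bar> \<le> (LINT x|lebesgue. \<bar>indicator (dcube Q) x *\<^sub>R (h x - c)\<bar>)"
      by (rule integral_abs_bound)
    also have "\<dots> = (LINT x|lebesgue. indicator (dcube Q) x *\<^sub>R \<bar>h x - c\<bar>)"
      by (intro Bochner_Integration.integral_cong) (auto split: split_indicator)
    finally show ?thesis by (simp add: set_lebesgue_integral_def)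
  qed
  finally show ?thesis by simp
qed

context RH_weight
begin

text \<open>A measurable function is an almost everywhere limit of continuous ones. Truncated to
  values between 0 and \<open>S\<close>, an essential bound for \<open>u\<close> on the cube, they
  converge in the mean by dominated convergence.\<close>

lemma continuous_approximation:
  assumes e: "0 < e"
  shows "\<exists>h. continuous_on UNIV h \<and> (LINT x:dcube Q|lebesgue. \<bar>u x - h x\<bar>) \<le> e"
proof -
  define S where "S = K * davg u Q"
  have S: "S > 0" using K_pos davg_pos by (simp add: S_def)
  have "u measurable_on UNIV" by (rule lebesgue_measurable_imp_measurable_on_real) auto
  then obtain N F where N: "negligible N" and F: "\<And>n. continuous_on UNIV (F n)"
    and lim: "\<And>x. x \<notin> N \<Longrightarrow> (\<lambda>n. F n x) \<longlonglongrightarrow> u x"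
    unfolding measurable_on_def by (auto split: if_splits)
  define h where "h n x = max 0 (min S (F n x))" for n :: nat and x
  have h: "continuous_on UNIV (h n)" for n unfolding h_def by (intro continuous_intros F)
  have hm [measurable]: "h n \<in> borel_measurable lebesgue" for n
    by (rule measurable_completion) (use borel_measurable_continuous_onI[OF h[of n]] in simp)
  have "(\<lambda>n. LINT x|lebesgue. indicator (dcube Q) x *\<^sub>R \<bar>u x - h n x\<bar>) \<longlonglongrightarrow> (LINT x|(lebesgue :: (real ^ 'n) measure). (0::real))"
  proof (rule integral_dominated_convergence[where w = "\<lambda>x. indicator (dcube Q) x *\<^sub>R S"])
    show "integrable lebesgue (\<lambda>x. indicator (dcube Q) x *\<^sub>R S)"
      using set_integrable_dcube_const by (simp add: set_integrable_def)
    have AEN: "AE x in lebesgue. x \<notin> N"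
      using N by (intro AE_not_in) (simp add: negligible_iff_null_sets)
    show "AE x in lebesgue. (\<lambda>n. indicator (dcube Q) x *\<^sub>R \<bar>u x - h n x\<bar>) \<longlonglongrightarrow> 0"
      using AEN RH_dcube[of Q]
    proof eventually_elim
      fix x assume x: "x \<notin> N" "x \<in> dcube Q \<longrightarrow> u x \<le> K * davg u Q"
      show "(\<lambda>n. indicator (dcube Q) x *\<^sub>R \<bar>u x - h n x\<bar>) \<longlonglongrightarrow> 0"
      proof (cases "x \<in> dcube Q")
        case True
        have "(\<lambda>n. h n x) \<longlonglongrightarrow> max 0 (min S (u x))"
          unfolding h_def by (intro tendsto_intros lim x(1))
        also have "max 0 (min S (u x)) = u x" using x(2) True u_nonneg[of x] by (simp add: S_def)
        finally have "(\<lambda>n. \<bar>u x - h n x\<bar>) \<longlonglongrightarrow> \<bar>u x - u x\<bar>" by (intro tendsto_intros)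
        then show ?thesis using True by simp
      qed simp
    qed
    show "AE x in lebesgue. norm (indicator (dcube Q) x *\<^sub>R \<bar>u x - h n x\<bar>) \<le> indicator (dcube Q) x *\<^sub>R S" for n
      using RH_dcube[of Q]
    proof eventually_elim
      fix x assume "x \<in> dcube Q \<longrightarrow> u x \<le> K * davg u Q"
      then show "norm (indicator (dcube Q) x *\<^sub>R \<bar>u x - h n x\<bar>) \<le> indicator (dcube Q) x *\<^sub>R S"
        using u_nonneg[of x] S by (auto simp: S_def[symmetric] h_def split: split_indicator)
    qed
  qed auto
  then have "(\<lambda>n. LINT x:dcube Q|lebesgue. \<bar>u x - h n x\<bar>) \<longlonglongrightarrow> 0"
    by (simp add: set_lebesgue_integral_def)
  then have "\<forall>\<^sub>F n in sequentially. (LINT x:dcube Q|lebesgue. \<bar>u x - h n x\<bar>) < e"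
    using e by (rule order_tendstoD)
  from eventually_happens'[OF sequentially_bot this]
  obtain n where "(LINT x:dcube Q|lebesgue. \<bar>u x - h n x\<bar>) < e" by blast
  then show ?thesis using h less_imp_le by blast
qed

lemma set_integrable_ln_add:
  assumes d: "0 < d"
  shows "set_integrable lebesgue (dcube Q) (\<lambda>x. ln (u x + d))"
  unfolding set_integrable_def
proof (rule integrableI_bounded_set[where A = "dcube Q" and B = "\<bar>ln d\<bar> + \<bar>ln (K * davg u Q + d)\<bar>"])
  show "AE x\<in>dcube Q in lebesgue. norm (indicat_real (dcube Q) x *\<^sub>R ln (u x + d)) \<le> \<bar>ln d\<bar> + \<bar>ln (K * davg u Q + d)\<bar>"
    using RH_dcube[of Q]
  proof eventually_elim
    fix x assume x: "x \<in> dcube Q \<longrightarrow> u x \<le> K * davg u Q"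
    show "x \<in> dcube Q \<longrightarrow> norm (indicat_real (dcube Q) x *\<^sub>R ln (u x + d)) \<le> \<bar>ln d\<bar> + \<bar>ln (K * davg u Q + d)\<bar>"
    proof
      assume xQ: "x \<in> dcube Q"
      have "ln d \<le> ln (u x + d)" using d u_nonneg[of x] by (subst ln_le_cancel_iff) auto
      moreover have "ln (u x + d) \<le> ln (K * davg u Q + d)" using d u_nonneg[of x] x xQ by (subst ln_le_cancel_iff) auto
      ultimately show "norm (indicat_real (dcube Q) x *\<^sub>R ln (u x + d)) \<le> \<bar>ln d\<bar> + \<bar>ln (K * davg u Q + d)\<bar>"
        using xQ by simp
    qed
  qed
qed (auto simp: emeasure_dcube)

lemma ln_davg_le:
  assumes d: "0 < d"
  shows "dvol TYPE('n) (fst R) * ln (davg u R) \<le>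
    (LINT x:dcube R|lebesgue. ln (u x + d)) + 1 / d * (LINT x:dcube R|lebesgue. \<bar>u x - davg u R\<bar>)"
proof -
  have i: "set_integrable lebesgue (dcube R) (\<lambda>x. 1 / d * \<bar>u x - davg u R\<bar>)"
    by (intro set_integrable_mult_right set_integrable_abs set_integral_diff(1) u_int_dcube set_integrable_dcube_const)
  have "(LINT x:dcube R|lebesgue. ln (davg u R)) \<le> (LINT x:dcube R|lebesgue. ln (u x + d) + 1 / d * \<bar>u x - davg u R\<bar>)"
  proof (rule set_integral_mono[OF set_integrable_dcube_const set_integral_add(1)[OF set_integrable_ln_add[OF d] i]])
    fix x
    have pos: "u x + d > 0" "davg u R + d > 0" using d u_nonneg[of x] davg_pos[of R] by auto
    have "ln (davg u R) \<le> ln (davg u R + d)" using d davg_pos[of R] by (subst ln_le_cancel_iff) auto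
    also have "\<dots> = ln (u x + d) + ln ((davg u R + d) / (u x + d))" using pos by (simp add: ln_div)
    also have "ln ((davg u R + d) / (u x + d)) \<le> (davg u R + d) / (u x + d) - 1"
      using pos by (intro ln_le_minus_one) auto
    also have "(davg u R + d) / (u x + d) - 1 = (davg u R - u x) / (u x + d)" using pos by (simp add: field_simps)
    also have "\<dots> \<le> \<bar>u x - davg u R\<bar> / (u x + d)" using pos by (intro divide_right_mono) auto
    also have "\<dots> \<le> \<bar>u x - davg u R\<bar> / d" using d u_nonneg[of x] by (intro divide_left_mono) auto
    finally show "ln (davg u R) \<le> ln (u x + d) + 1 / d * \<bar>u x - davg u R\<bar>" by simp
  qed
  also have "\<dots> = (LINT x:dcube R|lebesgue. ln (u x + d)) + 1 / d * (LINT x:dcube R|lebesgue. \<bar>u x - davg u R\<bar>)"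
    by (subst set_integral_add(2)[OF set_integrable_ln_add[OF d] i]) simp
  finally show ?thesis by (simp add: set_integral_dcube_const)
qed

text \<open>
  \<open>leaf_sum_ln_davg\<close> bounds the integral of the logarithm of the conditional expectations of \<open>u\<close>.
  These converge to \<open>u\<close> in the mean, and adding \<open>d\<close> makes the logarithm Lipschitz.
\<close>

lemma integral_ln_add_lower:
  assumes d: "0 < d"
  shows "dvol TYPE('n) (fst Q) * (ln (davg u Q) - log_defect) \<le> (LINT x:dcube Q|lebesgue. ln (u x + d))"
proof (rule field_le_epsilon)
  fix e :: real assume e: "0 < e"
  let ?v = "dvol TYPE('n) (fst Q)"
  \<comment> \<open>Both errors reach the estimate with the factor \<open>2 / d\<close>: the
    distance \<open>d * e / 4\<close> to the continuous function, and \<open>\<eta>\<close> times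
    the volume from its oscillation on small cubes. Each contributes \<open>e / 2\<close>.\<close>
  define \<eta> where "\<eta> = d * e / (4 * ?v)"
  have \<eta>: "\<eta> > 0" using d e by (simp add: \<eta>_def)
  have "d * e / 4 > 0" using d e by simp
  from continuous_approximation[OF this, of Q] obtain h where h: "continuous_on UNIV h"
    and he: "(LINT x:dcube Q|lebesgue. \<bar>u x - h x\<bar>) \<le> d * e / 4" by blast
  have "uniformly_continuous_on (dclosure Q) h"
    by (intro compact_uniformly_continuous) (auto simp: dclosure_def intro: continuous_on_subset[OF h])
  then obtain r where r: "r > 0" "\<And>x y. x \<in> dclosure Q \<Longrightarrow> y \<in> dclosure Q \<Longrightarrow> dist y x < r \<Longrightarrow> dist (h y) (h x) < \<eta>"
    using \<eta> unfolding uniformly_continuous_on_def by blast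
  obtain m :: nat where m: "real CARD('n) * 2 powr real_of_int (fst Q) / r < real m" using reals_Archimedean2 by blast
  have "real CARD('n) * 2 powr real_of_int (fst Q) / r < 2 powr real m"
  proof -
    have "real m < 2 powr real m" by (simp add: powr_realpow of_nat_less_two_power)
    with m show ?thesis by linarith
  qed
  then have small: "real CARD('n) * 2 powr real_of_int (fst Q - int m) < r"
    using r(1) by (simp add: powr_diff field_simps)
  have hi: "set_integrable lebesgue (dcube R) (\<lambda>x. \<bar>u x - h x\<bar>)" for R
    by (intro set_integrable_abs set_integral_diff(1) u_int_dcube set_integrable_dcube_continuous h)
  define f1 where "f1 R = (LINT x:dcube R|lebesgue. ln (u x + d))" for R
  define f2 where "f2 R = (LINT x:dcube R|lebesgue. \<bar>u x - h x\<bar>)" for R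
  define f3 where "f3 R = dvol TYPE('n) (fst R)" for R :: "int \<times> ('n \<Rightarrow> int)"
  have "?v * (ln (davg u Q) - log_defect) \<le> leaf_sum dchild m (\<lambda>R. dvol TYPE('n) (fst R) * ln (davg u R)) Q"
    by (rule leaf_sum_ln_davg)
  also have "\<dots> \<le> leaf_sum dchild m (\<lambda>R. f1 R + (2 / d * f2 R + 2 / d * \<eta> * f3 R)) Q"
  proof (rule leaf_sum_dchild_mono)
    fix R assume R: "fst R = fst Q - int m" "dcube R \<subseteq> dcube Q"
    define z where "z = (\<chi> a. 2 powr real_of_int (fst R) * real_of_int (snd R a))"
    have z: "z \<in> dcube R" unfolding dcube_mem_iff z_def by simp
    have osc: "\<bar>h x - h z\<bar> \<le> \<eta>" if "x \<in> dcube R" for x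
    proof -
      have "norm (x - z) \<le> real CARD('n) * 2 powr real_of_int (fst R)"
        by (rule dclosure_diameter) (use that z dcube_subset_dclosure in blast)+
      then have "dist x z < r" using small by (simp add: dist_norm R)
      moreover have "x \<in> dclosure Q" "z \<in> dclosure Q" using that z R(2) dcube_subset_dclosure by blast+
      ultimately have "dist (h x) (h z) < \<eta>" using r(2) by blast
      then show ?thesis by (simp add: dist_real_def)
    qed
    have "(LINT x:dcube R|lebesgue. \<bar>u x - davg u R\<bar>) \<le> 2 * (LINT x:dcube R|lebesgue. \<bar>u x - h z\<bar>)"
      by (rule mean_oscillation_le[OF u_int_dcube])
    also have "(LINT x:dcube R|lebesgue. \<bar>u x - h z\<bar>) \<le> (LINT x:dcube R|lebesgue. \<bar>u x - h x\<bar> + \<eta>)"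
    proof (rule set_integral_mono)
      show "set_integrable lebesgue (dcube R) (\<lambda>x. \<bar>u x - h z\<bar>)"
        by (intro set_integrable_abs set_integral_diff(1) u_int_dcube set_integrable_dcube_const)
      show "set_integrable lebesgue (dcube R) (\<lambda>x. \<bar>u x - h x\<bar> + \<eta>)"
        by (intro set_integral_add(1) hi set_integrable_dcube_const)
      show "\<bar>u x - h z\<bar> \<le> \<bar>u x - h x\<bar> + \<eta>" if "x \<in> dcube R" for x using osc[OF that] by linarith
    qed
    also have "\<dots> = f2 R + \<eta> * f3 R"
      by (subst set_integral_add(2)[OF hi set_integrable_dcube_const]) (simp add: set_integral_dcube_const f2_def f3_def)
    finally have "1 / d * (LINT x:dcube R|lebesgue. \<bar>u x - davg u R\<bar>) \<le> 1 / d * (2 * (f2 R + \<eta> * f3 R))"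
      using d by (intro mult_left_mono) auto
    also have "\<dots> = 2 / d * f2 R + 2 / d * \<eta> * f3 R" by (simp add: algebra_simps)
    finally show "dvol TYPE('n) (fst R) * ln (davg u R) \<le> f1 R + (2 / d * f2 R + 2 / d * \<eta> * f3 R)"
      using ln_davg_le[OF d, of R] unfolding f1_def by linarith
  qed
  also have "\<dots> = f1 Q + (2 / d * f2 Q + 2 / d * \<eta> * f3 Q)"
  proof -
    have "leaf_sum dchild m f1 Q = f1 Q" unfolding f1_def
      by (rule leaf_sum_additive) (rule set_integral_dcube_eq_sum[OF set_integrable_ln_add[OF d], symmetric])
    moreover have "leaf_sum dchild m f2 Q = f2 Q" unfolding f2_def
      by (rule leaf_sum_additive) (rule set_integral_dcube_eq_sum[OF hi, symmetric])
    moreover have "leaf_sum dchild m f3 Q = f3 Q" unfolding f3_def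
      by (rule leaf_sum_additive) (rule dvol_eq_sum[symmetric])
    ultimately show ?thesis by (simp only: leaf_sum_add leaf_sum_cmult)
  qed
  also have "\<dots> \<le> f1 Q + e"
  proof -
    have "2 / d * f2 Q \<le> 2 / d * (d * e / 4)" using he d unfolding f2_def by (intro mult_left_mono) auto
    also have "\<dots> = e / 2" using d by simp
    finally have "2 / d * f2 Q \<le> e / 2" .
    moreover have "2 / d * \<eta> * f3 Q = e / 2"
      using d by (simp add: \<eta>_def f3_def dvol_pos[THEN less_imp_neq, symmetric])
    ultimately show ?thesis by linarith
  qed
  finally show "?v * (ln (davg u Q) - log_defect) \<le> (LINT x:dcube Q|lebesgue. ln (u x + d)) + e"
    by (simp add: f1_def)
qed

text \<open>The limit of \<open>d\<close> to zero by Fatou's lemma. On the cube,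
  \<open>ln (S + 1) - ln (u x + d)\<close> is nonnegative because \<open>u \<le> S\<close> and
  \<open>d \<le> 1\<close>; the uniform bound on its integrals also yields the integrability of
  \<open>ln u\<close>.\<close>

lemma integral_ln_lower:
  "set_integrable lebesgue (dcube Q) (\<lambda>x. ln (u x))" (is ?int)
  "dvol TYPE('n) (fst Q) * (ln (davg u Q) - log_defect) \<le> (LINT x:dcube Q|lebesgue. ln (u x))" (is ?lower)
proof -
  let ?v = "dvol TYPE('n) (fst Q)"
  define S where "S = K * davg u Q"
  have S: "S > 0" using K_pos davg_pos by (simp add: S_def)
  define d where "d k = 1 / (real k + 1)" for k :: nat
  have d: "0 < d k" "d k \<le> 1" for k by (auto simp: d_def)
  define \<phi> where "\<phi> x = ln (S + 1) - ln (u x)" for x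
  define B where "B = ?v * (ln (S + 1) - (ln (davg u Q) - log_defect))"
  have psi_i: "set_integrable lebesgue (dcube Q) (\<lambda>x. ln (S + 1) - ln (u x + d k))" for k
    by (intro set_integral_diff(1) set_integrable_dcube_const set_integrable_ln_add d)
  have psi: "(\<integral>\<^sup>+x\<in>dcube Q. ennreal (ln (S + 1) - ln (u x + d k)) \<partial>lebesgue) \<le> ennreal B" for k
  proof -
    have "(\<integral>\<^sup>+x\<in>dcube Q. ennreal (ln (S + 1) - ln (u x + d k)) \<partial>lebesgue) = ennreal (LINT x:dcube Q|lebesgue. ln (S + 1) - ln (u x + d k))"
    proof (rule nn_set_integral_eq_set_integral'[OF psi_i])
      show "AE x\<in>dcube Q in lebesgue. 0 \<le> ln (S + 1) - ln (u x + d k)"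
        using RH_dcube[of Q]
      proof eventually_elim
        fix x assume x: "x \<in> dcube Q \<longrightarrow> u x \<le> K * davg u Q"
        show "x \<in> dcube Q \<longrightarrow> 0 \<le> ln (S + 1) - ln (u x + d k)"
        proof
          assume "x \<in> dcube Q"
          then have "ln (u x + d k) \<le> ln (S + 1)"
            using x u_nonneg[of x] d[of k] S by (subst ln_le_cancel_iff) (auto simp: S_def)
          then show "0 \<le> ln (S + 1) - ln (u x + d k)" by simp
        qed
      qed
    qed
    also have "(LINT x:dcube Q|lebesgue. ln (S + 1) - ln (u x + d k)) = ?v * ln (S + 1) - (LINT x:dcube Q|lebesgue. ln (u x + d k))"
      by (subst set_integral_diff(2)[OF set_integrable_dcube_const set_integrable_ln_add[OF d(1)]]) (simp add: set_integral_dcube_const)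
    also have "\<dots> \<le> B" using integral_ln_add_lower[OF d(1), of Q k] by (simp add: B_def right_diff_distrib)
    finally show ?thesis by (simp add: ennreal_leI)
  qed
  have "d \<longlonglongrightarrow> 0" unfolding d_def using LIMSEQ_inverse_real_of_nat by (simp add: inverse_eq_divide add.commute)
  have "(\<integral>\<^sup>+x\<in>dcube Q. ennreal (\<phi> x) \<partial>lebesgue) = (\<integral>\<^sup>+x. liminf (\<lambda>k. ennreal (ln (S + 1) - ln (u x + d k)) * indicator (dcube Q) x) \<partial>lebesgue)"
  proof (rule nn_integral_cong_AE)
    show "AE x in lebesgue. ennreal (\<phi> x) * indicator (dcube Q) x = liminf (\<lambda>k. ennreal (ln (S + 1) - ln (u x + d k)) * indicator (dcube Q) x)"
      using u_pos
    proof eventually_elim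
      fix x assume x: "0 < u x"
      have "(\<lambda>k. ennreal (ln (S + 1) - ln (u x + d k))) \<longlonglongrightarrow> ennreal (ln (S + 1) - ln (u x + 0))"
        by (intro tendsto_intros \<open>d \<longlonglongrightarrow> 0\<close>) (use x in auto)
      then have "liminf (\<lambda>k. ennreal (ln (S + 1) - ln (u x + d k))) = ennreal (\<phi> x)"
        by (simp add: \<phi>_def lim_imp_Liminf)
      then show "ennreal (\<phi> x) * indicator (dcube Q) x = liminf (\<lambda>k. ennreal (ln (S + 1) - ln (u x + d k)) * indicator (dcube Q) x)"
        by (cases "x \<in> dcube Q") (auto simp: lim_imp_Liminf)
    qed
  qed
  also have "\<dots> \<le> liminf (\<lambda>k. \<integral>\<^sup>+x\<in>dcube Q. ennreal (ln (S + 1) - ln (u x + d k)) \<partial>lebesgue)"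
    by (rule nn_integral_liminf) measurable
  also have "\<dots> \<le> liminf (\<lambda>k::nat. ennreal B)" by (rule Liminf_mono) (simp add: psi)
  also have "\<dots> = ennreal B" by (simp add: Liminf_const)
  finally have phi_le: "(\<integral>\<^sup>+x\<in>dcube Q. ennreal (\<phi> x) \<partial>lebesgue) \<le> ennreal B" .
  have phi_nn: "AE x\<in>dcube Q in lebesgue. 0 \<le> \<phi> x"
    using RH_dcube[of Q] u_pos
  proof eventually_elim
    fix x assume x: "x \<in> dcube Q \<longrightarrow> u x \<le> K * davg u Q" "0 < u x"
    show "x \<in> dcube Q \<longrightarrow> 0 \<le> \<phi> x"
    proof
      assume "x \<in> dcube Q"
      then have "ln (u x) \<le> ln (S + 1)" using x S by (subst ln_le_cancel_iff) (auto simp: S_def)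
      then show "0 \<le> \<phi> x" by (simp add: \<phi>_def)
    qed
  qed
  have phi_m [measurable]: "\<phi> \<in> borel_measurable lebesgue" unfolding \<phi>_def by measurable
  have phi_i: "set_integrable lebesgue (dcube Q) \<phi>"
    unfolding set_integrable_def
  proof (rule integrableI_nonneg)
    show "AE x in lebesgue. 0 \<le> indicat_real (dcube Q) x *\<^sub>R \<phi> x"
      using phi_nn by eventually_elim (auto split: split_indicator)
    have "(\<integral>\<^sup>+x. ennreal (indicat_real (dcube Q) x *\<^sub>R \<phi> x) \<partial>lebesgue) = (\<integral>\<^sup>+x\<in>dcube Q. ennreal (\<phi> x) \<partial>lebesgue)"
      by (intro nn_integral_cong) (auto split: split_indicator)
    then show "(\<integral>\<^sup>+x. ennreal (indicat_real (dcube Q) x *\<^sub>R \<phi> x) \<partial>lebesgue) < \<infinity>"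
      using phi_le by (simp add: le_less_trans)
  qed measurable
  have B: "0 \<le> B"
  proof -
    have "ln (davg u Q) \<le> ln (S + 1) + log_defect"
    proof -
      have "0 < davg u Q" by (rule davg_pos)
      moreover have "davg u Q \<le> S" unfolding S_def by (rule davg_sub) simp
      ultimately have "ln (davg u Q) \<le> ln (S + 1)" by (subst ln_le_cancel_iff) auto
      moreover have "0 \<le> log_defect" by (simp add: log_defect_def)
      ultimately show ?thesis by linarith
    qed
    then show ?thesis unfolding B_def by (intro mult_nonneg_nonneg less_imp_le[OF dvol_pos]) simp
  qed
  have "(LINT x:dcube Q|lebesgue. \<phi> x) \<le> B"
    using phi_le B unfolding nn_set_integral_eq_set_integral'[OF phi_i phi_nn] by (subst (asm) ennreal_le_iff) auto
  moreover have eq: "ln (u x) = ln (S + 1) - \<phi> x" for x by (simp add: \<phi>_def)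
  moreover show ?int unfolding eq by (intro set_integral_diff(1) set_integrable_dcube_const phi_i)
  moreover have "(LINT x:dcube Q|lebesgue. ln (u x)) = ?v * ln (S + 1) - (LINT x:dcube Q|lebesgue. \<phi> x)"
    unfolding eq by (subst set_integral_diff(2)[OF set_integrable_dcube_const phi_i]) (simp add: set_integral_dcube_const)
  ultimately show ?lower by (simp add: B_def right_diff_distrib)
qed

end

section \<open>Carleson sums for Muckenhoupt weights\<close>

text \<open>The form of Hoelder's inequality that supplies the hypothesis \<open>IV\<close> of
  \<open>carleson_embedding\<close>. The tangent is taken at the quotient \<open>t\<close> of the
  integrals, so that its linear part integrates to zero.\<close>

lemma holder_set_integral:
  fixes G H w :: "'a \<Rightarrow> real"
  assumes r: "1 < r" and A: "A \<in> sets M"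
    and w: "set_integrable M A w" and G: "set_integrable M A G" and H: "set_integrable M A H"
    and pt: "AE x\<in>A in M. 0 < w x \<and> 0 \<le> G x \<and> G x powr r / w x powr (r - 1) \<le> H x"
    and wpos: "0 < (LINT x:A|M. w x)"
  shows "(LINT x:A|M. G x) powr r / (LINT x:A|M. w x) powr (r - 1) \<le> (LINT x:A|M. H x)"
proof -
  define I where "I = (LINT x:A|M. G x)"
  define N where "N = (LINT x:A|M. w x)"
  have N: "N > 0" using wpos by (simp add: N_def)
  have I: "I \<ge> 0" unfolding I_def set_lebesgue_integral_def
    by (rule integral_nonneg_AE) (use pt in \<open>auto elim!: eventually_mono split: split_indicator\<close>)
  define t where "t = I / N"
  have t: "t \<ge> 0" using I N by (simp add: t_def)
  define a b where "a = t powr r" and "b = r * t powr (r - 1)"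
  have i2: "set_integrable M A (\<lambda>x. t * w x)" by (intro set_integrable_mult_right w)
  have i3: "set_integrable M A (\<lambda>x. b * (G x - t * w x))"
    by (intro set_integrable_mult_right set_integral_diff(1) G i2)
  have i1: "set_integrable M A (\<lambda>x. a * w x)" by (intro set_integrable_mult_right w)
  have "(LINT x:A|M. a * w x + b * (G x - t * w x)) \<le> (LINT x:A|M. H x)"
  proof (rule set_integral_mono_AE[OF set_integral_add(1)[OF i1 i3] H])
    show "AE x\<in>A in M. a * w x + b * (G x - t * w x) \<le> H x"
      using pt
    proof eventually_elim
      fix x assume x: "x \<in> A \<longrightarrow> 0 < w x \<and> 0 \<le> G x \<and> G x powr r / w x powr (r - 1) \<le> H x"
      show "x \<in> A \<longrightarrow> a * w x + b * (G x - t * w x) \<le> H x"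
      proof
        assume "x \<in> A"
        with x have x: "0 < w x" "0 \<le> G x" "G x powr r / w x powr (r - 1) \<le> H x" by auto
        have "w x * (t powr r + r * t powr (r - 1) * (G x / w x - t)) \<le> w x * (G x / w x) powr r"
          using powr_tangent[OF r, of "G x / w x" t] x t by (intro mult_left_mono) auto
        also have "w x * (G x / w x) powr r = G x powr r / w x powr (r - 1)"
          using x by (simp add: powr_divide powr_diff)
        also have "w x * (t powr r + r * t powr (r - 1) * (G x / w x - t)) = a * w x + b * (G x - t * w x)"
          using x by (simp add: a_def b_def field_simps)
        finally show "a * w x + b * (G x - t * w x) \<le> H x" using x by simp
      qed
    qed
  qed
  also have "(LINT x:A|M. a * w x + b * (G x - t * w x)) = a * N + b * (I - t * N)"
    by (subst set_integral_add(2)[OF i1 i3])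
       (simp add: I_def N_def set_integral_diff(2)[OF G i2])
  also have "I - t * N = 0" using N by (simp add: t_def)
  also have "a * N + b * 0 = I powr r / N powr (r - 1)"
    using I N by (simp add: a_def t_def powr_divide powr_diff)
  finally show ?thesis by (simp add: I_def N_def)
qed

section \<open>The dual weight, the A_p condition and packing with respect to the dual
  weight\<close>

lemma davg_nonneg: "(\<And>x. 0 \<le> h x) \<Longrightarrow> 0 \<le> davg h Q"
  unfolding davg_def by (intro divide_nonneg_nonneg set_lebesgue_integral_nonneg less_imp_le[OF dvol_pos]) auto

text \<open>The power of \<open>u\<close> is the dual weight, as
  \<open>p' / p = 1 / (p - 1)\<close>. Its logarithm is \<open>- 1 / (p - 1) * ln u\<close>, so the
  last assumption is its \<open>A_inf\<close> condition expressed through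
  \<open>ln u\<close>.\<close>

locale A_p_weight = RH_weight u K for u :: "real ^ 'n \<Rightarrow> real" and K +
  fixes p K\<^sub>A :: real
  assumes p: "1 < p" and K\<^sub>A: "0 < K\<^sub>A"
    and \<sigma>_int: "\<And>Q. set_integrable lebesgue (dcube Q) (\<lambda>x. u x powr (- 1 / (p - 1)))"
    and A_inf: "\<And>Q. davg (\<lambda>x. u x powr (- 1 / (p - 1))) Q * exp (1 / (p - 1) * davg (\<lambda>x. ln (u x)) Q) \<le> K\<^sub>A"
begin

definition \<sigma> :: "real ^ 'n \<Rightarrow> real" where
  "\<sigma> x = u x powr (- 1 / (p - 1))"

lemma \<sigma>_measurable [measurable]: "\<sigma> \<in> borel_measurable lebesgue"
  unfolding \<sigma>_def by measurable

lemma \<sigma>_nonneg: "0 \<le> \<sigma> x"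
  by (simp add: \<sigma>_def)

lemma \<sigma>_AE_pos: "AE x in lebesgue. 0 < \<sigma> x"
  using u_pos by eventually_elim (simp add: \<sigma>_def)

lemma \<sigma>_integrable: "set_integrable lebesgue (dcube Q) \<sigma>"
  unfolding \<sigma>_def[abs_def] by (rule \<sigma>_int)

definition A_p_bound :: real where
  "A_p_bound = (K\<^sub>A * exp (1 / (p - 1) * log_defect)) powr (p - 1)"

lemma A_p_bound_pos: "0 < A_p_bound"
  using K\<^sub>A by (simp add: A_p_bound_def)

text \<open>The \<open>A_inf\<close> condition bounds the average of \<open>\<sigma>\<close> by its
  geometric mean, a negative power of that of \<open>u\<close>, and \<open>integral_ln_lower\<close>
  bounds the average of \<open>u\<close> by the geometric mean of \<open>u\<close>. In the product
  the geometric means cancel.\<close>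

lemma A_p: "davg u Q * davg \<sigma> Q powr (p - 1) \<le> A_p_bound"
proof -
  let ?e = "1 / (p - 1)"
  have e: "?e > 0" using p by simp
  have \<sigma>0: "0 \<le> davg \<sigma> Q" by (rule davg_nonneg[OF \<sigma>_nonneg])
  have ln: "ln (davg u Q) - log_defect \<le> davg (\<lambda>x. ln (u x)) Q"
    unfolding davg_def[of "\<lambda>x. ln (u x)"]
    using integral_ln_lower(2)[of Q] by (subst pos_le_divide_eq[OF dvol_pos]) (simp only: mult.commute)
  have "davg \<sigma> Q * davg u Q powr ?e = davg \<sigma> Q * exp (?e * (ln (davg u Q) - log_defect)) * exp (?e * log_defect)"
    using davg_pos[of Q] by (simp add: powr_def right_diff_distrib exp_diff)
  also have "\<dots> \<le> davg \<sigma> Q * exp (?e * davg (\<lambda>x. ln (u x)) Q) * exp (?e * log_defect)"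
    using ln e \<sigma>0 by (intro mult_right_mono mult_left_mono) (auto intro!: mult_left_mono divide_right_mono)
  also have "\<dots> \<le> K\<^sub>A * exp (?e * log_defect)"
    using A_inf[of Q] by (intro mult_right_mono) (auto simp: \<sigma>_def[abs_def])
  finally have "(davg \<sigma> Q * davg u Q powr ?e) powr (p - 1) \<le> A_p_bound"
    unfolding A_p_bound_def using p \<sigma>0 by (intro powr_mono2) auto
  moreover have "(davg \<sigma> Q * davg u Q powr ?e) powr (p - 1) = davg u Q * davg \<sigma> Q powr (p - 1)"
    using davg_pos[of Q] \<sigma>0 p by (simp add: powr_mult powr_powr)
  ultimately show ?thesis by simp
qed

lemma \<sigma>_half_integrable: "set_integrable lebesgue (dcube Q) (\<lambda>x. \<sigma> x powr (1 / 2))"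
proof (rule set_integrable_bound)
  show "set_integrable lebesgue (dcube Q) (\<lambda>x. \<sigma> x + 1)"
    by (intro set_integral_add(1) \<sigma>_integrable set_integrable_dcube_const)
  show "set_borel_measurable lebesgue (dcube Q) (\<lambda>x. \<sigma> x powr (1 / 2))"
    unfolding set_borel_measurable_def by measurable
  have "\<sigma> x powr (1 / 2) \<le> \<sigma> x + 1" for x
  proof (cases "\<sigma> x \<le> 1")
    case True
    have "\<sigma> x powr (1 / 2) \<le> 1 powr (1 / 2)" using True \<sigma>_nonneg[of x] by (intro powr_mono2) auto
    then show ?thesis using \<sigma>_nonneg[of x] by simp
  next
    case False
    have "\<sigma> x powr (1 / 2) \<le> \<sigma> x powr 1" using False by (intro powr_mono) auto
    then show ?thesis using False by simp
  qed
  then show "AE x in lebesgue. x \<in> dcube Q \<longrightarrow> norm (\<sigma> x powr (1 / 2)) \<le> norm (\<sigma> x + 1)"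
    using \<sigma>_nonneg by (auto intro!: AE_I2 order_trans[OF _ abs_ge_self])
qed

text \<open>A reverse Jensen inequality. By \<open>A_inf\<close> the average of
  \<open>\<sigma>\<close> is at most \<open>K\<^sub>A\<close> times its geometric mean, which is the
  square of the geometric mean of the square root; the latter is at most the average
  \<open>t\<close> of the square root. This last step is Jensen's inequality for \<open>ln\<close>,
  proved with the tangent at \<open>t\<close>.\<close>

lemma davg_\<sigma>_le: "davg \<sigma> Q \<le> K\<^sub>A * (davg (\<lambda>x. \<sigma> x powr (1 / 2)) Q)\<^sup>2"
proof -
  let ?h = "\<lambda>x. \<sigma> x powr (1 / 2)" and ?e = "1 / (p - 1)" and ?v = "dvol TYPE('n) (fst Q)"
  define t where "t = davg ?h Q"
  have "0 < (LINT x:dcube Q|lebesgue. ?h x)"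
    by (rule set_integral_pos_AE[OF \<sigma>_half_integrable]) (use \<sigma>_AE_pos in \<open>auto elim!: eventually_mono\<close>)
  then have t: "t > 0" by (simp add: t_def davg_def)
  have i1: "set_integrable lebesgue (dcube Q) (\<lambda>x. - (?e / 2) * ln (u x))"
    by (intro set_integrable_mult_right integral_ln_lower(1))
  have i2: "set_integrable lebesgue (dcube Q) (\<lambda>x. 1 / t * ?h x)"
    by (intro set_integrable_mult_right \<sigma>_half_integrable)
  have "(LINT x:dcube Q|lebesgue. - (?e / 2) * ln (u x)) \<le> (LINT x:dcube Q|lebesgue. (ln t - 1) + 1 / t * ?h x)"
  proof (rule set_integral_mono_AE[OF i1 set_integral_add(1)[OF set_integrable_dcube_const i2]])
    show "AE x\<in>dcube Q in lebesgue. - (?e / 2) * ln (u x) \<le> (ln t - 1) + 1 / t * ?h x"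
      using u_pos
    proof eventually_elim
      fix x assume x: "0 < u x"
      have h: "?h x = u x powr (- (?e / 2))" by (simp add: \<sigma>_def powr_powr)
      have "- (?e / 2) * ln (u x) = ln (?h x)" using x by (simp add: h ln_powr)
      also have "\<dots> = ln t + ln (?h x / t)" using t x by (simp add: ln_div h)
      also have "ln (?h x / t) \<le> ?h x / t - 1" using t x by (intro ln_le_minus_one) (simp add: h)
      finally show "x \<in> dcube Q \<longrightarrow> - (?e / 2) * ln (u x) \<le> (ln t - 1) + 1 / t * ?h x" by simp
    qed
  qed
  also have "\<dots> = ?v * (ln t - 1) + 1 / t * (?v * t)"
    by (subst set_integral_add(2)[OF set_integrable_dcube_const i2])
       (simp add: set_integral_dcube_const t_def davg_def dvol_pos[THEN less_imp_neq, symmetric])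
  also have "\<dots> = ?v * ln t" using t by (simp add: algebra_simps)
  finally have "- (?e / 2) * (LINT x:dcube Q|lebesgue. ln (u x)) \<le> ln t * ?v"
    by (simp only: set_integral_mult_right mult.commute[of ?v])
  then have "- (?e / 2) * davg (\<lambda>x. ln (u x)) Q \<le> ln t"
    unfolding davg_def times_divide_eq_right by (subst pos_divide_le_eq[OF dvol_pos])
  then have "exp (2 * (- (?e / 2) * davg (\<lambda>x. ln (u x)) Q)) \<le> exp (2 * ln t)"
    by (subst exp_le_cancel_iff) linarith
  also have "exp (2 * ln t) = t\<^sup>2" using t by (simp add: exp_double)
  finally have "exp (2 * (- (?e / 2) * davg (\<lambda>x. ln (u x)) Q)) \<le> t\<^sup>2" .
  moreover have "2 * (- (e / 2) * X) = - (e * X)" for e X :: real by simp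
  ultimately have le: "exp (- (?e * davg (\<lambda>x. ln (u x)) Q)) \<le> t\<^sup>2" by (simp only:)
  have "davg \<sigma> Q \<le> K\<^sub>A * exp (- (?e * davg (\<lambda>x. ln (u x)) Q))"
    using A_inf[of Q] by (simp add: \<sigma>_def[abs_def] exp_minus field_simps)
  also have "\<dots> \<le> K\<^sub>A * t\<^sup>2" using le K\<^sub>A by (intro mult_left_mono) auto
  finally show ?thesis by (simp add: t_def)
qed

text \<open>The packing condition passes from Lebesgue measure to \<open>\<sigma> dx\<close>. The
  embedding theorem is applied with exponent 2 to the square root of \<open>\<sigma>\<close>, as
  \<open>davg_\<sigma>_le\<close> replaces the average of \<open>\<sigma>\<close> by the square of
  an average; 4 is its constant \<open>2 powr 2 / (2 - 1)\<close>.\<close>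

lemma carleson_\<sigma>:
  assumes \<mu>: "\<And>Q. 0 \<le> \<mu> Q" and a: "0 < a"
    and car: "\<And>m Q. tree_sum dchild m \<mu> Q \<le> a * dvol TYPE('n) (fst Q)"
  shows "tree_sum dchild m (\<lambda>Q. \<mu> Q * davg \<sigma> Q) Q \<le> 4 * K\<^sub>A * a * (LINT x:dcube Q|lebesgue. \<sigma> x)"
proof -
  let ?I = "\<lambda>Q. LINT x:dcube Q|lebesgue. \<sigma> x powr (1 / 2)"
  have V: "?I Q powr 2 / dvol TYPE('n) (fst Q) powr (2 - 1) \<le> (LINT x:dcube Q|lebesgue. \<sigma> x)" for Q
  proof -
    have "?I Q powr 2 / (LINT x:dcube Q|lebesgue. 1) powr (2 - 1) \<le> (LINT x:dcube Q|lebesgue. \<sigma> x)"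
      by (rule holder_set_integral[OF _ sets_dcube set_integrable_dcube_const \<sigma>_half_integrable \<sigma>_integrable])
         (use \<sigma>_nonneg in \<open>auto simp: set_integral_dcube_const powr_powr\<close>)
    then show ?thesis by (simp add: set_integral_dcube_const)
  qed
  have "tree_sum dchild m (\<lambda>R. \<mu> R * (?I R / dvol TYPE('n) (fst R)) powr 2) Q \<le> 2 powr 2 / (2 - 1) * a * (LINT x:dcube Q|lebesgue. \<sigma> x)"
  proof (rule carleson_embedding[OF _ a finite_dchild dchild_nonempty dvol_pos _ _ _ _ V \<mu> car])
    show "(\<Sum>R\<in>dchild Q. dvol TYPE('n) (fst R)) = dvol TYPE('n) (fst Q)" for Q :: "int \<times> ('n \<Rightarrow> int)" by (rule dvol_eq_sum[symmetric])
    show "0 \<le> ?I Q" for Q by (intro set_lebesgue_integral_nonneg) auto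
    show "(\<Sum>R\<in>dchild Q. ?I R) = ?I Q" for Q by (rule set_integral_dcube_eq_sum[OF \<sigma>_half_integrable, symmetric])
    show "(\<Sum>R\<in>dchild Q. LINT x:dcube R|lebesgue. \<sigma> x) = (LINT x:dcube Q|lebesgue. \<sigma> x)" for Q
      by (rule set_integral_dcube_eq_sum[OF \<sigma>_integrable, symmetric])
  qed simp
  then have 1: "K\<^sub>A * tree_sum dchild m (\<lambda>R. \<mu> R * (?I R / dvol TYPE('n) (fst R)) powr 2) Q \<le> K\<^sub>A * (4 * a * (LINT x:dcube Q|lebesgue. \<sigma> x))"
    using K\<^sub>A by (intro mult_left_mono) auto
  have "tree_sum dchild m (\<lambda>Q. \<mu> Q * davg \<sigma> Q) Q \<le> tree_sum dchild m (\<lambda>R. K\<^sub>A * (\<mu> R * (?I R / dvol TYPE('n) (fst R)) powr 2)) Q"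
  proof (rule tree_sum_mono)
    fix R
    have "0 \<le> ?I R / dvol TYPE('n) (fst R)"
      by (intro divide_nonneg_nonneg set_lebesgue_integral_nonneg less_imp_le[OF dvol_pos]) auto
    then have "davg \<sigma> R \<le> K\<^sub>A * (?I R / dvol TYPE('n) (fst R)) powr 2"
      using davg_\<sigma>_le[of R] by (simp add: davg_def[of "\<lambda>x. \<sigma> x powr (1 / 2)"])
    then have "\<mu> R * davg \<sigma> R \<le> \<mu> R * (K\<^sub>A * (?I R / dvol TYPE('n) (fst R)) powr 2)"
      using \<mu> by (intro mult_left_mono)
    then show "\<mu> R * davg \<sigma> R \<le> K\<^sub>A * (\<mu> R * (?I R / dvol TYPE('n) (fst R)) powr 2)" by (simp only: mult.left_commute)
  qed
  also have "\<dots> = K\<^sub>A * tree_sum dchild m (\<lambda>R. \<mu> R * (?I R / dvol TYPE('n) (fst R)) powr 2) Q"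
    by (rule tree_sum_cmult)
  finally show ?thesis using 1 by simp
qed

section \<open>Carleson sums of the gradient\<close>

context
  fixes F :: "real ^ 'n \<Rightarrow> real"
  assumes F_nonneg: "\<And>x. 0 \<le> F x" and F_cont: "continuous_on UNIV F"
    and F_int: "integrable lebesgue (\<lambda>x. F x powr p * u x)"
begin

lemma F_integrable: "set_integrable lebesgue (dcube Q) F"
  by (rule set_integrable_dcube_continuous[OF F_cont])

lemma Fpu_integrable: "set_integrable lebesgue (dcube Q) (\<lambda>x. F x powr p * u x)"
  unfolding set_integrable_def by (intro integrable_mult_indicator F_int) auto

lemma \<sigma>_mass_pos: "0 < (LINT x:dcube Q|lebesgue. \<sigma> x)"
  by (rule set_integral_pos_AE[OF \<sigma>_integrable \<sigma>_AE_pos])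

lemma holder_F:
  "(LINT x:dcube Q|lebesgue. F x) powr p / (LINT x:dcube Q|lebesgue. \<sigma> x) powr (p - 1) \<le> (LINT x:dcube Q|lebesgue. F x powr p * u x)"
proof (rule holder_set_integral[OF p sets_dcube \<sigma>_integrable F_integrable Fpu_integrable _ \<sigma>_mass_pos])
  show "AE x\<in>dcube Q in lebesgue. 0 < \<sigma> x \<and> 0 \<le> F x \<and> F x powr p / \<sigma> x powr (p - 1) \<le> F x powr p * u x"
    using u_pos \<sigma>_AE_pos
  proof eventually_elim
    fix x assume x: "0 < u x" "0 < \<sigma> x"
    have "\<sigma> x powr (p - 1) = u x powr (-1)" using p by (simp add: \<sigma>_def powr_powr)
    then have "F x powr p / \<sigma> x powr (p - 1) = F x powr p * u x" using x by (simp add: powr_minus divide_inverse)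
    then show "x \<in> dcube Q \<longrightarrow> 0 < \<sigma> x \<and> 0 \<le> F x \<and> F x powr p / \<sigma> x powr (p - 1) \<le> F x powr p * u x"
      using x F_nonneg by simp
  qed
qed

text \<open>The quotient of the two integrals is the average of \<open>F / \<sigma>\<close> with
  respect to \<open>\<sigma> dx\<close>, and \<open>davg F Q\<close> is this quotient times
  \<open>davg \<sigma> Q\<close>. Of the power \<open>p\<close> of \<open>davg \<sigma> Q\<close>,
  the part \<open>p - 1\<close> is absorbed by the A_p condition; the remaining factor goes into the
  packing weights of \<open>carleson_F\<close>.\<close>

lemma davg_power_le:
  "davg u Q * davg F Q powr p \<le> A_p_bound * (davg \<sigma> Q * ((LINT x:dcube Q|lebesgue. F x) / (LINT x:dcube Q|lebesgue. \<sigma> x)) powr p)"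
proof -
  let ?I = "LINT x:dcube Q|lebesgue. F x" and ?N = "LINT x:dcube Q|lebesgue. \<sigma> x"
  have I: "0 \<le> ?I" by (rule set_lebesgue_integral_nonneg[OF F_nonneg])
  note N = \<sigma>_mass_pos[of Q]
  have \<sigma>: "davg \<sigma> Q > 0" using N by (simp add: davg_def)
  have "davg F Q = ?I / ?N * davg \<sigma> Q" using N by (simp add: davg_def)
  then have "davg F Q powr p = (?I / ?N) powr p * davg \<sigma> Q powr p"
    using I N \<sigma> by (simp only: powr_mult)
  also have "davg \<sigma> Q powr p = davg \<sigma> Q powr (p - 1) * davg \<sigma> Q"
    using \<sigma> by (simp add: powr_diff)
  finally have "davg u Q * davg F Q powr p = (davg u Q * davg \<sigma> Q powr (p - 1)) * (davg \<sigma> Q * (?I / ?N) powr p)"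
    by (simp add: mult_ac)
  also have "\<dots> \<le> A_p_bound * (davg \<sigma> Q * (?I / ?N) powr p)"
    using \<sigma> by (intro mult_right_mono A_p) auto
  finally show ?thesis .
qed

text \<open>A single cube against the total energy: this is spent in \<open>level_term_le\<close> on
  the surplus power \<open>q / p - 1\<close>.\<close>

lemma dvol_davg_power_le:
  "dvol TYPE('n) (fst Q) * (davg u Q * davg F Q powr p) \<le> A_p_bound * (LINT x|lebesgue. F x powr p * u x)"
proof -
  let ?I = "LINT x:dcube Q|lebesgue. F x" and ?N = "LINT x:dcube Q|lebesgue. \<sigma> x" and ?v = "dvol TYPE('n) (fst Q)"
  have I: "0 \<le> ?I" by (rule set_lebesgue_integral_nonneg[OF F_nonneg])
  note N = \<sigma>_mass_pos[of Q]
  have "?v * (davg u Q * davg F Q powr p) \<le> ?v * (A_p_bound * (davg \<sigma> Q * (?I / ?N) powr p))"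
    by (intro mult_left_mono davg_power_le less_imp_le[OF dvol_pos])
  also have "\<dots> = A_p_bound * (?N * (?I / ?N) powr p)"
    by (simp add: davg_def dvol_pos[THEN less_imp_neq, symmetric])
  also have "?N * (?I / ?N) powr p = ?I powr p / ?N powr (p - 1)"
    using I N by (simp add: powr_divide powr_diff)
  also have "\<dots> \<le> (LINT x:dcube Q|lebesgue. F x powr p * u x)" by (rule holder_F)
  also have "\<dots> \<le> (LINT x|lebesgue. F x powr p * u x)"
    unfolding set_lebesgue_integral_def
    by (rule integral_mono) (use Fpu_integrable F_int u_nonneg in \<open>auto simp: set_integrable_def split: split_indicator\<close>)
  finally show ?thesis using A_p_bound_pos by (simp add: mult_left_mono)
qed

definition carleson_const :: real where
  "carleson_const = A_p_bound * (2 powr p / (p - 1) * (4 * K\<^sub>A))"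

text \<open>By \<open>carleson_\<sigma>\<close> the coefficients
  \<open>\<mu> Q * davg \<sigma> Q\<close> satisfy a packing condition for
  \<open>\<sigma> dx\<close>, so the embedding theorem with exponent \<open>p\<close> applies to the
  averages of \<open>F / \<sigma>\<close> in that measure.\<close>

lemma carleson_F:
  assumes \<mu>: "\<And>Q. 0 \<le> \<mu> Q" and a: "0 < a"
    and car: "\<And>m Q. tree_sum dchild m \<mu> Q \<le> a * dvol TYPE('n) (fst Q)"
  shows "tree_sum dchild m (\<lambda>Q. \<mu> Q * (davg u Q * davg F Q powr p)) Q
     \<le> carleson_const * a * (LINT x:dcube Q|lebesgue. F x powr p * u x)"
proof -
  let ?I = "\<lambda>Q. LINT x:dcube Q|lebesgue. F x" and ?N = "\<lambda>Q. LINT x:dcube Q|lebesgue. \<sigma> x"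
  have \<mu>\<sigma>: "0 \<le> \<mu> Q * davg \<sigma> Q" for Q using \<mu>[of Q] davg_nonneg[of \<sigma> Q, OF \<sigma>_nonneg] by simp
  have 1: "tree_sum dchild m (\<lambda>R. \<mu> R * davg \<sigma> R * (?I R / ?N R) powr p) Q
      \<le> 2 powr p / (p - 1) * (4 * K\<^sub>A * a) * (LINT x:dcube Q|lebesgue. F x powr p * u x)"
  proof (rule carleson_embedding[OF p _ finite_dchild dchild_nonempty \<sigma>_mass_pos _ _ _ _ holder_F \<mu>\<sigma> carleson_\<sigma>[OF \<mu> a car]])
    show "0 < 4 * K\<^sub>A * a" using K\<^sub>A a by simp
    show "(\<Sum>R\<in>dchild Q. ?N R) = ?N Q" for Q by (rule set_integral_dcube_eq_sum[OF \<sigma>_integrable, symmetric])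
    show "0 \<le> ?I Q" for Q by (rule set_lebesgue_integral_nonneg[OF F_nonneg])
    show "(\<Sum>R\<in>dchild Q. ?I R) = ?I Q" for Q by (rule set_integral_dcube_eq_sum[OF F_integrable, symmetric])
    show "(\<Sum>R\<in>dchild Q. LINT x:dcube R|lebesgue. F x powr p * u x) = (LINT x:dcube Q|lebesgue. F x powr p * u x)" for Q
      by (rule set_integral_dcube_eq_sum[OF Fpu_integrable, symmetric])
  qed
  have "tree_sum dchild m (\<lambda>Q. \<mu> Q * (davg u Q * davg F Q powr p)) Q
      \<le> tree_sum dchild m (\<lambda>R. A_p_bound * (\<mu> R * davg \<sigma> R * (?I R / ?N R) powr p)) Q"
  proof (rule tree_sum_mono)
    fix R
    have "\<mu> R * (davg u R * davg F R powr p) \<le> \<mu> R * (A_p_bound * (davg \<sigma> R * (?I R / ?N R) powr p))"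
      by (intro mult_left_mono davg_power_le \<mu>)
    then show "\<mu> R * (davg u R * davg F R powr p) \<le> A_p_bound * (\<mu> R * davg \<sigma> R * (?I R / ?N R) powr p)"
      by (simp only: mult_ac)
  qed
  also have "\<dots> = A_p_bound * tree_sum dchild m (\<lambda>R. \<mu> R * davg \<sigma> R * (?I R / ?N R) powr p) Q"
    by (rule tree_sum_cmult)
  also have "\<dots> \<le> A_p_bound * (2 powr p / (p - 1) * (4 * K\<^sub>A * a) * (LINT x:dcube Q|lebesgue. F x powr p * u x))"
    using 1 A_p_bound_pos by (intro mult_left_mono) auto
  also have "\<dots> = carleson_const * a * (LINT x:dcube Q|lebesgue. F x powr p * u x)"
    by (simp add: carleson_const_def)
  finally show ?thesis .
qed

text \<open>What the cube contributes once a power of two depending only on the offset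
  \<open>j\<close> has been split off. The power of the volume is what remains of the side length to
  the power \<open>q\<close> after multiplication by the power of the maximal function.\<close>

definition level_term :: "real \<Rightarrow> int \<times> ('n \<Rightarrow> int) \<Rightarrow> real" where
  "level_term q Q = dvol TYPE('n) (fst Q) powr (q / p - 1) * (davg u Q powr (q / p) * davg F Q powr q)"

text \<open>With \<open>b = davg u Q * davg F Q powr p\<close> and the volume \<open>v\<close>, the
  term is \<open>(v * b) powr (q / p - 1) * b\<close>. The first factor is bounded by the energy,
  and the second one is linear in \<open>b\<close>, as \<open>carleson_F\<close> needs it.\<close>

lemma level_term_le:
  assumes q: "p \<le> q"
  shows "level_term q Q \<le> (A_p_bound * (LINT x|lebesgue. F x powr p * u x)) powr (q / p - 1) * (davg u Q * davg F Q powr p)"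
proof -
  let ?b = "davg u Q * davg F Q powr p" and ?v = "dvol TYPE('n) (fst Q)"
  have b: "0 \<le> ?b" using davg_pos[of Q] by simp
  have qp: "0 \<le> q / p - 1" using q p by simp
  have "level_term q Q = ?v powr (q / p - 1) * ?b powr (q / p)"
    using p davg_pos[of Q] davg_nonneg[where Q = Q, OF F_nonneg] by (simp add: level_term_def powr_mult powr_powr)
  also have "\<dots> = (?v * ?b) powr (q / p - 1) * ?b"
  proof (cases "?b = 0")
    case False
    then have "?b powr (q / p) = ?b powr (q / p - 1) * ?b" using b by (simp add: powr_diff)
    then show ?thesis using b by (simp add: powr_mult less_imp_le[OF dvol_pos])
  qed (use p q in auto)
  also have "\<dots> \<le> (A_p_bound * (LINT x|lebesgue. F x powr p * u x)) powr (q / p - 1) * ?b"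
    using b qp dvol_davg_power_le[of Q] by (intro mult_right_mono powr_mono2) (auto simp: less_imp_le[OF dvol_pos])
  finally show ?thesis .
qed

lemma level_term_nonneg: "0 \<le> level_term q Q"
  by (simp add: level_term_def)

definition level_const :: "real \<Rightarrow> real" where
  "level_const q = A_p_bound powr (q / p - 1) * carleson_const"

lemma level_sum_le:
  fixes g :: "real ^ 'n \<Rightarrow> real"
  assumes q: "p \<le> q" and g: "integrable lebesgue g" "0 < (LINT y|lebesgue. \<bar>g y\<bar>)"
  shows "(\<integral>\<^sup>+i. (\<integral>\<^sup>+x\<in>dmax_level g (i - j). ennreal (level_term q (i, dindex i x)) \<partial>lebesgue) \<partial>count_space UNIV)
    \<le> ennreal (level_const q * level_decay TYPE('n) j * (LINT x|lebesgue. F x powr p * u x) powr (q / p))"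
proof -
  let ?T = "LINT x|lebesgue. F x powr p * u x" and ?a = "level_decay TYPE('n) j"
  let ?E = "\<lambda>Q. measure lebesgue (dcube Q \<inter> dmax_level g (fst Q - j))"
  let ?V = "\<lambda>Q. LINT x:dcube Q|lebesgue. F x powr p * u x"
  define c where "c = (A_p_bound * ?T) powr (q / p - 1)"
  have T: "0 \<le> ?T" by (rule Bochner_Integration.integral_nonneg) (use u_nonneg in auto)
  have V0: "0 \<le> ?V Q" for Q by (rule set_lebesgue_integral_nonneg) (use u_nonneg in auto)
  have c: "c \<ge> 0" by (simp add: c_def)
  have cc: "carleson_const \<ge> 0" using p K\<^sub>A A_p_bound_pos by (simp add: carleson_const_def)
  have a: "?a > 0" by (rule level_decay_pos)
  define d where "d = c * (carleson_const * ?a)"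
  have d: "d \<ge> 0" using c cc a by (simp add: d_def)
  have "(\<integral>\<^sup>+i. (\<integral>\<^sup>+x\<in>dmax_level g (i - j). ennreal (level_term q (i, dindex i x)) \<partial>lebesgue) \<partial>count_space UNIV) \<le> ennreal (d * ?T)"
  proof (rule sum_levels_le[where V = "\<lambda>Q. d * ?V Q"])
    show "tree_sum dchild m (\<lambda>Q. ?E Q * level_term q Q) Q \<le> d * ?V Q" for m Q
    proof -
      have "tree_sum dchild m (\<lambda>Q. ?E Q * level_term q Q) Q \<le> tree_sum dchild m (\<lambda>Q. c * (?E Q * (davg u Q * davg F Q powr p))) Q"
      proof (rule tree_sum_mono)
        fix R
        have "?E R * level_term q R \<le> ?E R * (c * (davg u R * davg F R powr p))"
          unfolding c_def by (intro mult_left_mono level_term_le q) auto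
        then show "?E R * level_term q R \<le> c * (?E R * (davg u R * davg F R powr p))" by (simp only: mult.left_commute)
      qed
      also have "\<dots> = c * tree_sum dchild m (\<lambda>Q. ?E Q * (davg u Q * davg F Q powr p)) Q" by (rule tree_sum_cmult)
      also have "\<dots> \<le> c * (carleson_const * ?a * ?V Q)"
        by (intro mult_left_mono c carleson_F a level_sets_carleson g) auto
      finally show ?thesis by (simp add: d_def mult.assoc)
    qed
    show "(\<integral>\<^sup>+k. ennreal (d * ?V (i, k)) \<partial>count_space UNIV) \<le> ennreal (d * ?T)" for i
    proof -
      have eq: "ennreal (?V (i, k)) = (\<integral>\<^sup>+x\<in>dcube (i, k). ennreal (F x powr p * u x) \<partial>lebesgue)" for k
        by (rule nn_set_integral_eq_set_integral'[OF Fpu_integrable, symmetric]) (use u_nonneg in auto)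
      have "(\<integral>\<^sup>+k. ennreal (d * ?V (i, k)) \<partial>count_space UNIV) = ennreal d * (\<integral>\<^sup>+k. ennreal (?V (i, k)) \<partial>count_space UNIV)"
        using d V0 by (simp add: ennreal_mult nn_integral_cmult)
      also have "(\<integral>\<^sup>+k. ennreal (?V (i, k)) \<partial>count_space UNIV) = (\<integral>\<^sup>+x. ennreal (F x powr p * u x) \<partial>lebesgue)"
        unfolding eq by (rule nn_integral_eq_sum_dcube[symmetric]) (use F_int in auto)
      also have "\<dots> = ennreal ?T"
        by (rule nn_integral_eq_integral[OF F_int]) (use u_nonneg in auto)
      finally show ?thesis using d T by (simp add: ennreal_mult)
    qed
  qed (auto simp: level_term_nonneg)
  also have "d * ?T = level_const q * ?a * ?T powr (q / p)"
  proof (cases "?T = 0")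
    case False
    have "?T powr (q / p) = ?T powr (q / p - 1) * ?T" using False T by (simp add: powr_diff)
    then show ?thesis using T A_p_bound_pos by (simp add: d_def c_def level_const_def powr_mult mult_ac)
  qed simp
  finally show ?thesis .
qed

end

end

section \<open>Weights with values in the extended half-line\<close>

lemma weight_finite_AE:
  assumes w: "weight w"
  shows "AE x in lebesgue. w x \<noteq> \<infinity>"
proof -
  have [measurable]: "w \<in> borel_measurable lebesgue" using w by (simp add: weight_def)
  have [measurable]: "cball 0 (real N) \<in> sets lebesgue" for N
    by (rule fmeasurableD[OF lmeasurable_compact[OF compact_cball]])
  have "AE x in lebesgue. w x * indicator (cball 0 (real N)) x \<noteq> \<infinity>" for N :: nat
  proof (rule nn_integral_PInf_AE)
    have "(\<integral>\<^sup>+x\<in>cball 0 (real N). w x \<partial>lebesgue) < \<infinity>"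
      using w compact_cball unfolding weight_def by blast
    then show "(\<integral>\<^sup>+x. w x * indicator (cball 0 (real N)) x \<partial>lebesgue) \<noteq> \<infinity>" by simp
  qed measurable
  then have "AE x in lebesgue. \<forall>N::nat. w x * indicator (cball 0 (real N)) x \<noteq> \<infinity>"
    by (subst AE_all_countable) blast
  then show ?thesis
  proof eventually_elim
    fix x assume *: "\<forall>N::nat. w x * indicator (cball 0 (real N)) x \<noteq> \<infinity>"
    obtain N :: nat where "norm x \<le> real N" using real_arch_simple by blast
    then show "w x \<noteq> \<infinity>" using *[rule_format, of N] by simp
  qed
qed

lemma weight_real_average:
  fixes w :: "real ^ 'n \<Rightarrow> ennreal"
  assumes w: "weight w" and h [measurable]: "h \<in> borel_measurable lebesgue" and h0: "\<And>x. 0 \<le> h x"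
    and eq: "AE x in lebesgue. w x = ennreal (h x)"
    and D: "compact D" "0 < measure lebesgue D"
  shows "set_integrable lebesgue D h"
    and "average D w = ennreal ((LINT x:D|lebesgue. h x) / measure lebesgue D)"
proof -
  have Dm: "D \<in> lmeasurable" using D by (intro lmeasurable_compact)
  then have [measurable]: "D \<in> sets lebesgue" by auto
  have e: "(\<integral>\<^sup>+x\<in>D. w x \<partial>lebesgue) = (\<integral>\<^sup>+x\<in>D. ennreal (h x) \<partial>lebesgue)"
    by (intro nn_set_integral_cong eq)
  show hi: "set_integrable lebesgue D h"
    unfolding set_integrable_def
  proof (rule integrableI_nonneg)
    have "(\<integral>\<^sup>+x. ennreal (indicat_real D x *\<^sub>R h x) \<partial>lebesgue) = (\<integral>\<^sup>+x\<in>D. ennreal (h x) \<partial>lebesgue)"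
      by (intro nn_integral_cong) (auto split: split_indicator)
    also have "\<dots> < \<infinity>" using w D unfolding weight_def e[symmetric] by blast
    finally show "(\<integral>\<^sup>+x. ennreal (indicat_real D x *\<^sub>R h x) \<partial>lebesgue) < \<infinity>" .
  qed (use h0 in auto)
  have "emeasure lebesgue D = ennreal (measure lebesgue D)" using Dm by (simp add: emeasure_eq_measure2)
  moreover have "(\<integral>\<^sup>+x\<in>D. ennreal (h x) \<partial>lebesgue) = ennreal (LINT x:D|lebesgue. h x)"
    by (rule nn_set_integral_eq_set_integral'[OF hi]) (use h0 in auto)
  ultimately show "average D w = ennreal ((LINT x:D|lebesgue. h x) / measure lebesgue D)"
    unfolding average_def e using D set_lebesgue_integral_nonneg[where A = D and M = lebesgue, OF h0] by (simp add: divide_ennreal)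
qed

lemma cubes_compact: "D \<in> cubes \<Longrightarrow> compact D"
  by (auto simp: cubes_def)

lemma cubes_measure_pos: "D \<in> cubes \<Longrightarrow> 0 < measure lebesgue (D :: (real ^ 'n) set)"
proof -
  assume "D \<in> cubes"
  then obtain a b l where D: "D = cbox a b" and l: "l > 0" "\<And>i. b $ i - a $ i = l" by (auto simp: cubes_def)
  have "b $ i = a $ i + l" for i using l(2)[of i] by simp
  then have "b = (\<chi> j. a $ j + l)" by (simp add: vec_eq_iff)
  then show ?thesis using cart_interval_measure[OF l(1), of a] D l by simp
qed

lemma RH_inf_real:
  fixes v :: "real ^ 'n \<Rightarrow> ennreal"
  assumes v: "weight v" and u [measurable]: "u \<in> borel_measurable lebesgue" and u0: "\<And>x. 0 \<le> u x"
    and eq: "AE x in lebesgue. v x = ennreal (u x)"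
    and K: "RH_inf_const v \<le> ennreal K" "0 < K" and D: "D \<in> cubes"
  shows "AE x\<in>D in lebesgue. u x \<le> K * ((LINT x:D|lebesgue. u x) / measure lebesgue D)"
proof -
  define a where "a = (LINT x:D|lebesgue. u x) / measure lebesgue D"
  note Dp = cubes_measure_pos[OF D]
  have a: "a \<ge> 0" unfolding a_def by (intro divide_nonneg_nonneg set_lebesgue_integral_nonneg u0) auto
  have av: "average D v = ennreal a"
    unfolding a_def by (rule weight_real_average(2)[OF v u u0 eq cubes_compact[OF D] Dp])
  define s where "s = esssup (restrict_space lebesgue D) v"
  have "s * inverse (ennreal a) \<le> RH_inf_const v"
    unfolding RH_inf_const_def s_def av[symmetric] by (rule SUP_upper[OF D])
  then have le: "s * inverse (ennreal a) \<le> ennreal K" using K by (rule_tac order_trans)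
  have sa: "s \<le> ennreal (K * a)"
  proof (cases "a = 0")
    \<comment> \<open>Here \<open>inverse 0\<close> is infinite, so a vanishing average forces the
      essential supremum to vanish.\<close>
    case True
    have "s = 0"
    proof (rule ccontr)
      assume "s \<noteq> 0"
      then have "s * inverse (ennreal a) = \<infinity>" using True by (simp add: ennreal_mult_top)
      with le show False by (simp add: top_unique)
    qed
    then show ?thesis by simp
  next
    case False
    have "s = s * (inverse (ennreal a) * ennreal a)"
      using False a by (simp add: inverse_ennreal ennreal_mult[symmetric])
    also have "\<dots> = s * inverse (ennreal a) * ennreal a" by (simp only: mult.assoc)
    also have "\<dots> \<le> ennreal K * ennreal a" by (intro mult_right_mono le) auto
    finally show ?thesis using K a by (simp add: ennreal_mult)
  qed
  have [simp]: "D \<in> sets lebesgue" by (rule fmeasurableD[OF lmeasurable_compact[OF cubes_compact[OF D]]])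
  have "AE x in restrict_space lebesgue D. v x \<le> s" unfolding s_def by (rule esssup_AE)
  then have "AE x\<in>D in lebesgue. v x \<le> s" by (subst (asm) AE_restrict_space_iff) auto
  with eq show ?thesis
  proof eventually_elim
    fix x assume x: "v x = ennreal (u x)" "x \<in> D \<longrightarrow> v x \<le> s"
    show "x \<in> D \<longrightarrow> u x \<le> K * ((LINT x:D|lebesgue. u x) / measure lebesgue D)"
    proof
      assume "x \<in> D"
      then have "ennreal (u x) \<le> ennreal (K * a)" using x sa by (metis order_trans)
      then have "u x \<le> K * a" using K(2) a by (simp add: ennreal_le_iff)
      then show "u x \<le> K * ((LINT x:D|lebesgue. u x) / measure lebesgue D)" by (simp add: a_def)
    qed
  qed
qed

lemma signed_average_dclosure:
  fixes L :: "real ^ 'n \<Rightarrow> real"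
  assumes L: "set_integrable lebesgue (dcube Q) L" and eq: "AE x in lebesgue. h x = ereal (L x)"
  shows "signed_average (dclosure Q) h = ereal (davg L Q)"
proof -
  let ?v = "dvol TYPE('n) (fst Q)"
  define A where "A = (\<integral>\<^sup>+x. ennreal (indicator (dcube Q) x *\<^sub>R L x) \<partial>lebesgue)"
  define B where "B = (\<integral>\<^sup>+x. ennreal (- (indicator (dcube Q) x *\<^sub>R L x)) \<partial>lebesgue)"
  have int: "integrable lebesgue (\<lambda>x. indicator (dcube Q) x *\<^sub>R L x)" using L by (simp add: set_integrable_def)
  have fin: "A \<noteq> \<infinity>" "B \<noteq> \<infinity>"
    unfolding A_def B_def using int by (auto simp: real_integrable_def)
  obtain a b where ab: "A = ennreal a" "0 \<le> a" "B = ennreal b" "0 \<le> b"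
    using fin by (metis ennreal_cases infinity_ennreal_def)
  have LI: "(LINT x:dcube Q|lebesgue. L x) = a - b"
    using real_lebesgue_integral_def[OF int] ab
    unfolding set_lebesgue_integral_def A_def[symmetric] B_def[symmetric] by simp
  have "(\<integral>\<^sup>+x\<in>dclosure Q. e2ennreal (h x) \<partial>lebesgue) = A"
    unfolding nn_integral_dclosure_eq A_def
    by (rule nn_integral_cong_AE) (use eq in \<open>auto elim!: eventually_mono simp: e2ennreal_ereal split: split_indicator\<close>)
  moreover have "(\<integral>\<^sup>+x\<in>dclosure Q. e2ennreal (- h x) \<partial>lebesgue) = B"
    unfolding nn_integral_dclosure_eq B_def
    by (rule nn_integral_cong_AE) (use eq in \<open>auto elim!: eventually_mono simp: e2ennreal_ereal split: split_indicator\<close>)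
  ultimately have "signed_average (dclosure Q) h = enn2ereal (ennreal a / ennreal ?v) - enn2ereal (ennreal b / ennreal ?v)"
    by (simp add: signed_average_def average_def emeasure_dclosure ab)
  also have "\<dots> = ereal (a / ?v) - ereal (b / ?v)"
    using ab dvol_pos[where 'n = 'n, of "fst Q"] by (simp add: divide_ennreal enn2ereal_ennreal del: dvol_pos)
  also have "\<dots> = ereal (davg L Q)" by (simp add: davg_def LI diff_divide_distrib)
  finally show ?thesis .
qed

text \<open>A member of \<open>A_inf\<close> is locally integrable, hence finite almost everywhere.
  As the dual weight is infinite where \<open>v\<close> is zero, \<open>v\<close> is positive almost
  everywhere, and the real powers and logarithms of its representative agree with the extended ones.
  \<open>K\<close> and \<open>K\<^sub>A\<close> are real upper bounds for the extended
  constants.\<close>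

lemma A_p_weight_of_RH_inf:
  fixes v :: "real ^ 'n \<Rightarrow> ennreal"
  assumes p: "1 < p" "1 / p + 1 / p' = 1"
    and v: "v \<in> RH_inf" and s: "(\<lambda>x. v x epowr (- p' / p)) \<in> A_inf"
    and K: "RH_inf_const v \<le> ennreal K" "0 < K"
    and K\<^sub>A: "A_inf_const (\<lambda>x. v x epowr (- p' / p)) \<le> ennreal K\<^sub>A" "0 < K\<^sub>A"
  shows "A_p_weight (\<lambda>x. enn2real (v x)) K p K\<^sub>A" and "AE x in lebesgue. v x = ennreal (enn2real (v x))"
proof -
  define u where "u x = enn2real (v x)" for x
  define e where "e = 1 / (p - 1)"
  have e: "e > 0" using p by (simp add: e_def)
  have pe: "- p' / p = - e"
  proof -
    have "1 / p' = (p - 1) / p" using p by (simp add: field_simps)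
    then have "p' = p / (p - 1)" using p by (metis inverse_divide inverse_eq_divide inverse_inverse_eq)
    then show ?thesis using p by (simp add: e_def)
  qed
  let ?\<sigma> = "\<lambda>x. v x epowr (- p' / p)"
  have wv: "weight v" using v by (simp add: RH_inf_def)
  have ws: "weight ?\<sigma>" using s by (simp add: A_inf_def)
  have vm [measurable]: "v \<in> borel_measurable lebesgue" using wv by (simp add: weight_def)
  have um [measurable]: "u \<in> borel_measurable lebesgue" unfolding u_def by measurable
  have u0: "0 \<le> u x" for x by (simp add: u_def)
  have veq: "AE x in lebesgue. v x = ennreal (u x)"
    using weight_finite_AE[OF wv] by eventually_elim (simp add: u_def top.not_eq_extremum)
  have upos: "AE x in lebesgue. 0 < u x"
    using weight_finite_AE[OF wv] weight_finite_AE[OF ws]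
  proof eventually_elim
    fix x assume x: "v x \<noteq> \<infinity>" "?\<sigma> x \<noteq> \<infinity>"
    have "v x \<noteq> 0" using x(2) e unfolding pe by (auto simp: epowr_def)
    then show "0 < u x" using x(1) by (simp add: u_def enn2real_positive_iff top.not_eq_extremum zero_less_iff_neq_zero)
  qed
  have seq: "AE x in lebesgue. ?\<sigma> x = ennreal (u x powr (- e))"
    using veq upos
  proof eventually_elim
    fix x assume x: "v x = ennreal (u x)" "0 < u x"
    then show "?\<sigma> x = ennreal (u x powr (- e))" unfolding pe using e by (auto simp: epowr_def)
  qed
  interpret RH_weight u K
  proof
    show "u \<in> borel_measurable lebesgue" "\<And>x. 0 \<le> u x" "AE x in lebesgue. 0 < u x" "0 < K"
      by (rule um u0 upos K(2))+
    fix D :: "(real ^ 'n) set" assume D: "D \<in> cubes"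
    show "set_integrable lebesgue D u"
      by (rule weight_real_average(1)[OF wv um u0 veq cubes_compact[OF D] cubes_measure_pos[OF D]])
    show "AE x\<in>D in lebesgue. u x \<le> K * ((LINT x:D|lebesgue. u x) / measure lebesgue D)"
      by (rule RH_inf_real[OF wv um u0 veq K D])
  qed
  have sm: "(\<lambda>x. u x powr (- e)) \<in> borel_measurable lebesgue" by measurable
  have s0: "0 \<le> u x powr (- e)" for x by simp
  have pe': "- 1 / (p - 1) = - e" by (simp add: e_def)
  have si: "set_integrable lebesgue (dclosure Q) (\<lambda>x. u x powr (- e))"
    and sav: "average (dclosure Q) ?\<sigma> = ennreal ((LINT x:dclosure Q|lebesgue. u x powr (- e)) / measure lebesgue (dclosure Q))" for Q :: "int \<times> ('n \<Rightarrow> int)"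
    by (rule weight_real_average[OF ws sm s0 seq cubes_compact[OF dclosure_cubes] cubes_measure_pos[OF dclosure_cubes]])+
  have si': "set_integrable lebesgue (dcube Q) (\<lambda>x. u x powr (- e))" for Q
    by (rule set_integrable_subset[OF si[of Q]]) (auto simp: dcube_subset_dclosure)
  have "A_p_weight u K p K\<^sub>A"
  proof
    show "1 < p" "0 < K\<^sub>A" by fact+
    show "set_integrable lebesgue (dcube Q) (\<lambda>x. u x powr (- 1 / (p - 1)))" for Q unfolding pe' by (rule si')
    show "davg (\<lambda>x. u x powr (- 1 / (p - 1))) Q * exp (1 / (p - 1) * davg (\<lambda>x. ln (u x)) Q) \<le> K\<^sub>A" for Q
    proof -
      let ?a = "davg (\<lambda>x. u x powr (- e)) Q" and ?L = "\<lambda>x. - e * ln (u x)"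
      have a0: "0 \<le> ?a" by (rule davg_nonneg) simp
      have av: "average (dclosure Q) ?\<sigma> = ennreal ?a"
      proof -
        have "ennreal (LINT x:dcube Q|lebesgue. u x powr (- e)) = (\<integral>\<^sup>+x\<in>dcube Q. ennreal (u x powr (- e)) \<partial>lebesgue)"
          by (rule nn_set_integral_eq_set_integral'[OF si', symmetric]) simp
        also have "\<dots> = (\<integral>\<^sup>+x\<in>dclosure Q. ?\<sigma> x \<partial>lebesgue)"
          unfolding nn_integral_dclosure_eq[symmetric] by (rule nn_set_integral_cong) (use seq in \<open>auto elim!: eventually_mono\<close>)
        finally have "average (dclosure Q) ?\<sigma> = ennreal (LINT x:dcube Q|lebesgue. u x powr (- e)) / ennreal (dvol TYPE('n) (fst Q))"
          by (simp add: average_def emeasure_dclosure)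
        also have "\<dots> = ennreal ?a"
          unfolding davg_def by (rule divide_ennreal) (auto intro: set_lebesgue_integral_nonneg)
        finally show ?thesis .
      qed
      have Li: "set_integrable lebesgue (dcube Q) ?L"
        by (intro set_integrable_mult_right integral_ln_lower(1))
      have sa: "signed_average (dclosure Q) (\<lambda>x. eln (?\<sigma> x)) = ereal (davg ?L Q)"
      proof (rule signed_average_dclosure[OF Li])
        show "AE x in lebesgue. eln (?\<sigma> x) = ereal (?L x)"
          using seq upos
        proof eventually_elim
          fix x assume x: "?\<sigma> x = ennreal (u x powr (- e))" "0 < u x"
          have "0 < u x powr (- e)" using x(2) by simp
          then have "eln (?\<sigma> x) = ereal (ln (u x powr (- e)))"
            unfolding x(1) eln_def by (simp add: ennreal_eq_0_iff)
          then show "eln (?\<sigma> x) = ereal (?L x)" using x(2) by (simp add: ln_powr)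
        qed
      qed
      have L: "davg ?L Q = - (e * davg (\<lambda>x. ln (u x)) Q)"
        unfolding davg_def set_integral_mult_right by simp
      have "ennreal ?a * eexp (- signed_average (dclosure Q) (\<lambda>x. eln (?\<sigma> x))) \<le> A_inf_const ?\<sigma>"
        unfolding A_inf_const_def av[symmetric] by (rule SUP_upper[OF dclosure_cubes])
      also have "\<dots> \<le> ennreal K\<^sub>A" by (rule K\<^sub>A)
      also have "eexp (- signed_average (dclosure Q) (\<lambda>x. eln (?\<sigma> x))) = ennreal (exp (e * davg (\<lambda>x. ln (u x)) Q))"
        unfolding sa L by (simp add: eexp_def)
      finally have "ennreal (?a * exp (e * davg (\<lambda>x. ln (u x)) Q)) \<le> ennreal K\<^sub>A"
        using a0 by (simp add: ennreal_mult)
      then show ?thesis unfolding pe' using K\<^sub>A(2) by (subst (asm) ennreal_le_iff) (auto simp: e_def)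
    qed
  qed
  then show "A_p_weight (\<lambda>x. enn2real (v x)) K p K\<^sub>A" by (simp add: u_def[abs_def])
  show "AE x in lebesgue. v x = ennreal (enn2real (v x))" using veq by (simp add: u_def)
qed

section \<open>The weighted inequality\<close>

lemma epowr_ennreal: "0 \<le> x \<Longrightarrow> 0 < a \<Longrightarrow> ennreal x epowr a = ennreal (x powr a)"
  by (auto simp: epowr_def ennreal_eq_0_iff)

lemma epowr_mono:
  assumes "x \<le> y" "0 < a"
  shows "x epowr a \<le> y epowr a"
proof (cases "y = \<infinity>")
  case False
  then obtain s where s: "y = ennreal s" "0 \<le> s" by (metis ennreal_cases infinity_ennreal_def)
  have "x \<noteq> \<infinity>" using assms False by (auto simp: top_unique)
  then obtain r where r: "x = ennreal r" "0 \<le> r" by (metis ennreal_cases infinity_ennreal_def)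
  have "r \<le> s" using assms r s by simp
  then show ?thesis using r s assms by (simp add: epowr_ennreal powr_mono2 ennreal_leI)
qed (use assms in \<open>auto simp: epowr_def\<close>)

section \<open>Summation over the offset between scale and level\<close>

lemma nn_integral_int_geometric:
  assumes e: "0 < (e::real)"
  shows "(\<integral>\<^sup>+j. ennreal (2 powr (- e * real_of_int \<bar>j\<bar>)) \<partial>count_space UNIV) \<le> ennreal (2 / (1 - 2 powr (- e)))"
proof (rule nn_integral_count_space_int_le)
  fix N
  define r where "r = 2 powr (- e)"
  have r: "0 < r" "r < 1" using e by (auto simp: r_def powr_less_one)
  let ?h = "\<lambda>j::int. 2 powr (- e * real_of_int \<bar>j\<bar>)"
  have pw: "2 powr (- e * real l) = r ^ l" for l :: nat
    using r by (simp add: r_def powr_powr flip: powr_realpow)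
  have h_int: "?h (int l) = r ^ l" "?h (- int l) = r ^ l" for l :: nat using pw[of l] by simp_all
  have inj: "inj_on int {..<Suc N}" "inj_on (\<lambda>l. - int l) {..<Suc N}" by (auto simp: inj_on_def)
  have geo: "(\<Sum>l\<in>{..<Suc N}. r ^ l) \<le> 1 / (1 - r)"
    unfolding sum_gp_strict using r by (auto simp: divide_right_mono)
  \<comment> \<open>Zero lies in both halves and is counted twice, which only enlarges the
    bound.\<close>
  have "(\<Sum>j\<in>{- int N<..int N}. ?h j) \<le> (\<Sum>j\<in>int ` {..<Suc N} \<union> (\<lambda>l. - int l) ` {..<Suc N}. ?h j)"
  proof (rule sum_mono2)
    show "{- int N<..int N} \<subseteq> int ` {..<Suc N} \<union> (\<lambda>l. - int l) ` {..<Suc N}"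
    proof
      fix j assume j: "j \<in> {- int N<..int N}"
      show "j \<in> int ` {..<Suc N} \<union> (\<lambda>l. - int l) ` {..<Suc N}"
      proof (cases "j \<ge> 0")
        case True
        then have "j = int (nat j)" "nat j < Suc N" using j by auto
        then show ?thesis by blast
      next
        case False
        then have "j = - int (nat (- j))" "nat (- j) < Suc N" using j by auto
        then show ?thesis by blast
      qed
    qed
  qed auto
  also have "\<dots> \<le> (\<Sum>j\<in>int ` {..<Suc N}. ?h j) + (\<Sum>j\<in>(\<lambda>l. - int l) ` {..<Suc N}. ?h j)"
    by (subst sum_Un) (auto intro!: sum_nonneg)
  also have "(\<Sum>j\<in>int ` {..<Suc N}. ?h j) = (\<Sum>l\<in>{..<Suc N}. r ^ l)"
    by (simp only: sum.reindex[OF inj(1)] o_def h_int)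
  also have "(\<Sum>j\<in>(\<lambda>l. - int l) ` {..<Suc N}. ?h j) = (\<Sum>l\<in>{..<Suc N}. r ^ l)"
    by (simp only: sum.reindex[OF inj(2)] o_def h_int)
  also have "(\<Sum>l\<in>{..<Suc N}. r ^ l) + (\<Sum>l\<in>{..<Suc N}. r ^ l) \<le> 1 / (1 - r) + 1 / (1 - r)"
    by (intro add_mono geo)
  finally have "(\<Sum>j\<in>{- int N<..int N}. ?h j) \<le> 2 / (1 - r)" by simp
  then have "ennreal (\<Sum>j\<in>{- int N<..int N}. ?h j) \<le> ennreal (2 / (1 - r))" by (rule ennreal_leI)
  then show "(\<Sum>j\<in>{- int N<..int N}. ennreal (?h j)) \<le> ennreal (2 / (1 - 2 powr (- e)))"
    by (subst sum_ennreal) (auto simp: r_def)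
qed

text \<open>Every term of the right-hand series bounds the corresponding \<open>b j\<close>, up to a geometric factor.\<close>

lemma nn_integral_int_powr_le:
  fixes b :: "int \<Rightarrow> real"
  assumes b: "\<And>j. 0 \<le> b j" and q: "0 < q" and e: "0 < e"
  shows "(\<integral>\<^sup>+j. ennreal (b j) \<partial>count_space UNIV) epowr q \<le>
    ennreal ((2 / (1 - 2 powr (- e))) powr q) * (\<integral>\<^sup>+j. ennreal ((2 powr (e * real_of_int \<bar>j\<bar>) * b j) powr q) \<partial>count_space UNIV)"
proof -
  define S where "S = 2 / (1 - 2 powr (- e))"
  have S: "S > 0" using e by (simp add: S_def powr_less_one)
  let ?w = "\<lambda>j. 2 powr (e * real_of_int \<bar>j\<bar>)"
  define R where "R = (\<integral>\<^sup>+j. ennreal ((?w j * b j) powr q) \<partial>count_space UNIV)"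
  show ?thesis
  proof (cases "R = \<infinity>")
    case True
    then show ?thesis using S unfolding R_def[symmetric] S_def[symmetric]
      by (simp add: ennreal_mult_top ennreal_eq_0_iff)
  next
    case False
    then obtain r where r: "R = ennreal r" "0 \<le> r" by (metis ennreal_cases infinity_ennreal_def)
    have each: "b j \<le> r powr (1 / q) * 2 powr (- e * real_of_int \<bar>j\<bar>)" for j
    proof -
      have "ennreal ((?w j * b j) powr q) \<le> R"
        unfolding R_def using nn_integral_count_space_sum_le[of "{j}" "\<lambda>j. ennreal ((?w j * b j) powr q)"] by simp
      then have "(?w j * b j) powr q \<le> r" using r by simp
      then have "((?w j * b j) powr q) powr (1 / q) \<le> r powr (1 / q)" using q by (intro powr_mono2) auto
      then have "?w j * b j \<le> r powr (1 / q)" using q b by (simp add: powr_powr)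
      then have "2 powr (- e * real_of_int \<bar>j\<bar>) * (?w j * b j) \<le> 2 powr (- e * real_of_int \<bar>j\<bar>) * r powr (1 / q)"
        by (intro mult_left_mono) auto
      moreover have "2 powr (- e * real_of_int \<bar>j\<bar>) * ?w j = 1" by (simp flip: powr_add)
      then have "2 powr (- e * real_of_int \<bar>j\<bar>) * (?w j * b j) = b j" by (simp only: mult.assoc[symmetric] mult_1_left)
      ultimately show ?thesis by (simp only: mult.commute[of "r powr (1 / q)"])
    qed
    have "(\<integral>\<^sup>+j. ennreal (b j) \<partial>count_space UNIV) \<le> (\<integral>\<^sup>+j. ennreal (r powr (1 / q)) * ennreal (2 powr (- e * real_of_int \<bar>j\<bar>)) \<partial>count_space UNIV)"
      unfolding ennreal_mult[OF powr_ge_zero powr_ge_zero, symmetric]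
      by (intro nn_integral_mono ennreal_leI each)
    also have "\<dots> = ennreal (r powr (1 / q)) * (\<integral>\<^sup>+j. ennreal (2 powr (- e * real_of_int \<bar>j\<bar>)) \<partial>count_space UNIV)"
      by (rule nn_integral_cmult) simp
    also have "\<dots> \<le> ennreal (r powr (1 / q)) * ennreal S"
      unfolding S_def by (intro mult_left_mono nn_integral_int_geometric e) auto
    finally have "(\<integral>\<^sup>+j. ennreal (b j) \<partial>count_space UNIV) \<le> ennreal (r powr (1 / q) * S)"
      using S by (simp add: ennreal_mult)
    from epowr_mono[OF this q] have "(\<integral>\<^sup>+j. ennreal (b j) \<partial>count_space UNIV) epowr q \<le> ennreal ((r powr (1 / q) * S) powr q)"
      using S q by (simp add: epowr_ennreal)
    also have "(r powr (1 / q) * S) powr q = S powr q * r" using r S q by (simp add: powr_mult powr_powr)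
    finally show ?thesis using r S unfolding R_def[symmetric] S_def[symmetric] by (simp add: ennreal_mult)
  qed
qed

text \<open>For \<open>j \<ge> 0\<close> the decay of the packing constant beats the growth of
  \<open>2 powr (\<alpha> * j)\<close>; for negative \<open>j\<close> that power decays by itself.
  \<open>\<delta>\<close> is half of the smaller margin: one half pays for the factor
  \<open>2 powr (\<delta> * \<bar>j\<bar>)\<close> that \<open>nn_integral_int_powr_le\<close>
  introduces, the other one makes the sum over \<open>j\<close> converge.\<close>

lemma level_decay_le:
  assumes "0 < (\<alpha>::real)" "\<alpha> < real CARD('n::finite)"
    and \<delta>: "\<delta> = min \<alpha> (real CARD('n) - \<alpha>) / 2"
  shows "2 powr (\<delta> * real_of_int \<bar>j\<bar> + \<alpha> * real_of_int j) * level_decay TYPE('n) j \<le> 6 ^ CARD('n) * 2 powr (- \<delta> * real_of_int \<bar>j\<bar>)"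
proof -
  have d: "2 * \<delta> \<le> \<alpha>" "2 * \<delta> \<le> real CARD('n) - \<alpha>" "0 \<le> \<delta>" using assms by (auto simp: \<delta>)
  have six: "(1::real) \<le> 6 ^ CARD('n)" by simp
  show ?thesis
  proof (cases "j \<ge> 0")
    case True
    have "2 powr (\<delta> * real_of_int \<bar>j\<bar> + \<alpha> * real_of_int j) * level_decay TYPE('n) j
        \<le> 2 powr (\<delta> * real_of_int \<bar>j\<bar> + \<alpha> * real_of_int j) * (6 ^ CARD('n) * dvol TYPE('n) (- j))"
      by (intro mult_left_mono) (auto simp: level_decay_def)
    also have "\<dots> = 6 ^ CARD('n) * 2 powr (\<delta> * real_of_int \<bar>j\<bar> + \<alpha> * real_of_int j - real CARD('n) * real_of_int j)"
      by (simp add: dvol_def powr_diff powr_minus field_simps)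
    also have "\<dots> \<le> 6 ^ CARD('n) * 2 powr (- \<delta> * real_of_int \<bar>j\<bar>)"
    proof (intro mult_left_mono powr_mono)
      have "2 * \<delta> * real_of_int j \<le> (real CARD('n) - \<alpha>) * real_of_int j" using d True by (intro mult_right_mono) auto
      then show "\<delta> * real_of_int \<bar>j\<bar> + \<alpha> * real_of_int j - real CARD('n) * real_of_int j \<le> - \<delta> * real_of_int \<bar>j\<bar>"
        using True by (simp add: algebra_simps)
    qed auto
    finally show ?thesis .
  next
    case False
    have "2 powr (\<delta> * real_of_int \<bar>j\<bar> + \<alpha> * real_of_int j) * level_decay TYPE('n) j
        \<le> 2 powr (\<delta> * real_of_int \<bar>j\<bar> + \<alpha> * real_of_int j) * 1"
      by (intro mult_left_mono) (auto simp: level_decay_def)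
    also have "\<dots> \<le> 1 * 2 powr (- \<delta> * real_of_int \<bar>j\<bar>)"
    proof -
      have "\<alpha> * real_of_int j \<le> 2 * \<delta> * real_of_int j" using d False by (intro mult_right_mono_neg) auto
      then show ?thesis using False by (simp add: algebra_simps)
    qed
    also have "\<dots> \<le> 6 ^ CARD('n) * 2 powr (- \<delta> * real_of_int \<bar>j\<bar>)" by (intro mult_right_mono six) auto
    finally show ?thesis .
  qed
qed

text \<open>The factors are, in this order, the constant of \<open>dyadic_representation\<close>,
  the price of moving the power \<open>q\<close> inside a sum over scales, the comparison with
  \<open>dmaximal\<close>, the replacement of the weight by its averages, and the sum over
  \<open>j\<close> of the bounds of \<open>level_sum_le\<close>.\<close>

definition sobolev_const :: "'n::finite itself \<Rightarrow> real \<Rightarrow> real \<Rightarrow> real \<Rightarrow> real \<Rightarrow> real \<Rightarrow> real" where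
  "sobolev_const T K p K\<^sub>A q \<Theta> =
    (let \<delta> = min (\<Theta> * q) (real CARD('n) - \<Theta> * q) / 2
     in (real CARD('n) * 4 ^ CARD('n)) powr q * (2 / (1 - 2 powr (- (\<delta> / q)))) powr q * 6 powr (\<Theta> * q) * K powr (q / p) *
        (\<bar>A_p_weight.level_const TYPE('n) K p K\<^sub>A q\<bar> * (6 ^ CARD('n) * (2 / (1 - 2 powr (- \<delta>))))))"

lemma weighted_sobolev:
  fixes u :: "real ^ 'n \<Rightarrow> real" and f g :: "real ^ 'n \<Rightarrow> real"
  assumes W: "A_p_weight u K p K\<^sub>A" and v: "AE x in lebesgue. v x = ennreal (u x)"
    and q: "p \<le> q" and \<Theta>: "\<Theta> = 1 + real CARD('n) * (1 / q - 1 / p)" "0 < \<Theta>" "q < real CARD('n) / \<Theta>"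
    and f: "f \<in> C1_0" and g: "integrable lebesgue g" "0 < (LINT y|lebesgue. \<bar>g y\<bar>)"
    and T: "integrable lebesgue (\<lambda>x. norm (gradient f x) powr p * u x)"
  shows "(\<integral>\<^sup>+x. ennreal \<bar>f x\<bar> epowr q * maximal_function g x epowr (\<Theta> * q / real CARD('n)) * v x epowr (q / p) \<partial>lebesgue)
    \<le> ennreal (sobolev_const TYPE('n) K p K\<^sub>A q \<Theta> * (LINT y|lebesgue. \<bar>g y\<bar>) powr (\<Theta> * q / real CARD('n)) *
        (LINT x|lebesgue. norm (gradient f x) powr p * u x) powr (q / p))"
proof -
  interpret A_p_weight u K p K\<^sub>A by (rule W)
  define F where "F x = norm (gradient f x)" for x
  have F0: "0 \<le> F x" for x by (simp add: F_def)
  have Fc: "continuous_on UNIV F"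
    unfolding F_def using f by (intro continuous_on_norm) (simp add: C1_0_def)
  have FT: "integrable lebesgue (\<lambda>x. F x powr p * u x)" using T by (simp add: F_def)
  define M where "M = (LINT y|lebesgue. \<bar>g y\<bar>)"
  have M: "M > 0" using g by (simp add: M_def)
  define T' where "T' = (LINT x|lebesgue. F x powr p * u x)"
  let ?n = "real CARD('n)"
  have q0: "q > 0" using p q by simp
  define \<alpha> where "\<alpha> = \<Theta> * q"
  have \<alpha>: "0 < \<alpha>" "\<alpha> < ?n" using \<Theta>(2,3) q0 by (auto simp: \<alpha>_def field_simps)
  define \<delta> where "\<delta> = min \<alpha> (?n - \<alpha>) / 2"
  have \<delta>: "0 < \<delta>" using \<alpha> by (simp add: \<delta>_def)
  define e where "e = \<delta> / q"
  have e: "0 < e" "e * q = \<delta>" using \<delta> q0 by (auto simp: e_def)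
  define C where "C = ?n * 4 ^ CARD('n)"
  have C: "C > 0" by (simp add: C_def)
  define S where "S = 2 / (1 - 2 powr (- e))"
  have S: "S > 0" using e by (simp add: S_def powr_less_one)
  define Z where "Z = S powr q * (6 powr \<alpha> * M powr (\<alpha> / ?n)) * (C powr q * K powr (q / p))"
  have Z: "Z \<ge> 0" using S M by (simp add: Z_def)
  define L where "L x = ennreal \<bar>f x\<bar> epowr q * maximal_function g x epowr (\<alpha> / ?n) * v x epowr (q / p)" for x
  let ?t = "\<lambda>i x. A_p_weight.level_term u p F q (i, dindex i x)"
  have t0: "0 \<le> ?t i x" for i x by (rule level_term_nonneg[OF F0 Fc FT])
  define c where "c j = 2 powr (\<delta> * real_of_int \<bar>j\<bar> + \<alpha> * real_of_int j)" for j :: int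
  \<comment> \<open>The pair \<open>z\<close> is \<open>(j, i)\<close> with the offset
    \<open>j\<close> and the scale \<open>i\<close>. At a point of level \<open>k\<close> the
    indicator leaves only \<open>i = k + j\<close> for each \<open>j\<close>; summing over all
    \<open>i\<close> removes the dependence of the index set on the point, so that sums and integral
    can be exchanged.\<close>
  define h where "h z x = ennreal (c (fst z)) * (ennreal (?t (snd z) x) * indicator (dmax_level g (snd z - fst z)) x)" for z :: "int \<times> int" and x
  have gm: "g \<in> borel_measurable lebesgue" using g by auto
  have pt: "L x \<le> ennreal Z * (\<integral>\<^sup>+z. h z x \<partial>count_space UNIV)"
    if x: "v x = ennreal (u x)" "dmaximal g x \<noteq> \<infinity>" "\<And>Q. x \<in> dcube Q \<Longrightarrow> u x \<le> K * davg u Q" for x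
  proof (cases "dmaximal g x = 0")
    \<comment> \<open>The levels cover only points where the dyadic maximal function is positive and
      finite; where it is zero the integrand vanishes.\<close>
    case True
    then have "maximal_function g x = 0" using maximal_function_le_dmaximal[OF gm, of x] by simp
    then have "L x = 0" using \<alpha> by (simp add: L_def epowr_def)
    then show ?thesis by simp
  next
    case False
    then obtain k where k: "x \<in> dmax_level g k" using dmax_level_cover[OF g(2)] x(2) by blast
    define b where "b i = C * (2 powr real_of_int i * davg F (i, dindex i x))" for i
    have b0: "0 \<le> b i" for i using C davg_nonneg[where h = F, OF F0] by (simp add: b_def)
    have "ennreal \<bar>f x\<bar> \<le> (\<integral>\<^sup>+i. ennreal (b i) \<partial>count_space UNIV)"
    proof -
      have "ennreal \<bar>f x\<bar> \<le> ennreal C * (\<integral>\<^sup>+i. ennreal (2 powr real_of_int i * davg F (i, dindex i x)) \<partial>count_space UNIV)"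
        using dyadic_representation[OF f, of x] by (simp add: C_def F_def[abs_def])
      also have "\<dots> = (\<integral>\<^sup>+i. ennreal (b i) \<partial>count_space UNIV)"
        unfolding b_def using C davg_nonneg[where h = F, OF F0]
        by (subst nn_integral_cmult[symmetric]) (auto simp: ennreal_mult)
      finally show ?thesis .
    qed
    \<comment> \<open>From here on scales are counted from the level \<open>k\<close> of
      \<open>x\<close>.\<close>
    also have "\<dots> = (\<integral>\<^sup>+j. ennreal (b (k + j)) \<partial>count_space UNIV)"
      by (rule nn_integral_bij_count_space[symmetric])
         (rule bij_betw_byWitness[where f' = "\<lambda>i. i - k"], auto)
    finally have "ennreal \<bar>f x\<bar> epowr q \<le> (\<integral>\<^sup>+j. ennreal (b (k + j)) \<partial>count_space UNIV) epowr q"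
      by (rule epowr_mono[OF _ q0])
    also have "\<dots> \<le> ennreal (S powr q) * (\<integral>\<^sup>+j. ennreal ((2 powr (e * real_of_int \<bar>j\<bar>) * b (k + j)) powr q) \<partial>count_space UNIV)"
      unfolding S_def by (rule nn_integral_int_powr_le[OF b0 q0 e(1)])
    finally have f_le: "ennreal \<bar>f x\<bar> epowr q \<le> ennreal (S powr q) * (\<integral>\<^sup>+j. ennreal ((2 powr (e * real_of_int \<bar>j\<bar>) * b (k + j)) powr q) \<partial>count_space UNIV)" .
    have M_le: "maximal_function g x epowr (\<alpha> / ?n) \<le> ennreal (6 powr \<alpha> * M powr (\<alpha> / ?n) * 2 powr (- (\<alpha> * real_of_int k)))"
    proof -
      have "maximal_function g x \<le> ennreal (6 ^ CARD('n)) * dmaximal g x" by (rule maximal_function_le_dmaximal[OF gm])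
      also have "\<dots> \<le> ennreal (6 ^ CARD('n)) * ennreal (dvol TYPE('n) (- k) * M)"
        using k by (intro mult_left_mono) (auto simp: dmax_level_def M_def)
      also have "\<dots> = ennreal (6 powr ?n * (dvol TYPE('n) (- k) * M))"
        using M by (simp add: ennreal_mult less_imp_le[OF dvol_pos] powr_realpow)
      finally have "maximal_function g x epowr (\<alpha> / ?n) \<le> ennreal ((6 powr ?n * (dvol TYPE('n) (- k) * M)) powr (\<alpha> / ?n))"
        using epowr_mono[of _ _ "\<alpha> / ?n"] \<alpha> M by (simp add: epowr_ennreal[symmetric] less_imp_le[OF dvol_pos])
      also have "(6 powr ?n * (dvol TYPE('n) (- k) * M)) powr (\<alpha> / ?n) = 6 powr \<alpha> * M powr (\<alpha> / ?n) * 2 powr (- (\<alpha> * real_of_int k))"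
        using M by (simp add: powr_mult powr_powr dvol_def mult.commute[of \<alpha>])
      finally show ?thesis .
    qed
    have v_eq: "v x epowr (q / p) = ennreal (u x powr (q / p))"
      unfolding x(1) by (rule epowr_ennreal) (use u_nonneg p q0 in auto)
    have term_le: "(2 powr (e * real_of_int \<bar>j\<bar>) * b (k + j)) powr q * 2 powr (- (\<alpha> * real_of_int k)) * u x powr (q / p)
        \<le> (C powr q * K powr (q / p)) * (c j * ?t (k + j) x)" for j
    proof -
      define i where "i = k + j"
      define A where "A = davg F (i, dindex i x)"
      define U where "U = davg u (i, dindex i x)"
      have A: "0 \<le> A" unfolding A_def by (rule davg_nonneg[OF F0])
      have U: "0 < U" unfolding U_def by (rule davg_pos)
      have "u x powr (q / p) \<le> (K * U) powr (q / p)"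
        unfolding U_def using u_nonneg p q0 x(3)[OF mem_dcube_dindex] by (intro powr_mono2) auto
      also have "\<dots> = K powr (q / p) * U powr (q / p)" using K_pos U by (simp add: powr_mult)
      finally have u_le: "u x powr (q / p) \<le> K powr (q / p) * U powr (q / p)" .
      have "(2 powr (e * real_of_int \<bar>j\<bar>) * b i) powr q = 2 powr (\<delta> * real_of_int \<bar>j\<bar>) * (C powr q * (2 powr (q * real_of_int i) * A powr q))"
      proof -
        have "(2 powr (e * real_of_int \<bar>j\<bar>)) powr q = 2 powr (\<delta> * real_of_int \<bar>j\<bar>)"
          unfolding powr_powr e(2)[symmetric] by (simp only: mult_ac)
        moreover have "(2 powr real_of_int i) powr q = 2 powr (q * real_of_int i)"
          by (simp only: powr_powr mult.commute)
        moreover have "(w * (C * (y * A))) powr q = w powr q * (C powr q * (y powr q * A powr q))" if "0 \<le> w" "0 \<le> y" for w y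
          using C A that by (simp add: powr_mult)
        ultimately show ?thesis unfolding b_def A_def[symmetric] by simp
      qed
      then have "(2 powr (e * real_of_int \<bar>j\<bar>) * b i) powr q * 2 powr (- (\<alpha> * real_of_int k)) * u x powr (q / p)
          = C powr q * A powr q * (2 powr (\<delta> * real_of_int \<bar>j\<bar>) * 2 powr (q * real_of_int i) * 2 powr (- (\<alpha> * real_of_int k))) * u x powr (q / p)"
        by (simp add: mult_ac)
      also have "2 powr (\<delta> * real_of_int \<bar>j\<bar>) * 2 powr (q * real_of_int i) * 2 powr (- (\<alpha> * real_of_int k)) = c j * dvol TYPE('n) i powr (q / p - 1)"
      proof -
        \<comment> \<open>The value of \<open>\<Theta>\<close> is used here: the power
          \<open>q - \<alpha>\<close> of the side length is the power \<open>q / p - 1\<close> of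
          the volume.\<close>
        have "?n * (q / p - 1) = q - \<alpha>"
          using p q0 by (simp add: \<alpha>_def \<Theta>(1) field_simps)
        then have "?n * real_of_int i * (q / p - 1) = (q - \<alpha>) * real_of_int i" by (metis mult.assoc mult.commute)
        then have dv: "dvol TYPE('n) i powr (q / p - 1) = 2 powr ((q - \<alpha>) * real_of_int i)"
          unfolding dvol_def powr_powr by (simp only:)
        have "\<delta> * real_of_int \<bar>j\<bar> + q * real_of_int i + - (\<alpha> * real_of_int k) = \<delta> * real_of_int \<bar>j\<bar> + \<alpha> * real_of_int j + (q - \<alpha>) * real_of_int i"
          by (simp add: i_def algebra_simps)
        then show ?thesis unfolding dv c_def powr_add[symmetric] by (simp only:)
      qed
      also have "C powr q * A powr q * (c j * dvol TYPE('n) i powr (q / p - 1)) * u x powr (q / p)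
          \<le> C powr q * A powr q * (c j * dvol TYPE('n) i powr (q / p - 1)) * (K powr (q / p) * U powr (q / p))"
        by (intro mult_left_mono u_le) (auto simp: c_def)
      also have "\<dots> = (C powr q * K powr (q / p)) * (c j * ?t i x)"
        by (simp add: level_term_def[OF F0 Fc FT] A_def U_def mult_ac)
      finally show ?thesis by (simp add: i_def)
    qed
    have "L x \<le> ennreal (S powr q) * (\<integral>\<^sup>+j. ennreal ((2 powr (e * real_of_int \<bar>j\<bar>) * b (k + j)) powr q) \<partial>count_space UNIV)
        * ennreal (6 powr \<alpha> * M powr (\<alpha> / ?n) * 2 powr (- (\<alpha> * real_of_int k))) * ennreal (u x powr (q / p))"
      unfolding L_def v_eq by (intro mult_mono f_le M_le) auto
    also have "\<dots> = ennreal (S powr q * (6 powr \<alpha> * M powr (\<alpha> / ?n))) *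
        (ennreal (2 powr (- (\<alpha> * real_of_int k)) * u x powr (q / p)) * (\<integral>\<^sup>+j. ennreal ((2 powr (e * real_of_int \<bar>j\<bar>) * b (k + j)) powr q) \<partial>count_space UNIV))"
      by (simp add: ennreal_mult mult_ac)
    also have "ennreal (2 powr (- (\<alpha> * real_of_int k)) * u x powr (q / p)) * (\<integral>\<^sup>+j. ennreal ((2 powr (e * real_of_int \<bar>j\<bar>) * b (k + j)) powr q) \<partial>count_space UNIV)
        = (\<integral>\<^sup>+j. ennreal ((2 powr (e * real_of_int \<bar>j\<bar>) * b (k + j)) powr q * 2 powr (- (\<alpha> * real_of_int k)) * u x powr (q / p)) \<partial>count_space UNIV)"
      by (subst nn_integral_cmult[symmetric]) (auto simp: ennreal_mult mult_ac)
    also have "\<dots> \<le> (\<integral>\<^sup>+j. ennreal (C powr q * K powr (q / p)) * ennreal (c j * ?t (k + j) x) \<partial>count_space UNIV)"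
    proof (rule nn_integral_mono)
      fix j
      have "0 \<le> c j * ?t (k + j) x" using t0 by (simp add: c_def)
      then have "ennreal (C powr q * K powr (q / p)) * ennreal (c j * ?t (k + j) x) = ennreal ((C powr q * K powr (q / p)) * (c j * ?t (k + j) x))"
        by (intro ennreal_mult[symmetric]) auto
      then show "ennreal ((2 powr (e * real_of_int \<bar>j\<bar>) * b (k + j)) powr q * 2 powr (- (\<alpha> * real_of_int k)) * u x powr (q / p))
          \<le> ennreal (C powr q * K powr (q / p)) * ennreal (c j * ?t (k + j) x)"
        using ennreal_leI[OF term_le[of j]] by (simp only:)
    qed
    also have "\<dots> = ennreal (C powr q * K powr (q / p)) * (\<integral>\<^sup>+j. ennreal (c j * ?t (k + j) x) \<partial>count_space UNIV)"
      by (rule nn_integral_cmult) simp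
    also have "(\<integral>\<^sup>+j. ennreal (c j * ?t (k + j) x) \<partial>count_space UNIV) \<le> (\<integral>\<^sup>+j. (\<integral>\<^sup>+i. h (j, i) x \<partial>count_space UNIV) \<partial>count_space UNIV)"
    proof (rule nn_integral_mono)
      fix j
      have "ennreal (c j * ?t (k + j) x) = h (j, k + j) x"
        using k t0 by (simp add: h_def ennreal_mult c_def)
      also have "\<dots> \<le> (\<integral>\<^sup>+i. h (j, i) x \<partial>count_space UNIV)"
        using nn_integral_count_space_sum_le[of "{k + j}" "\<lambda>i. h (j, i) x"] by simp
      finally show "ennreal (c j * ?t (k + j) x) \<le> (\<integral>\<^sup>+i. h (j, i) x \<partial>count_space UNIV)" .
    qed
    also have "\<dots> = (\<integral>\<^sup>+z. h z x \<partial>count_space UNIV)" by (rule nn_integral_fst_count_space)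
    finally have "L x \<le> ennreal (S powr q * (6 powr \<alpha> * M powr (\<alpha> / ?n))) * (ennreal (C powr q * K powr (q / p)) * (\<integral>\<^sup>+z. h z x \<partial>count_space UNIV))"
      by (simp add: mult_left_mono)
    also have "\<dots> = ennreal Z * (\<integral>\<^sup>+z. h z x \<partial>count_space UNIV)"
      by (simp add: Z_def ennreal_mult mult_ac)
    finally show ?thesis .
  qed
  have hm [measurable]: "h z \<in> borel_measurable lebesgue" for z
  proof -
    have [measurable]: "(\<lambda>x. ennreal (?t (snd z) x)) \<in> borel_measurable lebesgue" by (rule measurable_fun_dindex)
    show ?thesis unfolding h_def by measurable
  qed
  \<comment> \<open>There are countably many labels, so one null set serves all cubes.\<close>
  have RH_all: "AE x in lebesgue. \<forall>Q. x \<in> dcube Q \<longrightarrow> u x \<le> K * davg u Q"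
    by (subst AE_all_countable) (use RH_dcube in blast)
  have "(\<integral>\<^sup>+x. L x \<partial>lebesgue) \<le> (\<integral>\<^sup>+x. ennreal Z * (\<integral>\<^sup>+z. h z x \<partial>count_space UNIV) \<partial>lebesgue)"
  proof (rule nn_integral_mono_AE)
    show "AE x in lebesgue. L x \<le> ennreal Z * (\<integral>\<^sup>+z. h z x \<partial>count_space UNIV)"
      using v dmaximal_finite_AE[OF g(1)] RH_all by eventually_elim (rule pt, auto)
  qed
  also have "\<dots> = (\<integral>\<^sup>+x. (\<integral>\<^sup>+z. ennreal Z * h z x \<partial>count_space UNIV) \<partial>lebesgue)"
    by (simp add: nn_integral_cmult)
  also have "\<dots> = (\<integral>\<^sup>+z. (\<integral>\<^sup>+x. ennreal Z * h z x \<partial>lebesgue) \<partial>count_space UNIV)"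
    by (rule nn_integral_count_space_nn_integral) auto
  also have "\<dots> = ennreal Z * (\<integral>\<^sup>+z. (\<integral>\<^sup>+x. h z x \<partial>lebesgue) \<partial>count_space UNIV)"
    by (simp add: nn_integral_cmult)
  also have "(\<integral>\<^sup>+z. (\<integral>\<^sup>+x. h z x \<partial>lebesgue) \<partial>count_space UNIV) = (\<integral>\<^sup>+j. (\<integral>\<^sup>+i. (\<integral>\<^sup>+x. h (j, i) x \<partial>lebesgue) \<partial>count_space UNIV) \<partial>count_space UNIV)"
    by (rule nn_integral_fst_count_space[symmetric])
  also have "\<dots> \<le> (\<integral>\<^sup>+j. ennreal (\<bar>level_const q\<bar> * T' powr (q / p) * 6 ^ CARD('n)) * ennreal (2 powr (- \<delta> * real_of_int \<bar>j\<bar>)) \<partial>count_space UNIV)"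
  proof (rule nn_integral_mono)
    fix j
    have "(\<integral>\<^sup>+i. (\<integral>\<^sup>+x. h (j, i) x \<partial>lebesgue) \<partial>count_space UNIV)
        = (\<integral>\<^sup>+i. ennreal (c j) * (\<integral>\<^sup>+x\<in>dmax_level g (i - j). ennreal (?t i x) \<partial>lebesgue) \<partial>count_space UNIV)"
    proof (rule nn_integral_cong)
      fix i
      have [measurable]: "(\<lambda>x. ennreal (?t i x)) \<in> borel_measurable lebesgue" by (rule measurable_fun_dindex)
      show "(\<integral>\<^sup>+x. h (j, i) x \<partial>lebesgue) = ennreal (c j) * (\<integral>\<^sup>+x\<in>dmax_level g (i - j). ennreal (?t i x) \<partial>lebesgue)"
        unfolding h_def fst_conv snd_conv by (rule nn_integral_cmult) measurable
    qed
    also have "\<dots> = ennreal (c j) * (\<integral>\<^sup>+i. (\<integral>\<^sup>+x\<in>dmax_level g (i - j). ennreal (?t i x) \<partial>lebesgue) \<partial>count_space UNIV)"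
      by (rule nn_integral_cmult) simp
    also have "\<dots> \<le> ennreal (c j) * ennreal (level_const q * level_decay TYPE('n) j * T' powr (q / p))"
      unfolding T'_def by (intro mult_left_mono level_sum_le[OF F0 Fc FT q g]) auto
    also have "\<dots> \<le> ennreal (c j) * ennreal (\<bar>level_const q\<bar> * level_decay TYPE('n) j * T' powr (q / p))"
      by (intro mult_left_mono ennreal_leI mult_right_mono) (auto simp: less_imp_le[OF level_decay_pos])
    also have "\<dots> = ennreal (\<bar>level_const q\<bar> * T' powr (q / p) * (c j * level_decay TYPE('n) j))"
      by (subst ennreal_mult[symmetric]) (auto simp: c_def less_imp_le[OF level_decay_pos] mult_ac)
    also have "\<dots> \<le> ennreal (\<bar>level_const q\<bar> * T' powr (q / p) * (6 ^ CARD('n) * 2 powr (- \<delta> * real_of_int \<bar>j\<bar>)))"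
      unfolding c_def by (intro ennreal_leI mult_left_mono level_decay_le \<alpha> \<delta>_def) auto
    also have "\<dots> = ennreal (\<bar>level_const q\<bar> * T' powr (q / p) * 6 ^ CARD('n)) * ennreal (2 powr (- \<delta> * real_of_int \<bar>j\<bar>))"
      by (subst ennreal_mult[symmetric]) (auto simp: mult.assoc)
    finally show "(\<integral>\<^sup>+i. (\<integral>\<^sup>+x. h (j, i) x \<partial>lebesgue) \<partial>count_space UNIV) \<le> \<dots>" .
  qed
  also have "\<dots> = ennreal (\<bar>level_const q\<bar> * T' powr (q / p) * 6 ^ CARD('n)) * (\<integral>\<^sup>+j. ennreal (2 powr (- \<delta> * real_of_int \<bar>j\<bar>)) \<partial>count_space UNIV)"
    by (rule nn_integral_cmult) simp
  also have "\<dots> \<le> ennreal (\<bar>level_const q\<bar> * T' powr (q / p) * 6 ^ CARD('n)) * ennreal (2 / (1 - 2 powr (- \<delta>)))"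
    by (intro mult_left_mono nn_integral_int_geometric \<delta>) auto
  finally have "(\<integral>\<^sup>+x. L x \<partial>lebesgue) \<le> ennreal Z * (ennreal (\<bar>level_const q\<bar> * T' powr (q / p) * 6 ^ CARD('n)) * ennreal (2 / (1 - 2 powr (- \<delta>))))"
    by (simp add: mult_left_mono)
  also have "\<dots> = ennreal (Z * (\<bar>level_const q\<bar> * T' powr (q / p) * 6 ^ CARD('n) * (2 / (1 - 2 powr (- \<delta>)))))"
  proof -
    have D: "0 \<le> 2 / (1 - 2 powr (- \<delta>))" using \<delta> by (simp add: powr_less_one less_imp_le)
    have P: "0 \<le> \<bar>level_const q\<bar> * T' powr (q / p) * 6 ^ CARD('n)" by simp
    show ?thesis
      unfolding ennreal_mult[OF P D, symmetric] by (rule ennreal_mult[OF Z mult_nonneg_nonneg[OF P D], symmetric])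
  qed
  also have "Z * (\<bar>level_const q\<bar> * T' powr (q / p) * 6 ^ CARD('n) * (2 / (1 - 2 powr (- \<delta>)))) =
      sobolev_const TYPE('n) K p K\<^sub>A q \<Theta> * M powr (\<alpha> / ?n) * T' powr (q / p)"
    by (simp add: sobolev_const_def Let_def Z_def \<delta>_def \<alpha>_def C_def S_def e_def mult_ac)
  finally show ?thesis
    by (simp only: L_def[abs_def] M_def T'_def \<alpha>_def F_def)
qed

theorem theorem6p8:
  fixes p q p' \<Theta> :: real and K\<^sub>A K\<^sub>R :: ennreal
  assumes "CARD('n::finite) > 1"
    and "1 < p" and "p \<le> q"
    and "\<Theta> = 1 + real CARD('n) * (1 / q - 1 / p)" and "\<Theta> > 0"
    and "q < real CARD('n) / \<Theta>"
    and "1 / p + 1 / p' = 1"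
  shows "\<exists>C::real. C > 0 \<and>
    (\<forall>v :: real ^ 'n \<Rightarrow> ennreal.
       v \<in> RH_inf \<and> (\<lambda>x. v x epowr (- p' / p)) \<in> A_inf \<and>
       RH_inf_const v = K\<^sub>R \<and> A_inf_const (\<lambda>x. v x epowr (- p' / p)) = K\<^sub>A \<longrightarrow>
       (\<forall>f\<in>C1_0. \<forall>g :: real ^ 'n \<Rightarrow> real. integrable lebesgue g \<longrightarrow>
          (\<integral>\<^sup>+x. ennreal \<bar>f x\<bar> epowr q
                 * maximal_function g x epowr (\<Theta> * q / real CARD('n))
                 * v x epowr (q / p) \<partial>lebesgue) epowr (1 / q)
          \<le> ennreal C * (\<integral>\<^sup>+x. ennreal \<bar>g x\<bar> \<partial>lebesgue) epowr (\<Theta> / real CARD('n))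
             * (\<integral>\<^sup>+x. ennreal (norm (gradient f x)) epowr p * v x \<partial>lebesgue) epowr (1 / p)))"
proof -
  \<comment> \<open>The constant has to be fixed before \<open>v\<close>, from the two weight
    constants alone. Adding one makes \<open>K\<close> and \<open>K'\<close> positive, as the
    locales require, also if a weight constant is zero.\<close>
  define K where "K = enn2real K\<^sub>R + 1"
  define K' where "K' = enn2real K\<^sub>A + 1"
  have K: "0 < K" "0 < K'" by (auto simp: K_def K'_def add_nonneg_pos)
  define C0 where "C0 = \<bar>sobolev_const TYPE('n) K p K' q \<Theta>\<bar>"
  define C where "C = C0 powr (1 / q) + 1"
  have C: "C > 0" by (simp add: C_def add_nonneg_pos)
  have q0: "q > 0" "p > 0" using assms by auto
  let ?n = "real CARD('n)"
  have main: "(\<integral>\<^sup>+x. ennreal \<bar>f x\<bar> epowr q * maximal_function g x epowr (\<Theta> * q / ?n) * v x epowr (q / p) \<partial>lebesgue) epowr (1 / q)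
      \<le> ennreal C * (\<integral>\<^sup>+x. ennreal \<bar>g x\<bar> \<partial>lebesgue) epowr (\<Theta> / ?n)
        * (\<integral>\<^sup>+x. ennreal (norm (gradient f x)) epowr p * v x \<partial>lebesgue) epowr (1 / p)" (is "?L epowr _ \<le> _ * ?M epowr _ * ?T epowr _")
    if v: "v \<in> RH_inf" and s: "(\<lambda>x. v x epowr (- p' / p)) \<in> A_inf"
      and KR: "RH_inf_const v = K\<^sub>R" and KA: "A_inf_const (\<lambda>x. v x epowr (- p' / p)) = K\<^sub>A"
      and f: "f \<in> C1_0" and g: "integrable lebesgue g"
    for v and f g :: "real ^ 'n \<Rightarrow> real"
  proof -
    have fin: "K\<^sub>R < \<infinity>" "K\<^sub>A < \<infinity>" using v s KR KA by (auto simp: RH_inf_def A_inf_def)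
    have le: "c \<le> ennreal (enn2real c + 1)" if "c < \<infinity>" for c :: ennreal
      using that by (cases c) (auto intro: ennreal_leI)
    define u where "u x = enn2real (v x)" for x
    have W: "A_p_weight u K p K'" and veq: "AE x in lebesgue. v x = ennreal (u x)"
      using A_p_weight_of_RH_inf[OF assms(2) assms(7) v s, of K K'] K fin KR KA le
      by (auto simp: K_def K'_def u_def[abs_def])
    interpret A_p_weight u K p K' by (rule W)
    define M where "M = (LINT y|lebesgue. \<bar>g y\<bar>)"
    have M0: "M \<ge> 0" unfolding M_def by (rule Bochner_Integration.integral_nonneg) auto
    have M: "?M = ennreal M" unfolding M_def using g by (intro nn_integral_eq_integral) auto
    show ?thesis
    proof (cases "M = 0")
      \<comment> \<open>The level sets are scaled by the norm of \<open>g\<close>, so a vanishing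
        norm is treated separately; the left-hand side is then zero.\<close>
      case True
      have "maximal_function g x = 0" for x
      proof -
        have "average Q (\<lambda>y. ennreal \<bar>g y\<bar>) = 0" for Q
        proof -
          have "(\<integral>\<^sup>+y\<in>Q. ennreal \<bar>g y\<bar> \<partial>lebesgue) \<le> ?M" by (intro nn_integral_mono) (auto split: split_indicator)
          then show ?thesis using M True by (simp add: average_def)
        qed
        then show ?thesis unfolding maximal_function_def by (simp add: SUP_constant bot_ennreal)
      qed
      then have "?L = 0" using assms q0 by (simp add: epowr_def)
      then show ?thesis using q0 by (simp add: epowr_def)
    next
      case False
      then have Mpos: "M > 0" using M0 by simp
      have Teq: "?T = (\<integral>\<^sup>+x. ennreal (norm (gradient f x) powr p * u x) \<partial>lebesgue)"
      proof (rule nn_integral_cong_AE)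
        show "AE x in lebesgue. ennreal (norm (gradient f x)) epowr p * v x = ennreal (norm (gradient f x) powr p * u x)"
          using veq by eventually_elim (use q0 u_nonneg in \<open>simp add: epowr_ennreal ennreal_mult\<close>)
      qed
      show ?thesis
      proof (cases "?T = \<infinity>")
        case True
        \<comment> \<open>With infinite energy the right-hand side is infinite only because the
          other factors are nonzero, as \<open>0 * \<infinity> = 0\<close>.\<close>
        have "ennreal C * ?M epowr (\<Theta> / ?n) \<noteq> 0"
          using C Mpos assms(5) unfolding M by (simp add: epowr_ennreal ennreal_eq_0_iff)
        moreover have "\<infinity> epowr (1 / p) = \<infinity>" using q0 by (simp add: epowr_def)
        ultimately show ?thesis using True by (simp add: ennreal_mult_top)
      next
        case Tfin: False
        have [measurable]: "(\<lambda>x. norm (gradient f x)) \<in> borel_measurable lebesgue"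
        proof -
          have "continuous_on UNIV (\<lambda>x. norm (gradient f x))" using f by (intro continuous_on_norm) (simp add: C1_0_def)
          from borel_measurable_continuous_onI[OF this] show ?thesis by (intro measurable_completion) simp
        qed
        have T: "integrable lebesgue (\<lambda>x. norm (gradient f x) powr p * u x)"
        proof (rule integrableI_nonneg)
          show "(\<integral>\<^sup>+x. ennreal (norm (gradient f x) powr p * u x) \<partial>lebesgue) < \<infinity>"
            using Tfin unfolding Teq by (simp add: top.not_eq_extremum)
        qed (use u_nonneg in auto)
        define t where "t = (LINT x|lebesgue. norm (gradient f x) powr p * u x)"
        have t0: "t \<ge> 0" unfolding t_def by (rule Bochner_Integration.integral_nonneg) (use u_nonneg in auto)
        have Tt: "?T = ennreal t" unfolding Teq t_def using u_nonneg by (intro nn_integral_eq_integral T) auto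
        have "?L \<le> ennreal (sobolev_const TYPE('n) K p K' q \<Theta> * M powr (\<Theta> * q / ?n) * t powr (q / p))"
          unfolding M_def t_def
          by (rule weighted_sobolev[OF W veq assms(3-6) f g _ T]) (use Mpos in \<open>simp add: M_def\<close>)
        also have "\<dots> \<le> ennreal (C0 * M powr (\<Theta> * q / ?n) * t powr (q / p))"
          unfolding C0_def by (intro ennreal_leI mult_right_mono) auto
        finally have "?L epowr (1 / q) \<le> ennreal ((C0 * M powr (\<Theta> * q / ?n) * t powr (q / p)) powr (1 / q))"
          using epowr_mono[of _ _ "1 / q"] q0 by (simp add: epowr_ennreal[symmetric] C0_def)
        also have "(C0 * M powr (\<Theta> * q / ?n) * t powr (q / p)) powr (1 / q) = C0 powr (1 / q) * M powr (\<Theta> / ?n) * t powr (1 / p)"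
          using q0 M0 t0 by (simp add: powr_mult powr_powr C0_def)
        also have "ennreal \<dots> \<le> ennreal (C * M powr (\<Theta> / ?n) * t powr (1 / p))"
          unfolding C_def by (intro ennreal_leI mult_right_mono) auto
        also have "\<dots> = ennreal C * ?M epowr (\<Theta> / ?n) * ?T epowr (1 / p)"
          unfolding M Tt using M0 t0 q0 assms(5) C by (simp add: epowr_ennreal ennreal_mult)
        finally show ?thesis .
      qed
    qed
  qed
  show ?thesis using C main by blast
qed

end
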